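(* Let $n\ge 7$ be an integer and let $l$ be a real number. Suppose $(u_0,u_1)\in (H^{l+1}(\mathbf{R}^n)\cap L^{1,1}(\mathbf{R}^n))\times(H^{l}(\mathbf{R}^n)\cap L^{1,1}(\mathbf{R}^n))$, and let $u\in X_2$ be the solution of the Cauchy problem $$u_{tt}-\Delta u_{tt}+\Delta^2u-\Delta u+u_t=0 \ \text{ in } (0,\infty)\times\mathbf{R}^n,\qquad u(0,x)=u_0(x),\quad u_t(0,x)=u_1(x).$$ Then, for all $t\ge 1$, $$\left\|\hat u(t,\xi)-\left(\hat u_1(\xi)\, e^{-\frac{t}{2|\xi|^2}}\frac{\sin(t|\xi|)}{|\xi|}+\hat u_0(\xi)\, e^{-\frac{t}{2|\xi|^2}}\cos(t|\xi|)\right)\right\|_2\le\begin{cases} C I_0\, t^{-\frac{l+3}{2}}, & \text{if } n\ge 10 \text{ and } 2\le l\le \frac n2-3,\\[1mm] C I_0\, t^{-\frac n4}, & \text{if } n\in\{7,8,9\} \text{ and } 2\le l<\frac n2-1,\\ & \text{or if } n\ge 10 \text{ and } \frac n2-3<l<\frac n2-1,\end{cases}$$ where $C>0$ is a constant independent of $t$ and of $u_0,u_1$.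
   Context: The Fourier transform (in $x$) is $\hat f(\xi)=\int_{\mathbf{R}^n}f(x)e^{-i\xi\cdot x}\,dx$. $\|\cdot\|_p$ is the $L^p(\mathbf{R}^n)$ norm; for functions of $(t,\xi)$, $\|\cdot\|_2$ is the $L^2$ norm in $\xi\in\mathbf{R}^n$. For real $l\ge 0$, $\|f\|_{H^l}=\left(\int_{\mathbf{R}^n}(1+|\xi|^2)^l|\hat f(\xi)|^2d\xi\right)^{1/2}$. $L^{1,1}(\mathbf{R}^n)$ is the set of $f\in L^1(\mathbf{R}^n)$ with $\|f\|_{1,1}:=\int_{\mathbf{R}^n}(1+|x|)|f(x)|dx<\infty$. The solution class is $X_2:=C^2([0,\infty);H^1(\mathbf{R}^n))\cap C^1([0,\infty);H^2(\mathbf{R}^n))\cap C([0,\infty);H^3(\mathbf{R}^n))$. It is known that for $(u_0,u_1)\in H^3(\mathbf{R}^n)\times H^2(\mathbf{R}^n)$ the Cauchy problem has a unique solution in $X_2$. Put $I_0:=\|u_1\|_{H^l}+\|u_0\|_{H^{l+1}}+\|u_1\|_{1,1}+\|u_0\|_{1,1}$. *)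

theory Defs
  imports "HOL-Analysis.Analysis"
begin

text \<open>
  Elements of \<open>L\<^sup>2\<close> and of the Sobolev spaces are represented by Borel functions; every class of
  Lebesgue measurable functions modulo null sets contains one.
\<close>

definition L2_space :: "('a::euclidean_space \<Rightarrow> complex) set" where
  "L2_space = {f \<in> borel_measurable lborel. integrable lborel (\<lambda>x. (norm (f x))\<^sup>2)}"

definition L2_norm :: "('a::euclidean_space \<Rightarrow> complex) \<Rightarrow> real" where
  "L2_norm f = sqrt (LINT x|lborel. (norm (f x))\<^sup>2)"

definition L11_space :: "('a::euclidean_space \<Rightarrow> complex) set" where
  "L11_space =
    {f. integrable lborel f \<and> integrable lborel (\<lambda>x. (1 + norm x) * norm (f x))}"

definition L11_norm :: "('a::euclidean_space \<Rightarrow> complex) \<Rightarrow> real" where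
  "L11_norm f = (LINT x|lborel. (1 + norm x) * norm (f x))"

definition fourier_integral ::
    "('a::euclidean_space \<Rightarrow> complex) \<Rightarrow> 'a \<Rightarrow> complex" where
  "fourier_integral f \<xi> =
    (LINT x|lborel. f x * exp (- (\<i> * complex_of_real (\<xi> \<bullet> x))))"

text \<open>
  The Fourier transform on \<open>L\<^sup>2\<close>, as the \<open>L\<^sup>2\<close> limit of the integrals over balls. By Plancherel's
  theorem every \<open>f\<close> in \<open>L\<^sup>2\<close> is related to some \<open>g\<close>, which is unique up to null sets. The
  distance is measured in \<open>ennreal\<close>, so that it is not \<open>0\<close> by default when an integral diverges.
\<close>

definition has_fourier_L2 ::
    "('a::euclidean_space \<Rightarrow> complex) \<Rightarrow> ('a \<Rightarrow> complex) \<Rightarrow> bool" where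
  "has_fourier_L2 f g \<longleftrightarrow>
    f \<in> L2_space \<and> g \<in> L2_space \<and>
    ((\<lambda>R::real. \<integral>\<^sup>+ \<xi>. ennreal
        ((norm (fourier_integral (\<lambda>x. indicator (cball 0 R) x *\<^sub>R f x) \<xi> - g \<xi>))\<^sup>2) \<partial>lborel)
      \<longlongrightarrow> 0) at_top"

definition fourier :: "('a::euclidean_space \<Rightarrow> complex) \<Rightarrow> 'a \<Rightarrow> complex" where
  "fourier f =
    (if integrable lborel f then fourier_integral f else (SOME g. has_fourier_L2 f g))"

definition sobolev :: "real \<Rightarrow> ('a::euclidean_space \<Rightarrow> complex) set" where
  "sobolev s =
    {f. \<exists>g. has_fourier_L2 f g \<and>
        integrable lborel (\<lambda>\<xi>. (1 + (norm \<xi>)\<^sup>2) powr s * (norm (g \<xi>))\<^sup>2)}"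

definition sobolev_norm :: "real \<Rightarrow> ('a::euclidean_space \<Rightarrow> complex) \<Rightarrow> real" where
  "sobolev_norm s f =
    sqrt (LINT \<xi>|lborel. (1 + (norm \<xi>)\<^sup>2) powr s * (norm (fourier f \<xi>))\<^sup>2)"

text \<open>
  A function of time is only considered on \<open>[0,\<infinity>)\<close>; limits at time \<open>0\<close> are one-sided. Time
  derivatives are limits of difference quotients in the Sobolev norm.
\<close>

definition has_sobolev_deriv ::
    "real \<Rightarrow> (real \<Rightarrow> 'a::euclidean_space \<Rightarrow> complex) \<Rightarrow> (real \<Rightarrow> 'a \<Rightarrow> complex) \<Rightarrow> bool" where
  "has_sobolev_deriv s u v \<longleftrightarrow>
    (\<forall>t\<ge>0. u t \<in> sobolev s \<and> v t \<in> sobolev s \<and>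
      ((\<lambda>\<tau>. sobolev_norm s (\<lambda>x. (u \<tau> x - u t x) /\<^sub>R (\<tau> - t) - v t x)) \<longlongrightarrow> 0)
        (at t within {0..}))"

primrec Ck_sobolev ::
    "nat \<Rightarrow> real \<Rightarrow> (real \<Rightarrow> 'a::euclidean_space \<Rightarrow> complex) set" where
  "Ck_sobolev 0 s =
    {u. \<forall>t\<ge>0. u t \<in> sobolev s \<and>
      ((\<lambda>\<tau>. sobolev_norm s (\<lambda>x. u \<tau> x - u t x)) \<longlongrightarrow> 0) (at t within {0..})}"
| "Ck_sobolev (Suc k) s = {u. \<exists>v \<in> Ck_sobolev k s. has_sobolev_deriv s u v}"

definition X2 :: "(real \<Rightarrow> 'a::euclidean_space \<Rightarrow> complex) set" where
  "X2 = Ck_sobolev 2 1 \<inter> Ck_sobolev 1 2 \<inter> Ck_sobolev 0 3"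

definition partial_deriv ::
    "'a::euclidean_space \<Rightarrow> ('a \<Rightarrow> real) \<Rightarrow> 'a \<Rightarrow> real" where
  "partial_deriv b f x = frechet_derivative f (at x) b"

primrec Ck_fun :: "nat \<Rightarrow> ('a::euclidean_space \<Rightarrow> real) set" where
  "Ck_fun 0 = {f. continuous_on UNIV f}"
| "Ck_fun (Suc k) =
    {f. f differentiable_on UNIV \<and> (\<forall>b\<in>Basis. partial_deriv b f \<in> Ck_fun k)}"

definition test_functions :: "('a::euclidean_space \<Rightarrow> real) set" where
  "test_functions = {\<phi>. (\<forall>k. \<phi> \<in> Ck_fun k) \<and> compact (closure {x. \<phi> x \<noteq> 0})}"

definition laplacian :: "('a::euclidean_space \<Rightarrow> real) \<Rightarrow> 'a \<Rightarrow> real" where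
  "laplacian f x = (\<Sum>b\<in>Basis. partial_deriv b (partial_deriv b f) x)"

text \<open>
  For \<open>u\<close> in \<open>X2\<close> the terms \<open>\<Delta> u\<^sub>t\<^sub>t\<close> and \<open>\<Delta>\<^sup>2 u\<close> lie in \<open>H\<^sup>-\<^sup>1\<close> only, so the equation
  \<open>u\<^sub>t\<^sub>t - \<Delta> u\<^sub>t\<^sub>t + \<Delta>\<^sup>2 u - \<Delta> u + u\<^sub>t = 0\<close> is required at each time \<open>t > 0\<close> in the sense of distributions
  in \<open>x\<close>. The derivatives \<open>v = u\<^sub>t\<close> and \<open>w = u\<^sub>t\<^sub>t\<close> are unique up to null sets at each time.
\<close>

definition cauchy_solution ::
    "('a::euclidean_space \<Rightarrow> complex) \<Rightarrow> ('a \<Rightarrow> complex) \<Rightarrow> (real \<Rightarrow> 'a \<Rightarrow> complex) \<Rightarrow> bool" where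
  "cauchy_solution u\<^sub>0 u\<^sub>1 u \<longleftrightarrow>
    (\<exists>v w. has_sobolev_deriv 1 u v \<and> has_sobolev_deriv 1 v w \<and>
      (AE x in lborel. u 0 x = u\<^sub>0 x) \<and> (AE x in lborel. v 0 x = u\<^sub>1 x) \<and>
      (\<forall>t>0. \<forall>\<phi>\<in>test_functions.
        (LINT x|lborel.
            (\<phi> x - laplacian \<phi> x) *\<^sub>R w t x
          + (laplacian (laplacian \<phi>) x - laplacian \<phi> x) *\<^sub>R u t x
          + \<phi> x *\<^sub>R v t x) = 0))"

definition data_size ::
    "real \<Rightarrow> ('a::euclidean_space \<Rightarrow> complex) \<Rightarrow> ('a \<Rightarrow> complex) \<Rightarrow> real" where
  "data_size l u\<^sub>0 u\<^sub>1 =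
    sobolev_norm l u\<^sub>1 + sobolev_norm (l + 1) u\<^sub>0 + L11_norm u\<^sub>1 + L11_norm u\<^sub>0"

text \<open>At \<open>\<xi> = 0\<close>, a null set, the quotients take the default value \<open>0\<close>.\<close>

definition profile ::
    "('a::euclidean_space \<Rightarrow> complex) \<Rightarrow> ('a \<Rightarrow> complex) \<Rightarrow> real \<Rightarrow> 'a \<Rightarrow> complex" where
  "profile u\<^sub>0 u\<^sub>1 t \<xi> =
      fourier u\<^sub>1 \<xi> * complex_of_real (exp (- t / (2 * (norm \<xi>)\<^sup>2)) * (sin (t * norm \<xi>) / norm \<xi>))
    + fourier u\<^sub>0 \<xi> * complex_of_real (exp (- t / (2 * (norm \<xi>)\<^sup>2)) * cos (t * norm \<xi>))"

end

theory Submission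
  imports Defs "HOL-Probability.Characteristic_Functions"
begin

text \<open>
  On the Fourier side the equation is an ordinary differential equation in \<open>t\<close> for each frequency,
  \<open>y'' + 2 a y' + r\<^sup>2 y = 0\<close> with \<open>r = \<bar>\<xi>\<bar>\<close> and \<open>a = 1 / (2 (1 + r\<^sup>2))\<close>. Its characteristic roots
  \<open>- a \<plusminus> sqrt (a\<^sup>2 - r\<^sup>2)\<close> explain both rates. For large \<open>r\<close> the solution oscillates with frequency
  \<open>sqrt (r\<^sup>2 - a\<^sup>2) = r + O(r\<^sup>-\<^sup>5)\<close> under the damping \<open>e\<^bsup>-at\<^esup>\<close>, where \<open>a = 1 / (2 r\<^sup>2) + O(r\<^sup>-\<^sup>4)\<close>; it differs from the
  profile by a term of size \<open>t r\<^sup>-\<^sup>5 e\<^bsup>-ct/r\<^sup>2\<^esup>\<close> for \<open>u\<^sub>1\<close> and \<open>t r\<^sup>-\<^sup>4 e\<^bsup>-ct/r\<^sup>2\<^esup>\<close> for \<open>u\<^sub>0\<close>. The damping is lost as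
  \<open>r \<rightarrow> \<infinity>\<close>, so decay has to be bought with regularity: a factor \<open>r\<^bsup>-2p\<^esup>\<close> turns \<open>e\<^bsup>-ct/r\<^sup>2\<^esup>\<close> into \<open>t\<^bsup>-p\<^esup>\<close>, and the
  available \<open>2p = l + 5\<close> leave \<open>t\<^bsup>-(l+3)/2\<^esup>\<close>. For \<open>r \<le> 1\<close> the solution decays like the heat kernel and the
  profile even faster; there the data are bounded by their \<open>L\<^sup>1\<close> norms, and the \<open>L\<^sup>2\<close> norm of
  \<open>e\<^bsup>-ctr\<^sup>2\<^esup>\<close> is of order \<open>t\<^bsup>-n/4\<^esup>\<close>. The slower of the two rates wins, and the comparison of
  \<open>(l + 3) / 2\<close> with \<open>n / 4\<close> gives the case distinction. The pointwise estimates are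
  \<open>low_frequency_bound\<close> and \<open>high_frequency_bound\<close>; \<open>fourier_profile_bound\<close> integrates them.

  The longer part of the argument justifies the passage to the differential equation.
  A Sobolev function comes with an \<open>L\<^sup>2\<close> limit of its truncated Fourier integrals, and linearity and
  uniqueness of that limit suffice to transport the time derivatives (\<open>has_sobolev_deriv_fourier\<close>).
  To transport the equation in space, the distributional equation is tested with all
  translates of a bump, which says that a correlation of the solution with the bump vanishes.
  Truncated to a ball of radius \<open>k\<close>, this correlation is supported near the boundary of the ball and
  tends to \<open>0\<close> in \<open>L\<^sup>2\<close>; by Plancherel's inequality (\<open>Plancherel_le\<close>, from Gaussian weights) so
  does its Fourier transform, which is the transform of the equation times that of the bump
  (\<open>weak_equation_fourier\<close>, \<open>cauchy_equation_fourier\<close>). Finally \<open>v - \<nu> u\<close>, with \<open>u\<close> and \<open>v\<close> the transforms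
  of the solution and of its time derivative and \<open>\<nu>\<close> one characteristic root, solves a first order
  equation governed by the other root. As a curve in \<open>L\<^sup>2\<close> over a bounded set of
  frequencies it is an exponential (\<open>L2_exponential_flow\<close>, \<open>characteristic_flow\<close>), and the two
  resulting identities are solved for \<open>u\<close> (\<open>cauchy_solution_fourier\<close>).
\<close>

section \<open>Square integrable functions\<close>

abbreviation sq_int :: "('a::euclidean_space \<Rightarrow> complex) \<Rightarrow> ennreal" where
  "sq_int f \<equiv> \<integral>\<^sup>+x. ennreal ((norm (f x))\<^sup>2) \<partial>lborel"

lemma L2_spaceD:
  assumes "f \<in> L2_space"
  shows "f \<in> borel_measurable borel" "integrable lborel (\<lambda>x. (norm (f x))\<^sup>2)"
  using assms by (auto simp: L2_space_def)

lemma L2_norm_nonneg: "0 \<le> L2_norm f"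
  by (simp add: L2_norm_def)

lemma L2_norm_sq: "(L2_norm f)\<^sup>2 = (LINT x|lborel. (norm (f x))\<^sup>2)"
  by (simp add: L2_norm_def)

lemma L2_space_dominated:
  fixes f g :: "'a::euclidean_space \<Rightarrow> complex"
  assumes "g \<in> L2_space" "f \<in> borel_measurable borel" "AE x in lborel. norm (f x) \<le> norm (g x)"
  shows "f \<in> L2_space"
proof -
  have "integrable lborel (\<lambda>x. (norm (f x))\<^sup>2)"
  proof (rule Bochner_Integration.integrable_bound[OF L2_spaceD(2)[OF assms(1)]])
    show "AE x in lborel. norm ((norm (f x))\<^sup>2) \<le> norm ((norm (g x))\<^sup>2)"
      using assms(3) by eventually_elim (simp add: power_mono)
  qed (use assms(2) in measurable)
  then show ?thesis using assms(2) by (simp add: L2_space_def)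
qed

lemma L2_norm_mono:
  assumes "f \<in> L2_space" "g \<in> L2_space" "AE x in lborel. norm (f x) \<le> norm (g x)"
  shows "L2_norm f \<le> L2_norm g"
  unfolding L2_norm_def
  by (intro real_sqrt_le_mono integral_mono_AE L2_spaceD assms)
     (use assms(3) in eventually_elim, simp add: power_mono)

lemma L2_norm_cong_AE:
  assumes "f \<in> borel_measurable borel" "g \<in> borel_measurable borel" "AE x in lborel. f x = g x"
  shows "L2_norm f = L2_norm g"
  unfolding L2_norm_def
  by (intro arg_cong[where f = sqrt] integral_cong_AE)
     (use assms in \<open>auto elim!: eventually_mono\<close>)

lemma L2_space_cong_AE:
  assumes "g \<in> L2_space" "f \<in> borel_measurable borel" "AE x in lborel. f x = g x"
  shows "f \<in> L2_space"
  by (rule L2_space_dominated[OF assms(1,2)]) (use assms(3) in eventually_elim, simp)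

lemma L2_space_scale:
  assumes "f \<in> L2_space" shows "(\<lambda>x. c * f x) \<in> L2_space"
  using assms by (auto simp: L2_space_def norm_mult power_mult_distrib)

lemma L2_norm_scale: "L2_norm (\<lambda>x. c * f x) = norm c * L2_norm f"
  by (simp add: L2_norm_def norm_mult power_mult_distrib real_sqrt_mult)

lemma norm_add_sq_le: "(norm (a + b :: complex))\<^sup>2 \<le> (1 + s) * (norm a)\<^sup>2 + (1 + 1 / s) * (norm b)\<^sup>2"
  if "s > 0"
proof -
  have "(norm (a + b))\<^sup>2 \<le> (norm a + norm b)\<^sup>2" by (intro power_mono norm_triangle_ineq) simp
  moreover have "(1 + s) * (norm a)\<^sup>2 + (1 + 1 / s) * (norm b)\<^sup>2 - (norm a + norm b)\<^sup>2
      = (s * norm a - norm b)\<^sup>2 / s"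
    using that by (simp add: field_simps power2_eq_square)
  moreover have "(s * norm a - norm b)\<^sup>2 / s \<ge> 0" using that by simp
  ultimately show ?thesis by linarith
qed

lemma L2_space_add:
  fixes f g :: "'a::euclidean_space \<Rightarrow> complex"
  assumes "f \<in> L2_space" "g \<in> L2_space"
  shows "(\<lambda>x. f x + g x) \<in> L2_space"
proof -
  note [measurable] = assms[THEN L2_spaceD(1)]
  have "integrable lborel (\<lambda>x. (norm (f x + g x))\<^sup>2)"
  proof (rule Bochner_Integration.integrable_bound)
    show "integrable lborel (\<lambda>x. 2 * (norm (f x))\<^sup>2 + 2 * (norm (g x))\<^sup>2)"
      using assms[THEN L2_spaceD(2)] by simp
    show "AE x in lborel. norm ((norm (f x + g x))\<^sup>2) \<le> norm (2 * (norm (f x))\<^sup>2 + 2 * (norm (g x))\<^sup>2)"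
      using norm_add_sq_le[of 1] by simp
  qed measurable
  then show ?thesis by (simp add: L2_space_def)
qed

lemma L2_space_diff:
  fixes f g :: "'a::euclidean_space \<Rightarrow> complex"
  assumes "f \<in> L2_space" "g \<in> L2_space"
  shows "(\<lambda>x. f x - g x) \<in> L2_space"
  using L2_space_add[OF assms(1) L2_space_scale[OF assms(2), of "-1"]] by simp

text \<open>Optimising \<open>\<parallel>f + g\<parallel>\<^sup>2 \<le> (1 + s) \<parallel>f\<parallel>\<^sup>2 + (1 + 1/s) \<parallel>g\<parallel>\<^sup>2\<close> over \<open>s\<close> gives Minkowski's inequality.\<close>

lemma L2_norm_triangle:
  fixes f g :: "'a::euclidean_space \<Rightarrow> complex"
  assumes "f \<in> L2_space" "g \<in> L2_space"
  shows "L2_norm (\<lambda>x. f x + g x) \<le> L2_norm f + L2_norm g"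
proof -
  define A B where "A = L2_norm f" and "B = L2_norm g"
  have AB: "A \<ge> 0" "B \<ge> 0" by (simp_all add: A_def B_def L2_norm_nonneg)
  have *: "(L2_norm (\<lambda>x. f x + g x))\<^sup>2 \<le> (1 + s) * A\<^sup>2 + (1 + 1 / s) * B\<^sup>2" if "s > 0" for s
  proof -
    have "(LINT x|lborel. (norm (f x + g x))\<^sup>2)
        \<le> (LINT x|lborel. (1 + s) * (norm (f x))\<^sup>2 + (1 + 1 / s) * (norm (g x))\<^sup>2)"
      using norm_add_sq_le[OF that] assms[THEN L2_spaceD(2)] L2_spaceD(2)[OF L2_space_add[OF assms]]
      by (intro integral_mono) auto
    then show ?thesis using assms[THEN L2_spaceD(2)] by (simp add: L2_norm_sq A_def B_def)
  qed
  \<comment> \<open>The small \<open>e\<close> keeps the optimal \<open>s = B / A\<close> defined when one of the norms vanishes.\<close>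
  have "L2_norm (\<lambda>x. f x + g x) \<le> (A + e) + (B + e)" if "e > 0" for e
  proof (rule power2_le_imp_le)
    define s where "s = (B + e) / (A + e)"
    have s: "s > 0" using AB that by (simp add: s_def)
    have "(L2_norm (\<lambda>x. f x + g x))\<^sup>2 \<le> (1 + s) * A\<^sup>2 + (1 + 1 / s) * B\<^sup>2" by (rule *[OF s])
    also have "\<dots> \<le> (1 + s) * (A + e)\<^sup>2 + (1 + 1 / s) * (B + e)\<^sup>2"
      using s AB that by (intro add_mono mult_left_mono power_mono) auto
    also have "\<dots> = ((A + e) + (B + e))\<^sup>2"
    proof -
      have "A + e \<noteq> 0" "B + e \<noteq> 0" using AB that by auto
      then have "s * (A + e)\<^sup>2 = (B + e) * (A + e)" "1 / s * (B + e)\<^sup>2 = (A + e) * (B + e)"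
        by (simp_all add: s_def power2_eq_square)
      then show ?thesis unfolding distrib_right by (simp add: power2_eq_square algebra_simps)
    qed
    finally show "(L2_norm (\<lambda>x. f x + g x))\<^sup>2 \<le> ((A + e) + (B + e))\<^sup>2" .
  qed (use AB that in simp)
  then have "L2_norm (\<lambda>x. f x + g x) \<le> (A + B) + e" if "e > 0" for e
    using that[THEN half_gt_zero] by fastforce
  then show ?thesis unfolding A_def B_def by (rule field_le_epsilon)
qed

lemma L2_norm_triangle_diff:
  fixes f g :: "'a::euclidean_space \<Rightarrow> complex"
  assumes "f \<in> L2_space" "g \<in> L2_space"
  shows "L2_norm (\<lambda>x. f x - g x) \<le> L2_norm f + L2_norm g"
  using L2_norm_triangle[OF assms(1) L2_space_scale[OF assms(2), of "-1"]]
    L2_norm_scale[of "-1" g] by simp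

lemma L2_norm_eq_0_AE:
  assumes "f \<in> L2_space" "L2_norm f = 0"
  shows "AE x in lborel. f x = 0"
proof -
  have "(LINT x|lborel. (norm (f x))\<^sup>2) = 0" using assms(2) by (simp flip: L2_norm_sq)
  then show ?thesis
    using integral_nonneg_eq_0_iff_AE[OF L2_spaceD(2)[OF assms(1)]] by simp
qed

lemma nn_integral_norm_sq:
  assumes "f \<in> L2_space"
  shows "sq_int f = ennreal ((L2_norm f)\<^sup>2)"
  unfolding L2_norm_sq by (rule nn_integral_eq_integral[OF L2_spaceD(2)[OF assms]]) simp

lemma L2_space_iff_nn_integral:
  assumes "f \<in> borel_measurable borel"
  shows "f \<in> L2_space \<longleftrightarrow> sq_int f < \<infinity>"
  using assms by (simp add: L2_space_def integrable_iff_bounded)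

lemma L2_tail_tendsto_0:
  fixes f :: "'a::euclidean_space \<Rightarrow> complex"
  assumes "f \<in> L2_space"
  shows "(\<lambda>k. LINT x|lborel. indicator (- cball 0 (real k - c)) x * (norm (f x))\<^sup>2) \<longlonglongrightarrow> 0"
proof -
  note [measurable] = L2_spaceD(1)[OF assms]
  have "(\<lambda>k. LINT x|lborel. indicator (- cball 0 (real k - c)) x * (norm (f x))\<^sup>2)
      \<longlonglongrightarrow> (LINT x|(lborel :: 'a measure). 0)"
  proof (rule integral_dominated_convergence[OF _ _ L2_spaceD(2)[OF assms]])
    show "AE x in lborel. (\<lambda>k. indicator (- cball 0 (real k - c)) x * (norm (f x))\<^sup>2) \<longlonglongrightarrow> 0"
    proof (rule AE_I2)
      fix x :: 'a
      have "\<forall>\<^sub>F k in sequentially. real k \<ge> norm x + c"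
        by (metis eventually_sequentiallyI nat_ceiling_le_eq)
      then have "\<forall>\<^sub>F k in sequentially. indicator (- cball 0 (real k - c)) x * (norm (f x))\<^sup>2 = 0"
        by eventually_elim auto
      then show "(\<lambda>k. indicator (- cball 0 (real k - c)) x * (norm (f x))\<^sup>2) \<longlonglongrightarrow> 0"
        by (simp add: tendsto_eventually)
    qed
    show "AE x in lborel. norm (indicator (- cball 0 (real k - c)) x * (norm (f x))\<^sup>2) \<le> (norm (f x))\<^sup>2" for k
      by (auto simp: indicator_def)
  qed auto
  then show ?thesis by simp
qed

section \<open>The Fourier transform on \<open>L\<^sup>2\<close>\<close>

lemma cball_borel [measurable]: "cball c r \<in> sets borel" for c :: "'a::metric_space"
  by simp

definition cut :: "real \<Rightarrow> ('a::euclidean_space \<Rightarrow> complex) \<Rightarrow> 'a \<Rightarrow> complex" where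
  "cut R f = (\<lambda>x. indicator (cball 0 R) x *\<^sub>R f x)"

lemma cut_measurable:
  fixes f :: "'a::euclidean_space \<Rightarrow> complex"
  assumes [measurable]: "f \<in> borel_measurable borel"
  shows "cut R f \<in> borel_measurable borel"
  unfolding cut_def by (intro borel_measurable_scaleR borel_measurable_indicator assms) simp

lemma cut_integrable:
  fixes f :: "'a::euclidean_space \<Rightarrow> complex"
  assumes "f \<in> L2_space"
  shows "integrable lborel (cut R f)"
proof (rule Bochner_Integration.integrable_bound)
  note [measurable] = L2_spaceD(1)[OF assms]
  have "emeasure lborel (cball (0::'a) R) < \<infinity>" by (intro emeasure_bounded_finite) simp
  then show "integrable lborel (\<lambda>x. indicator (cball 0 R) x + (norm (f x))\<^sup>2)"
    using L2_spaceD(2)[OF assms] by (intro Bochner_Integration.integrable_add) (auto intro!: integrable_real_indicator)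
  show "cut R f \<in> borel_measurable lborel" using cut_measurable[OF L2_spaceD(1)[OF assms]] by simp
  have "x \<le> 1 + x\<^sup>2" for x :: real
    using zero_le_power2[of "x - 1/2"] by (simp add: power2_eq_square algebra_simps)
  then show "AE x in lborel. norm (cut R f x) \<le> norm (indicator (cball 0 R) x + (norm (f x))\<^sup>2)"
    by (auto simp: indicator_def cut_def)
qed

lemma cut_L2:
  assumes "f \<in> L2_space" shows "cut R f \<in> L2_space"
  by (rule L2_space_dominated[OF assms])
     (use cut_measurable[OF L2_spaceD(1)[OF assms]] in \<open>simp_all add: cut_def indicator_def\<close>)

lemma fourier_integral_measurable:
  fixes f :: "'a::euclidean_space \<Rightarrow> complex"
  assumes [measurable]: "f \<in> borel_measurable borel"
  shows "fourier_integral f \<in> borel_measurable borel"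
proof -
  have "(\<lambda>\<xi>. LINT x|lborel. f x * exp (- (\<i> * complex_of_real (\<xi> \<bullet> x)))) \<in> borel_measurable lborel"
    by measurable
  then show ?thesis by (simp add: fourier_integral_def[abs_def])
qed



lemma integrable_fourier_integrand:
  fixes f :: "'a::euclidean_space \<Rightarrow> complex"
  assumes "integrable lborel f"
  shows "integrable lborel (\<lambda>x. f x * exp (- (\<i> * complex_of_real (\<xi> \<bullet> x))))"
proof (rule Bochner_Integration.integrable_bound[OF assms])
  have [measurable]: "f \<in> borel_measurable borel" using assms by auto
  show "(\<lambda>x. f x * exp (- (\<i> * complex_of_real (\<xi> \<bullet> x)))) \<in> borel_measurable lborel" by simp
qed (auto simp: norm_mult)

lemma norm_fourier_integral_le:
  "norm (fourier_integral f \<xi>) \<le> (LINT x|lborel. norm (f x))"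
  unfolding fourier_integral_def
  by (rule order_trans[OF integral_norm_bound]) (simp add: norm_mult)

lemma fourier_integral_add:
  fixes f g :: "'a::euclidean_space \<Rightarrow> complex"
  assumes "integrable lborel f" "integrable lborel g"
  shows "fourier_integral (\<lambda>x. f x + g x) \<xi> = fourier_integral f \<xi> + fourier_integral g \<xi>"
  unfolding fourier_integral_def distrib_right
  by (intro Bochner_Integration.integral_add integrable_fourier_integrand assms)

lemma fourier_integral_scale:
  fixes f :: "'a::euclidean_space \<Rightarrow> complex"
  shows "fourier_integral (\<lambda>x. c * f x) \<xi> = c * fourier_integral f \<xi>"
  unfolding fourier_integral_def by (simp add: mult.assoc)

lemma has_fourier_L2D:
  assumes "has_fourier_L2 f g"
  shows "f \<in> L2_space" "g \<in> L2_space"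
    "((\<lambda>R. sq_int (\<lambda>\<xi>. fourier_integral (cut R f) \<xi> - g \<xi>)) \<longlongrightarrow> 0) at_top"
  using assms by (auto simp: has_fourier_L2_def cut_def)

lemma truncated_error_measurable:
  assumes "f \<in> borel_measurable borel" "g \<in> borel_measurable borel"
  shows "(\<lambda>\<xi>. fourier_integral (cut R f) \<xi> - g \<xi>) \<in> borel_measurable borel"
    "(\<lambda>\<xi>. g \<xi> - fourier_integral (cut R f) \<xi>) \<in> borel_measurable borel"
    "(\<lambda>\<xi>. ennreal ((norm (fourier_integral (cut R f) \<xi> - g \<xi>))\<^sup>2)) \<in> borel_measurable borel"
proof -
  have [measurable]: "(\<lambda>\<xi>. fourier_integral (cut R f) \<xi>) \<in> borel_measurable borel"
    by (rule fourier_integral_measurable[OF cut_measurable[OF assms(1)]])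
  note [measurable] = assms(2)
  show "(\<lambda>\<xi>. fourier_integral (cut R f) \<xi> - g \<xi>) \<in> borel_measurable borel"
    "(\<lambda>\<xi>. g \<xi> - fourier_integral (cut R f) \<xi>) \<in> borel_measurable borel"
    "(\<lambda>\<xi>. ennreal ((norm (fourier_integral (cut R f) \<xi> - g \<xi>))\<^sup>2)) \<in> borel_measurable borel"
    by measurable
qed

lemma nn_integral_sq_add_le:
  fixes f g :: "'a::euclidean_space \<Rightarrow> complex"
  assumes [measurable]: "f \<in> borel_measurable borel" "g \<in> borel_measurable borel"
  shows "sq_int (\<lambda>\<xi>. f \<xi> + g \<xi>)
    \<le> 2 * sq_int f + 2 * sq_int g"
proof -
  have "ennreal ((norm (f \<xi> + g \<xi>))\<^sup>2) \<le> 2 * ennreal ((norm (f \<xi>))\<^sup>2) + 2 * ennreal ((norm (g \<xi>))\<^sup>2)" for \<xi>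
  proof -
    have "ennreal ((norm (f \<xi> + g \<xi>))\<^sup>2) \<le> ennreal (2 * (norm (f \<xi>))\<^sup>2 + 2 * (norm (g \<xi>))\<^sup>2)"
      using norm_add_sq_le[of 1] by (intro ennreal_leI) simp
    then show ?thesis by (simp add: ennreal_plus ennreal_mult)
  qed
  then have "sq_int (\<lambda>\<xi>. f \<xi> + g \<xi>)
      \<le> (\<integral>\<^sup>+ \<xi>. 2 * ennreal ((norm (f \<xi>))\<^sup>2) + 2 * ennreal ((norm (g \<xi>))\<^sup>2) \<partial>lborel)"
    by (intro nn_integral_mono)
  then show ?thesis by (simp add: nn_integral_add nn_integral_cmult)
qed

lemma tendsto_0_mult_bound_ennreal:
  fixes f g :: "'b \<Rightarrow> ennreal"
  assumes "(f \<longlongrightarrow> 0) F" "c < top" "\<forall>\<^sub>F x in F. g x \<le> c * f x"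
  shows "(g \<longlongrightarrow> 0) F"
proof -
  have "((\<lambda>x. c * f x) \<longlongrightarrow> c * 0) F"
    by (rule ennreal_tendsto_cmult[OF assms(2,1)])
  then have "((\<lambda>x. c * f x) \<longlongrightarrow> 0) F" by simp
  then show ?thesis
    by (rule tendsto_sandwich[OF always_eventually assms(3) tendsto_const, rotated]) simp
qed

lemma tendsto_0_sum_bound_ennreal:
  fixes f g h :: "'b \<Rightarrow> ennreal"
  assumes "(f \<longlongrightarrow> 0) F" "(g \<longlongrightarrow> 0) F" "\<And>x. h x \<le> 2 * (f x + g x)"
  shows "(h \<longlongrightarrow> 0) F"
proof (rule tendsto_0_mult_bound_ennreal[where f = "\<lambda>x. f x + g x" and c = 2])
  show "((\<lambda>x. f x + g x) \<longlongrightarrow> 0) F" using tendsto_add[OF assms(1,2)] by simp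
qed (use assms(3) in auto)

lemma has_fourier_L2_add:
  assumes "has_fourier_L2 f f'" "has_fourier_L2 g g'"
  shows "has_fourier_L2 (\<lambda>x. f x + g x) (\<lambda>x. f' x + g' x)"
proof -
  note D = has_fourier_L2D[OF assms(1)] has_fourier_L2D[OF assms(2)]
  note M = D(1,2,4,5)[THEN L2_spaceD(1)]
  have le: "sq_int (\<lambda>\<xi>. fourier_integral (cut R (\<lambda>x. f x + g x)) \<xi> - (f' \<xi> + g' \<xi>))
     \<le> 2 * (sq_int (\<lambda>\<xi>. fourier_integral (cut R f) \<xi> - f' \<xi>)
      + sq_int (\<lambda>\<xi>. fourier_integral (cut R g) \<xi> - g' \<xi>))" for R
  proof -
    have eq: "fourier_integral (cut R (\<lambda>x. f x + g x)) \<xi> - (f' \<xi> + g' \<xi>)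
        = (fourier_integral (cut R f) \<xi> - f' \<xi>) + (fourier_integral (cut R g) \<xi> - g' \<xi>)" for \<xi>
      using fourier_integral_add[OF cut_integrable[OF D(1)] cut_integrable[OF D(4)], of R R \<xi>]
      by (simp add: cut_def scaleR_add_right)
    show ?thesis
      unfolding eq distrib_left[symmetric]
      by (rule order_trans[OF nn_integral_sq_add_le[OF truncated_error_measurable(1)[OF M(1,2)]
          truncated_error_measurable(1)[OF M(3,4)]]]) (simp add: distrib_left)
  qed
  have "((\<lambda>R. sq_int (\<lambda>\<xi>. fourier_integral (cut R (\<lambda>x. f x + g x)) \<xi> - (f' \<xi> + g' \<xi>)))
      \<longlongrightarrow> 0) at_top"
    by (rule tendsto_0_sum_bound_ennreal[OF D(3) D(6) le])
  then show ?thesis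
    unfolding has_fourier_L2_def by (intro conjI L2_space_add D) (simp add: cut_def)
qed

lemma has_fourier_L2_scale:
  assumes "has_fourier_L2 f f'"
  shows "has_fourier_L2 (\<lambda>x. c * f x) (\<lambda>x. c * f' x)"
proof -
  note D = has_fourier_L2D[OF assms(1)]
  note M = D(1,2)[THEN L2_spaceD(1)]
  have "fourier_integral (cut R (\<lambda>x. c * f x)) \<xi> - c * f' \<xi> = c * (fourier_integral (cut R f) \<xi> - f' \<xi>)" for R \<xi>
    using fourier_integral_scale[of c "cut R f" \<xi>] by (simp add: right_diff_distrib cut_def)
  then have "sq_int (\<lambda>\<xi>. fourier_integral (cut R (\<lambda>x. c * f x)) \<xi> - c * f' \<xi>)
      = ennreal ((norm c)\<^sup>2) * sq_int (\<lambda>\<xi>. fourier_integral (cut R f) \<xi> - f' \<xi>)" for R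
    by (subst nn_integral_cmult[symmetric])
       (simp_all add: norm_mult power_mult_distrib ennreal_mult truncated_error_measurable(3)[OF M])
  then have "((\<lambda>R. sq_int (\<lambda>\<xi>. fourier_integral (cut R (\<lambda>x. c * f x)) \<xi> - c * f' \<xi>)) \<longlongrightarrow> 0) at_top"
    by (intro tendsto_0_mult_bound_ennreal[OF D(3), of "ennreal ((norm c)\<^sup>2)"]) auto
  then show ?thesis
    unfolding has_fourier_L2_def by (intro conjI L2_space_scale D) (simp add: cut_def)
qed

lemma has_fourier_L2_unique:
  assumes "has_fourier_L2 f g" "has_fourier_L2 f h"
  shows "AE x in lborel. g x = h x"
proof -
  note D = has_fourier_L2D[OF assms(1)] has_fourier_L2D[OF assms(2)]
  note M [measurable] = D(1,2,5)[THEN L2_spaceD(1)]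
  have le: "sq_int (\<lambda>\<xi>. g \<xi> - h \<xi>) \<le> 2 * (sq_int (\<lambda>\<xi>. fourier_integral (cut R f) \<xi> - g \<xi>)
      + sq_int (\<lambda>\<xi>. fourier_integral (cut R f) \<xi> - h \<xi>))" for R
    using nn_integral_sq_add_le[OF truncated_error_measurable(2)[OF M(1,2)] truncated_error_measurable(1)[OF M(1,3)], of R R]
    by (simp add: distrib_left norm_minus_commute)
  have "((\<lambda>R::real. sq_int (\<lambda>\<xi>. g \<xi> - h \<xi>)) \<longlongrightarrow> 0) at_top"
    by (rule tendsto_0_sum_bound_ennreal[OF D(3) D(6) le])
  then have "sq_int (\<lambda>\<xi>. g \<xi> - h \<xi>) \<le> 0"
    by (simp add: tendsto_const_iff)
  then have "AE \<xi> in lborel. ennreal ((norm (g \<xi> - h \<xi>))\<^sup>2) = 0"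
    by (subst (asm) le_zero_eq, subst (asm) nn_integral_0_iff_AE) auto
  then show ?thesis by eventually_elim simp
qed

text \<open>For an integrable \<open>f\<close> the truncated integrals converge to the Fourier integral at every point,
  and Fatou's lemma shows that an \<open>L\<^sup>2\<close> limit must agree with this pointwise limit.\<close>

lemma has_fourier_L2_integrable:
  fixes f :: "'a::euclidean_space \<Rightarrow> complex"
  assumes "has_fourier_L2 f g" "integrable lborel f"
  shows "AE x in lborel. fourier_integral f x = g x"
proof -
  note D = has_fourier_L2D[OF assms(1)]
  note M [measurable] = D(1,2)[THEN L2_spaceD(1)]
  have [measurable]: "fourier_integral f \<in> borel_measurable borel"
    by (rule fourier_integral_measurable[OF M(1)])
  have lim: "(\<lambda>k. fourier_integral (cut (real k) f) \<xi>) \<longlonglongrightarrow> fourier_integral f \<xi>" for \<xi>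
    unfolding fourier_integral_def
  proof (rule integral_dominated_convergence[where w = "\<lambda>x. norm (f x)"])
    show "AE x in lborel. (\<lambda>k. cut (real k) f x * exp (- (\<i> * complex_of_real (\<xi> \<bullet> x))))
        \<longlonglongrightarrow> f x * exp (- (\<i> * complex_of_real (\<xi> \<bullet> x)))"
    proof (rule AE_I2, intro tendsto_intros)
      fix x :: 'a
      have "\<forall>\<^sub>F k in sequentially. real k \<ge> norm x"
        by (metis eventually_sequentiallyI nat_ceiling_le_eq)
      then have "\<forall>\<^sub>F k in sequentially. cut (real k) f x = f x"
        by eventually_elim (auto simp: cut_def)
      then show "(\<lambda>k. cut (real k) f x) \<longlonglongrightarrow> f x"
        by (simp add: tendsto_eventually)
    qed
    show "AE x in lborel. norm (cut (real k) f x * exp (- (\<i> * complex_of_real (\<xi> \<bullet> x)))) \<le> norm (f x)" for k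
      by (auto simp: norm_mult cut_def indicator_def)
  next
    fix k
    have [measurable]: "cut (real k) f \<in> borel_measurable borel" by (rule cut_measurable[OF M(1)])
    show "(\<lambda>x. cut (real k) f x * exp (- (\<i> * complex_of_real (\<xi> \<bullet> x)))) \<in> borel_measurable lborel"
      by simp
  qed (use assms(2) in simp_all)
  have "sq_int (\<lambda>\<xi>. fourier_integral f \<xi> - g \<xi>)
      = (\<integral>\<^sup>+ \<xi>. liminf (\<lambda>k. ennreal ((norm (fourier_integral (cut (real k) f) \<xi> - g \<xi>))\<^sup>2)) \<partial>lborel)"
  proof (intro nn_integral_cong)
    fix \<xi> :: 'a
    have "(\<lambda>k. ennreal ((norm (fourier_integral (cut (real k) f) \<xi> - g \<xi>))\<^sup>2))
        \<longlonglongrightarrow> ennreal ((norm (fourier_integral f \<xi> - g \<xi>))\<^sup>2)"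
      by (intro tendsto_intros tendsto_ennrealI lim)
    then show "ennreal ((norm (fourier_integral f \<xi> - g \<xi>))\<^sup>2)
       = liminf (\<lambda>k. ennreal ((norm (fourier_integral (cut (real k) f) \<xi> - g \<xi>))\<^sup>2))"
      by (metis lim_imp_Liminf sequentially_bot)
  qed
  also have "\<dots> \<le> liminf (\<lambda>k. sq_int (\<lambda>\<xi>. fourier_integral (cut (real k) f) \<xi> - g \<xi>))"
    by (intro nn_integral_liminf) (simp add: truncated_error_measurable(3)[OF M])
  also have "\<dots> = 0"
    by (intro lim_imp_Liminf filterlim_compose[OF D(3)] filterlim_real_sequentially) simp
  finally have "AE \<xi> in lborel. ennreal ((norm (fourier_integral f \<xi> - g \<xi>))\<^sup>2) = 0"
    by (subst (asm) le_zero_eq, subst (asm) nn_integral_0_iff_AE) auto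
  then show ?thesis by eventually_elim simp
qed

lemma has_fourier_L2_cong_AE:
  assumes "has_fourier_L2 f g" "h \<in> borel_measurable borel" "AE x in lborel. h x = g x"
  shows "has_fourier_L2 f h"
proof -
  note D = has_fourier_L2D[OF assms(1)]
  have "sq_int (\<lambda>\<xi>. fourier_integral (cut R f) \<xi> - h \<xi>)
      = sq_int (\<lambda>\<xi>. fourier_integral (cut R f) \<xi> - g \<xi>)" for R
    by (intro nn_integral_cong_AE) (use assms(3) in \<open>auto elim!: eventually_mono\<close>)
  then show ?thesis
    using D L2_space_cong_AE[OF D(2) assms(2,3)] by (simp add: has_fourier_L2_def cut_def)
qed

text \<open>In either case of the definition of \<open>fourier\<close>, the Fourier integral or the chosen function, its
  value represents the \<open>L\<^sup>2\<close> transform as soon as there is one.\<close>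

lemma has_fourier_L2_fourier:
  assumes "has_fourier_L2 f g"
  shows "has_fourier_L2 f (fourier f)"
proof (cases "integrable lborel f")
  case True
  note D = has_fourier_L2D[OF assms(1)]
  show ?thesis
    using has_fourier_L2_cong_AE[OF assms fourier_integral_measurable[OF L2_spaceD(1)[OF D(1)]]
      has_fourier_L2_integrable[OF assms True]] True by (simp add: fourier_def)
next
  case False
  then show ?thesis using someI[of "has_fourier_L2 f", OF assms] by (simp add: fourier_def)
qed

lemma fourier_eqI:
  assumes "has_fourier_L2 f g"
  shows "AE x in lborel. fourier f x = g x"
  using has_fourier_L2_unique[OF has_fourier_L2_fourier[OF assms] assms] .

lemma has_fourier_L2_cong_AE_left:
  assumes "has_fourier_L2 f g" "h \<in> borel_measurable borel" "AE x in lborel. h x = f x"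
  shows "has_fourier_L2 h g"
proof -
  note D = has_fourier_L2D[OF assms(1)]
  note [measurable] = D(1)[THEN L2_spaceD(1)] assms(2)
  have "fourier_integral (cut R h) = fourier_integral (cut R f)" for R
    unfolding fourier_integral_def cut_def
    by (intro ext integral_cong_AE) (use assms(3) in \<open>auto elim!: eventually_mono\<close>)
  then show ?thesis
    using D L2_space_cong_AE[OF D(1) assms(2,3)] by (simp add: has_fourier_L2_def cut_def)
qed

lemma sobolevD:
  fixes f :: "'a::euclidean_space \<Rightarrow> complex"
  assumes "f \<in> sobolev s"
  shows "has_fourier_L2 f (fourier f)" "f \<in> L2_space" "fourier f \<in> L2_space"
    "integrable lborel (\<lambda>\<xi>. (1 + (norm \<xi>)\<^sup>2) powr s * (norm (fourier f \<xi>))\<^sup>2)"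
proof -
  obtain g where g: "has_fourier_L2 f g"
    "integrable lborel (\<lambda>\<xi>. (1 + (norm \<xi>)\<^sup>2) powr s * (norm (g \<xi>))\<^sup>2)"
    using assms by (auto simp: sobolev_def)
  show 1: "has_fourier_L2 f (fourier f)" by (rule has_fourier_L2_fourier[OF g(1)])
  show 2: "f \<in> L2_space" "fourier f \<in> L2_space" using has_fourier_L2D[OF 1] by auto
  note [measurable] = 2[THEN L2_spaceD(1)] has_fourier_L2D(2)[OF g(1), THEN L2_spaceD(1)]
  have "AE \<xi> in lborel. (1 + (norm \<xi>)\<^sup>2) powr s * (norm (fourier f \<xi>))\<^sup>2 = (1 + (norm \<xi>)\<^sup>2) powr s * (norm (g \<xi>))\<^sup>2"
    using fourier_eqI[OF g(1)] by eventually_elim simp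
  from integrable_cong_AE[OF _ _ this]
  show "integrable lborel (\<lambda>\<xi>. (1 + (norm \<xi>)\<^sup>2) powr s * (norm (fourier f \<xi>))\<^sup>2)"
    using g(2) by simp
qed

lemma sobolev_norm_nonneg: "0 \<le> sobolev_norm s f"
  by (simp add: sobolev_norm_def)

text \<open>The weight \<open>(1 + \<bar>\<xi>\<bar>\<^sup>2)\<^sup>s\<close> is at least \<open>1\<close>, so a Sobolev norm bounds the \<open>L\<^sup>2\<close> norm of any
  representative \<open>g\<close> of the Fourier transform.\<close>

lemma L2_norm_le_sobolev_norm:
  fixes f :: "'a::euclidean_space \<Rightarrow> complex"
  assumes "has_fourier_L2 f g" "integrable lborel (\<lambda>\<xi>. (1 + (norm \<xi>)\<^sup>2) powr s * (norm (g \<xi>))\<^sup>2)" "s \<ge> 0"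
  shows "L2_norm g \<le> sobolev_norm s f"
proof -
  have f: "f \<in> sobolev s" using assms by (auto simp: sobolev_def)
  note D = sobolevD[OF f]
  have g: "g \<in> L2_space" using has_fourier_L2D[OF assms(1)] by simp
  have "L2_norm g = L2_norm (fourier f)"
    by (rule L2_norm_cong_AE) (use g D(3) fourier_eqI[OF assms(1)] L2_spaceD(1) in \<open>auto elim!: eventually_mono\<close>)
  also have "\<dots> \<le> sobolev_norm s f"
    unfolding L2_norm_def sobolev_norm_def
  proof (intro real_sqrt_le_mono integral_mono L2_spaceD D)
    fix \<xi> :: 'a
    have "1 \<le> (1 + (norm \<xi>)\<^sup>2) powr s" using assms(3) by (intro ge_one_powr_ge_zero) auto
    from mult_right_mono[OF this]
    show "(norm (fourier f \<xi>))\<^sup>2 \<le> (1 + (norm \<xi>)\<^sup>2) powr s * (norm (fourier f \<xi>))\<^sup>2"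
      by fastforce
  qed
  finally show ?thesis .
qed

lemma weighted_integrable_add:
  fixes f g :: "'a::euclidean_space \<Rightarrow> complex"
  assumes "integrable lborel (\<lambda>\<xi>. W \<xi> * (norm (f \<xi>))\<^sup>2)" "integrable lborel (\<lambda>\<xi>. W \<xi> * (norm (g \<xi>))\<^sup>2)"
    and [measurable]: "f \<in> borel_measurable borel" "g \<in> borel_measurable borel" "W \<in> borel_measurable borel"
    and W: "\<And>\<xi>. W \<xi> \<ge> 0"
  shows "integrable lborel (\<lambda>\<xi>. W \<xi> * (norm (f \<xi> + g \<xi>))\<^sup>2)"
proof (rule Bochner_Integration.integrable_bound)
  show "integrable lborel (\<lambda>\<xi>. 2 * (W \<xi> * (norm (f \<xi>))\<^sup>2) + 2 * (W \<xi> * (norm (g \<xi>))\<^sup>2))"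
    using assms(1,2) by simp
  have "W \<xi> * (norm (f \<xi> + g \<xi>))\<^sup>2 \<le> W \<xi> * (2 * (norm (f \<xi>))\<^sup>2 + 2 * (norm (g \<xi>))\<^sup>2)" for \<xi>
    using norm_add_sq_le[of 1 "f \<xi>" "g \<xi>"] W by (intro mult_left_mono) auto
  then show "AE \<xi> in lborel. norm (W \<xi> * (norm (f \<xi> + g \<xi>))\<^sup>2)
      \<le> norm (2 * (W \<xi> * (norm (f \<xi>))\<^sup>2) + 2 * (W \<xi> * (norm (g \<xi>))\<^sup>2))"
    using W by (auto simp: algebra_simps)
qed measurable

abbreviation has_L2_deriv ::
    "(real \<Rightarrow> 'a::euclidean_space \<Rightarrow> complex) \<Rightarrow> (real \<Rightarrow> 'a \<Rightarrow> complex) \<Rightarrow> real \<Rightarrow> bool" where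
  "has_L2_deriv U V t \<equiv>
    ((\<lambda>\<tau>. L2_norm (\<lambda>\<xi>. (U \<tau> \<xi> - U t \<xi>) /\<^sub>R (\<tau> - t) - V t \<xi>)) \<longlongrightarrow> 0) (at t within {0..})"

text \<open>By linearity and uniqueness of the transform, a time derivative in a Sobolev norm is a time
  derivative in \<open>L\<^sup>2\<close> of the Fourier transforms.\<close>

lemma has_sobolev_deriv_fourier:
  fixes u v :: "real \<Rightarrow> 'a::euclidean_space \<Rightarrow> complex"
  assumes "has_sobolev_deriv s u v" "s \<ge> 0" "t \<ge> 0"
  shows "has_L2_deriv (\<lambda>t. fourier (u t)) (\<lambda>t. fourier (v t)) t"
proof (rule tendsto_sandwich[OF _ _ tendsto_const])
  have lim: "((\<lambda>\<tau>. sobolev_norm s (\<lambda>x. (u \<tau> x - u t x) /\<^sub>R (\<tau> - t) - v t x)) \<longlongrightarrow> 0)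
           (at t within {0..})" and ut: "u t \<in> sobolev s" and vt: "v t \<in> sobolev s"
    using assms by (auto simp: has_sobolev_deriv_def)
  then show "((\<lambda>\<tau>. sobolev_norm s (\<lambda>x. (u \<tau> x - u t x) /\<^sub>R (\<tau> - t) - v t x)) \<longlongrightarrow> 0)
           (at t within {0..})" by simp
  show "\<forall>\<^sub>F \<tau> in at t within {0..}.
     L2_norm (\<lambda>\<xi>. (fourier (u \<tau>) \<xi> - fourier (u t) \<xi>) /\<^sub>R (\<tau> - t) - fourier (v t) \<xi>)
       \<le> sobolev_norm s (\<lambda>x. (u \<tau> x - u t x) /\<^sub>R (\<tau> - t) - v t x)"
  proof (unfold eventually_at_topological, intro exI[of _ UNIV] conjI ballI impI)
    fix \<tau> :: real assume "\<tau> \<in> {0..}"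
    then have u\<tau>: "u \<tau> \<in> sobolev s" using assms by (auto simp: has_sobolev_deriv_def)
    define c where "c = complex_of_real (1 / (\<tau> - t))"
    note D = sobolevD[OF u\<tau>] sobolevD[OF ut] sobolevD[OF vt]
    note [measurable] = D(3,7,11)[THEN L2_spaceD(1)]
    let ?W = "\<lambda>\<xi>::'a. (1 + (norm \<xi>)\<^sup>2) powr s"
    have sc: "integrable lborel (\<lambda>\<xi>. ?W \<xi> * (norm (d * g \<xi>))\<^sup>2)"
      if "integrable lborel (\<lambda>\<xi>. ?W \<xi> * (norm (g \<xi>))\<^sup>2)" for d and g :: "'a \<Rightarrow> complex"
    proof -
      have "?W \<xi> * (norm (d * g \<xi>))\<^sup>2 = (norm d)\<^sup>2 * (?W \<xi> * (norm (g \<xi>))\<^sup>2)" for \<xi>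
        by (simp add: norm_mult power_mult_distrib)
      then show ?thesis using integrable_mult_right[OF that, of "(norm d)\<^sup>2"] by presburger
    qed
    have "has_fourier_L2 (\<lambda>x. c * u \<tau> x + ((-c) * u t x + (-1) * v t x))
        (\<lambda>x. c * fourier (u \<tau>) x + ((-c) * fourier (u t) x + (-1) * fourier (v t) x))"
      by (intro has_fourier_L2_add has_fourier_L2_scale D)
    moreover have "integrable lborel (\<lambda>\<xi>. ?W \<xi> * (norm (c * fourier (u \<tau>) \<xi> + ((-c) * fourier (u t) \<xi> + (-1) * fourier (v t) \<xi>)))\<^sup>2)"
      by (intro weighted_integrable_add sc D) auto
    ultimately have "L2_norm (\<lambda>x. c * fourier (u \<tau>) x + ((-c) * fourier (u t) x + (-1) * fourier (v t) x))
       \<le> sobolev_norm s (\<lambda>x. c * u \<tau> x + ((-c) * u t x + (-1) * v t x))"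
      using assms(2) by (rule L2_norm_le_sobolev_norm)
    moreover have "c * y + ((-c) * z + (-1) * w) = (y - z) /\<^sub>R (\<tau> - t) - w" for y z w
    proof -
      have "(y - z) /\<^sub>R (\<tau> - t) = c * (y - z)"
        by (simp only: c_def scaleR_conv_of_real inverse_eq_divide)
      then show ?thesis by (simp add: algebra_simps)
    qed
    ultimately show "L2_norm (\<lambda>\<xi>. (fourier (u \<tau>) \<xi> - fourier (u t) \<xi>) /\<^sub>R (\<tau> - t) - fourier (v t) \<xi>)
       \<le> sobolev_norm s (\<lambda>x. (u \<tau> x - u t x) /\<^sub>R (\<tau> - t) - v t x)"
      by (simp only:)
  qed auto
qed (auto simp: L2_norm_nonneg)

section \<open>Product functions, Gaussians and Plancherel's inequality\<close>

text \<open>Functions of the form \<open>\<Prod>\<^sub>b f\<^sub>b(x \<bullet> b)\<close> reduce integrals in all dimensions to integrals over the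
  line. Both the Gaussian weights and the test functions below have this form.\<close>

lemma
  fixes f :: "'a::euclidean_space \<Rightarrow> real \<Rightarrow> complex"
  assumes f: "\<And>b. b \<in> Basis \<Longrightarrow> integrable lborel (f b)"
  shows integrable_prod_Basis: "integrable lborel (\<lambda>x. \<Prod>b\<in>Basis. f b (x \<bullet> b))"
    and integral_prod_Basis: "(LINT x|lborel. (\<Prod>b\<in>Basis. f b (x \<bullet> b))) = (\<Prod>b\<in>Basis. LINT s|lborel. f b s)"
proof -
  interpret product_sigma_finite "\<lambda>_::'a. lborel :: real measure" ..
  let ?T = "\<lambda>y::'a \<Rightarrow> real. \<Sum>b\<in>Basis. y b *\<^sub>R b"
  have [measurable]: "f b \<in> borel_measurable borel" if "b \<in> Basis" for b
    using f[OF that] by auto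
  have T: "?T \<in> (\<Pi>\<^sub>M b\<in>Basis. lborel) \<rightarrow>\<^sub>M borel" by measurable
  have m: "(\<lambda>x. \<Prod>b\<in>Basis. f b (x \<bullet> b)) \<in> borel_measurable (borel :: 'a measure)"
    by (intro borel_measurable_prod) measurable
  have eq: "(\<Prod>b\<in>Basis. f b (?T y \<bullet> b)) = (\<Prod>b\<in>Basis. f b (y b))" for y
    by (intro prod.cong refl) (simp add: inner_sum_left_Basis)
  have "integrable (\<Pi>\<^sub>M b\<in>(Basis::'a set). lborel) (\<lambda>y. \<Prod>b\<in>Basis. f b (y b))"
    by (intro product_integrable_prod f) simp
  then show "integrable lborel (\<lambda>x. \<Prod>b\<in>Basis. f b (x \<bullet> b))"
    by (simp add: lborel_eq[where 'a='a] integrable_distr_eq[OF T m] eq)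
  have "(LINT y|(\<Pi>\<^sub>M b\<in>(Basis::'a set). lborel). (\<Prod>b\<in>Basis. f b (y b))) = (\<Prod>b\<in>Basis. LINT s|lborel. f b s)"
    by (intro product_integral_prod f) simp
  then show "(LINT x|lborel. (\<Prod>b\<in>Basis. f b (x \<bullet> b))) = (\<Prod>b\<in>Basis. LINT s|lborel. f b s)"
    by (simp add: lborel_eq[where 'a='a] integral_distr[OF T m] eq)
qed

lemma integral_prod_Basis_real:
  fixes f :: "'a::euclidean_space \<Rightarrow> real \<Rightarrow> real"
  assumes f: "\<And>b. b \<in> Basis \<Longrightarrow> integrable lborel (f b)"
  shows "integrable lborel (\<lambda>x. \<Prod>b\<in>Basis. f b (x \<bullet> b))"
    and "(LINT x|lborel. (\<Prod>b\<in>Basis. f b (x \<bullet> b))) = (\<Prod>b\<in>Basis. LINT s|lborel. f b s)"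
proof -
  have c: "\<And>b. b \<in> Basis \<Longrightarrow> integrable lborel (\<lambda>s. complex_of_real (f b s))"
    using f by (simp add: integrable_of_real)
  have "complex_of_real (LINT x|lborel. (\<Prod>b\<in>Basis. f b (x \<bullet> b)))
      = (LINT x|lborel. (\<Prod>b\<in>Basis. complex_of_real (f b (x \<bullet> b))))"
    unfolding of_real_prod[symmetric] by (rule integral_complex_of_real[symmetric])
  also have "\<dots> = (\<Prod>b\<in>Basis. LINT s|lborel. complex_of_real (f b s))"
    by (rule integral_prod_Basis[OF c])
  also have "\<dots> = complex_of_real (\<Prod>b\<in>Basis. LINT s|lborel. f b s)"
    unfolding of_real_prod by (intro prod.cong refl integral_complex_of_real)
  finally show "(LINT x|lborel. (\<Prod>b\<in>Basis. f b (x \<bullet> b))) = (\<Prod>b\<in>Basis. LINT s|lborel. f b s)"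
    by (simp only: of_real_eq_iff)
  show "integrable lborel (\<lambda>x. \<Prod>b\<in>Basis. f b (x \<bullet> b))"
    using integrable_Re[OF integrable_prod_Basis[OF c]] by (simp flip: of_real_prod)
qed

lemma iexp_inner_Basis:
  fixes \<xi> x :: "'a::euclidean_space"
  shows "iexp (\<xi> \<bullet> x) = (\<Prod>b\<in>Basis. iexp ((\<xi> \<bullet> b) * (x \<bullet> b)))"
  by (subst euclidean_inner) (simp add: exp_sum sum_distrib_left)

text \<open>The Gaussian \<open>e\<^bsup>-\<sigma>\<^sup>2\<bar>\<xi>\<bar>\<^sup>2/2\<^esup>\<close>, kept as a product over the coordinates.\<close>

definition gauss :: "real \<Rightarrow> 'a::euclidean_space \<Rightarrow> real" where
  "gauss \<sigma> \<xi> = (\<Prod>b\<in>Basis. exp (- (\<sigma>\<^sup>2 * (\<xi> \<bullet> b)\<^sup>2 / 2)))"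

lemma gauss_eq: "gauss \<sigma> \<xi> = exp (- (\<sigma>\<^sup>2 * (norm \<xi>)\<^sup>2 / 2))"
proof -
  have "(norm \<xi>)\<^sup>2 = (\<Sum>b\<in>Basis. (\<xi> \<bullet> b)\<^sup>2)"
    unfolding power2_norm_eq_inner by (subst euclidean_inner) (simp add: power2_eq_square)
  then show ?thesis
    by (simp add: gauss_def sum_negf sum_distrib_left sum_divide_distrib flip: exp_sum)
qed

lemma fourier_gauss_1d:
  assumes "\<sigma> > 0"
  shows "integrable lborel (\<lambda>s. complex_of_real (exp (- (\<sigma>\<^sup>2 * s\<^sup>2 / 2))) * iexp (z * s))"
    and "(LINT s|lborel. complex_of_real (exp (- (\<sigma>\<^sup>2 * s\<^sup>2 / 2))) * iexp (z * s))
      = complex_of_real (2 * pi * normal_density 0 \<sigma> z)"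
proof -
  define h where "h = (\<lambda>s. complex_of_real (exp (- (\<sigma>\<^sup>2 * s\<^sup>2 / 2))) * iexp (z * s))"
  let ?g = "\<lambda>x. iexp (z / \<sigma> * x) * complex_of_real (std_normal_density x)"
  have int: "integrable lborel ?g"
  proof (rule Bochner_Integration.integrable_bound)
    show "integrable lborel std_normal_density" by simp
  qed (auto simp: norm_mult)
  have "char std_normal_distribution (z / \<sigma>) = (LINT x|lborel. ?g x)"
    unfolding char_def by (subst integral_density) (auto simp: scaleR_conv_of_real mult.commute)
  then have val: "(LINT x|lborel. ?g x) = complex_of_real (exp (- ((z / \<sigma>)\<^sup>2 / 2)))"
    by (simp add: char_std_normal_distribution)
  have gh: "?g (0 + \<sigma> * s) = complex_of_real (1 / sqrt (2 * pi)) * h s" for s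
    using assms by (simp add: h_def std_normal_density_def power_mult_distrib)
  have "integrable lborel (\<lambda>s. ?g (0 + \<sigma> * s))"
    using lborel_integrable_real_affine[OF int, of \<sigma> 0] assms by simp
  then have "integrable lborel (\<lambda>s. complex_of_real (1 / sqrt (2 * pi)) * h s)"
    unfolding gh .
  then have "integrable lborel (\<lambda>s. complex_of_real (sqrt (2 * pi)) * (complex_of_real (1 / sqrt (2 * pi)) * h s))"
    by (rule integrable_mult_right)
  moreover have "complex_of_real (sqrt (2 * pi)) * (complex_of_real (1 / sqrt (2 * pi)) * h s) = h s" for s
    by simp
  ultimately have "integrable lborel h" by (simp only:)
  then show "integrable lborel (\<lambda>s. complex_of_real (exp (- (\<sigma>\<^sup>2 * s\<^sup>2 / 2))) * iexp (z * s))"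
    unfolding h_def .
  have "(LINT x|lborel. ?g x) = \<bar>\<sigma>\<bar> *\<^sub>R (LINT s|lborel. ?g (0 + \<sigma> * s))"
    by (rule lborel_integral_real_affine) (use assms in simp)
  also have "\<dots> = complex_of_real (\<sigma> / sqrt (2 * pi)) * (LINT s|lborel. h s)"
    unfolding gh using assms by (simp add: scaleR_conv_of_real)
  finally have "(LINT s|lborel. h s) = complex_of_real (sqrt (2 * pi) / \<sigma> * exp (- ((z / \<sigma>)\<^sup>2 / 2)))"
    using assms val by (simp add: field_simps)
  also have "sqrt (2 * pi) / \<sigma> * exp (- ((z / \<sigma>)\<^sup>2 / 2)) = 2 * pi * normal_density 0 \<sigma> z"
  proof -
    have "2 * pi = sqrt (2 * pi) * sqrt (2 * pi)" by simp
    then have "2 * pi / sqrt (2 * pi * \<sigma>\<^sup>2) = sqrt (2 * pi) / \<sigma>"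
      using assms by (simp add: real_sqrt_mult field_simps)
    moreover have "normal_density 0 \<sigma> z = 1 / sqrt (2 * pi * \<sigma>\<^sup>2) * exp (- ((z / \<sigma>)\<^sup>2 / 2))"
      by (simp add: normal_density_def power_divide mult.commute)
    ultimately show ?thesis by (metis (no_types, lifting) mult.assoc mult.right_neutral times_divide_eq_right)
  qed
  finally show "(LINT s|lborel. complex_of_real (exp (- (\<sigma>\<^sup>2 * s\<^sup>2 / 2))) * iexp (z * s))
      = complex_of_real (2 * pi * normal_density 0 \<sigma> z)"
    unfolding h_def .
qed

text \<open>The Fourier transform of \<open>gauss \<sigma>\<close>. For the bound in Plancherel's inequality it matters only that it
  is nonnegative with an integral independent of \<open>\<sigma>\<close>.\<close>

definition gauss_kernel :: "real \<Rightarrow> 'a::euclidean_space \<Rightarrow> real" where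
  "gauss_kernel \<sigma> z = (\<Prod>b\<in>Basis. 2 * pi * normal_density 0 \<sigma> (z \<bullet> b))"

lemma fourier_gauss:
  fixes z :: "'a::euclidean_space"
  assumes "\<sigma> > 0"
  shows "integrable lborel (\<lambda>\<xi>::'a. complex_of_real (gauss \<sigma> \<xi>) * iexp (z \<bullet> \<xi>))"
    and "(LINT \<xi>|lborel. complex_of_real (gauss \<sigma> \<xi>) * iexp (z \<bullet> \<xi>))
      = complex_of_real (gauss_kernel \<sigma> z)"
proof -
  let ?f = "\<lambda>b s. complex_of_real (exp (- (\<sigma>\<^sup>2 * s\<^sup>2 / 2))) * iexp ((z \<bullet> b) * s)"
  have eq: "complex_of_real (gauss \<sigma> \<xi>) * iexp (z \<bullet> \<xi>) = (\<Prod>b\<in>Basis. ?f b (\<xi> \<bullet> b))" for \<xi>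
    unfolding gauss_def iexp_inner_Basis of_real_prod prod.distrib ..
  show "integrable lborel (\<lambda>\<xi>::'a. complex_of_real (gauss \<sigma> \<xi>) * iexp (z \<bullet> \<xi>))"
    unfolding eq by (rule integrable_prod_Basis[OF fourier_gauss_1d(1)[OF assms]])
  show "(LINT \<xi>|lborel. complex_of_real (gauss \<sigma> \<xi>) * iexp (z \<bullet> \<xi>))
      = complex_of_real (gauss_kernel \<sigma> z)"
    unfolding eq by (subst integral_prod_Basis[OF fourier_gauss_1d(1)[OF assms]])
      (simp only: fourier_gauss_1d(2)[OF assms] gauss_kernel_def of_real_prod)
qed

lemma gauss_kernel_nonneg: "0 \<le> gauss_kernel \<sigma> z"
  unfolding gauss_kernel_def by (intro prod_nonneg) simp

lemma gauss_kernel_integral: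
  assumes "\<sigma> > 0"
  shows "integrable lborel (gauss_kernel \<sigma> :: 'a::euclidean_space \<Rightarrow> real)"
    and "(LINT z|lborel. gauss_kernel \<sigma> (z :: 'a)) = (2 * pi) ^ DIM('a)"
proof -
  have 1: "integrable lborel (\<lambda>s. 2 * pi * normal_density 0 \<sigma> s)"
    using integrable_normal_density[OF assms] by simp
  have 2: "(LINT s|lborel. 2 * pi * normal_density 0 \<sigma> s) = 2 * pi"
    by (simp add: integral_normal_density[OF assms])
  show "integrable lborel (gauss_kernel \<sigma> :: 'a::euclidean_space \<Rightarrow> real)"
    unfolding gauss_kernel_def[abs_def] by (rule integral_prod_Basis_real[OF 1])
  show "(LINT z|lborel. gauss_kernel \<sigma> (z :: 'a)) = (2 * pi) ^ DIM('a)"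
    unfolding gauss_kernel_def[abs_def]
    by (subst integral_prod_Basis_real(2)[OF 1]) (simp_all only: 2 prod_constant)
qed

lemma gauss_integral:
  assumes "\<sigma> > 0"
  shows "integrable lborel (gauss \<sigma> :: 'a::euclidean_space \<Rightarrow> real)"
    and "(LINT \<xi>|lborel. gauss \<sigma> (\<xi>::'a)) = (sqrt (2 * pi) / \<sigma>) ^ DIM('a)"
proof -
  have "integrable lborel (\<lambda>\<xi>::'a. complex_of_real (gauss \<sigma> \<xi>))"
    "(LINT \<xi>|lborel. complex_of_real (gauss \<sigma> (\<xi>::'a))) = complex_of_real (gauss_kernel \<sigma> (0::'a))"
    using fourier_gauss[OF assms, of "0::'a"] by simp_all
  then have 1: "integrable lborel (gauss \<sigma> :: 'a \<Rightarrow> real)"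
    and 2: "(LINT \<xi>|lborel. gauss \<sigma> (\<xi>::'a)) = gauss_kernel \<sigma> (0::'a)"
    using integrable_Re[of lborel "\<lambda>\<xi>::'a. complex_of_real (gauss \<sigma> \<xi>)"] by simp_all
  show "integrable lborel (gauss \<sigma> :: 'a \<Rightarrow> real)" by fact
  have "2 * pi = sqrt (2 * pi) * sqrt (2 * pi)" by simp
  then have "2 * pi / sqrt (2 * pi * \<sigma>\<^sup>2) = sqrt (2 * pi) / \<sigma>"
    using assms by (simp add: real_sqrt_mult field_simps)
  then show "(LINT \<xi>|lborel. gauss \<sigma> (\<xi>::'a)) = (sqrt (2 * pi) / \<sigma>) ^ DIM('a)"
    unfolding 2 by (simp add: gauss_kernel_def normal_density_def)
qed

lemma lborel_integral_translate:
  fixes f :: "'a::euclidean_space \<Rightarrow> 'b::{banach, second_countable_topology}"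
  assumes "integrable lborel f"
  shows "integrable lborel (\<lambda>x. f (x - c))" "(LINT x|lborel. f (x - c)) = (LINT x|lborel. f x)"
proof -
  have [measurable]: "f \<in> borel_measurable borel" using assms by auto
  have d: "lborel = distr lborel borel (\<lambda>x::'a. - c + x)" by (rule lborel_distr_plus[symmetric])
  have "integrable (distr lborel borel (\<lambda>x::'a. - c + x)) f" using assms d by simp
  then show "integrable lborel (\<lambda>x. f (x - c))"
    by (subst (asm) integrable_distr_eq) auto
  have "(LINT x|lborel. f x) = (LINT x|distr lborel borel (\<lambda>x::'a. - c + x). f x)" using d by simp
  then show "(LINT x|lborel. f (x - c)) = (LINT x|lborel. f x)"
    by (subst (asm) integral_distr) auto
qed

lemma lborel_integral_reflect:
  fixes f :: "'a::euclidean_space \<Rightarrow> 'b::{banach, second_countable_topology}"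
  assumes "integrable lborel f"
  shows "integrable lborel (\<lambda>x. f (c - x))" "(LINT x|lborel. f (c - x)) = (LINT x|lborel. f x)"
proof -
  have [measurable]: "f \<in> borel_measurable borel" using assms by auto
  have d: "lborel = distr lborel borel (\<lambda>x::'a. c - x)"
    using lborel_affine[of "-1" c] by (simp add: density_1)
  have "integrable (distr lborel borel (\<lambda>x::'a. c - x)) f" using assms d by simp
  then show "integrable lborel (\<lambda>x. f (c - x))"
    by (subst (asm) integrable_distr_eq) auto
  have "(LINT x|lborel. f x) = (LINT x|distr lborel borel (\<lambda>x::'a. c - x). f x)" using d by simp
  then show "(LINT x|lborel. f (c - x)) = (LINT x|lborel. f x)"
    by (subst (asm) integral_distr) auto
qed

lemma gauss_kernel_measurable [measurable]: "gauss_kernel \<sigma> \<in> borel_measurable borel"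
  unfolding gauss_kernel_def[abs_def] by measurable

lemma gauss_measurable [measurable]: "gauss \<sigma> \<in> borel_measurable borel"
  unfolding gauss_def[abs_def] by measurable

lemma gauss_nonneg: "0 \<le> gauss \<sigma> \<xi>"
  by (simp add: gauss_eq)

lemma integrable_tensor:
  fixes f :: "'a::euclidean_space \<Rightarrow> complex" and g :: "'b::euclidean_space \<Rightarrow> complex"
  assumes "integrable lborel f" "integrable lborel g"
  shows "integrable (lborel \<Otimes>\<^sub>M lborel) (\<lambda>(x, y). f x * g y)"
proof -
  have [measurable]: "f \<in> borel_measurable borel" "g \<in> borel_measurable borel" using assms by auto
  show ?thesis
    by (rule lborel_pair.Fubini_integrable) (use assms in \<open>auto simp: norm_mult\<close>)
qed

text \<open>Writing the square of the Fourier integral as a double integral and exchanging the integrations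
  leaves the integral over \<open>\<xi>\<close> of the weight alone, which is the kernel at \<open>y - x\<close>.\<close>

lemma integral_gauss_fourier_sq:
  fixes f :: "'a::euclidean_space \<Rightarrow> complex"
  assumes f: "integrable lborel f" and \<sigma>: "\<sigma> > 0"
  shows "complex_of_real (LINT \<xi>|lborel. gauss \<sigma> \<xi> * (norm (fourier_integral f \<xi>))\<^sup>2)
     = (LINT p|(lborel :: ('a \<times> 'a) measure).
          f (fst p) * cnj (f (snd p)) * complex_of_real (gauss_kernel \<sigma> (snd p - fst p)))"
proof -
  have [measurable]: "f \<in> borel_measurable borel" using f by auto
  have [measurable]: "cnj \<in> borel_measurable borel"
    by (intro borel_measurable_continuous_onI continuous_intros)
  define F where "F = (\<lambda>p::'a \<times> 'a. f (fst p) * cnj (f (snd p)))"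
  have [measurable]: "F \<in> borel_measurable borel"
    unfolding F_def borel_prod[symmetric] by measurable
  have Fint: "integrable lborel F"
    using integrable_tensor[OF f, of "\<lambda>y. cnj (f y)"] f
    by (simp add: F_def lborel_prod case_prod_beta')
  define e where "e = (\<lambda>(p::'a \<times> 'a) (\<xi>::'a). complex_of_real (gauss \<sigma> \<xi>) * iexp ((snd p - fst p) \<bullet> \<xi>))"
  have ne: "norm (e p \<xi>) = gauss \<sigma> \<xi>" for p \<xi>
    by (simp add: e_def norm_mult gauss_nonneg)
  have sq: "complex_of_real (gauss \<sigma> \<xi> * (norm (fourier_integral f \<xi>))\<^sup>2) = (LINT p|lborel. F p * e p \<xi>)" for \<xi>
  proof -
    let ?h = "\<lambda>x. f x * exp (- (\<i> * complex_of_real (\<xi> \<bullet> x)))"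
    have h: "integrable lborel ?h" by (rule integrable_fourier_integrand[OF f])
    then have h': "integrable lborel (\<lambda>x. cnj (?h x))" by (rule integrable_cnj)
    have "complex_of_real ((norm (fourier_integral f \<xi>))\<^sup>2) = (LINT x|lborel. ?h x) * cnj (LINT x|lborel. ?h x)"
      by (simp only: complex_norm_square fourier_integral_def)
    also have "\<dots> = (LINT x|lborel. ?h x) * (LINT y|lborel. cnj (?h y))"
      by (simp only: Bochner_Integration.integral_cnj)
    also have "\<dots> = (LINT x|lborel. (LINT y|lborel. ?h x * cnj (?h y)))"
      by simp
    also have "\<dots> = (LINT p|(lborel \<Otimes>\<^sub>M lborel). (case p of (x, y) \<Rightarrow> ?h x * cnj (?h y)))"
      using lborel_pair.integral_fst[OF integrable_tensor[OF h h']] by simp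
    also have "\<dots> = (LINT p|lborel. ?h (fst p) * cnj (?h (snd p)))"
      by (simp only: lborel_prod case_prod_beta')
    finally have "complex_of_real (gauss \<sigma> \<xi> * (norm (fourier_integral f \<xi>))\<^sup>2)
       = (LINT p|lborel. complex_of_real (gauss \<sigma> \<xi>) * (?h (fst p) * cnj (?h (snd p))))"
      by simp
    also have "\<dots> = (LINT p|lborel. F p * e p \<xi>)"
    proof (intro Bochner_Integration.integral_cong refl)
      fix p :: "'a \<times> 'a"
      have "exp (- (\<i> * complex_of_real (\<xi> \<bullet> fst p))) * cnj (exp (- (\<i> * complex_of_real (\<xi> \<bullet> snd p))))
         = iexp ((snd p - fst p) \<bullet> \<xi>)"
        by (simp add: exp_cnj inner_diff_left inner_commute algebra_simps flip: exp_add)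
      then show "complex_of_real (gauss \<sigma> \<xi>) * (?h (fst p) * cnj (?h (snd p))) = F p * e p \<xi>"
        unfolding F_def e_def complex_cnj_mult by (metis (no_types, lifting) mult.assoc mult.left_commute)
    qed
    finally show ?thesis .
  qed
  have em: "(\<lambda>q. e (fst q) (snd q)) \<in> borel_measurable borel"
    unfolding e_def borel_prod[symmetric] by measurable
  have int: "integrable (lborel \<Otimes>\<^sub>M lborel) (\<lambda>(p, \<xi>). F p * e p \<xi>)"
  proof (rule lborel_pair.Fubini_integrable)
    show "(\<lambda>(p, \<xi>). F p * e p \<xi>) \<in> borel_measurable (lborel \<Otimes>\<^sub>M lborel)"
    proof -
      have Fm: "F \<in> borel_measurable borel" by measurable
      have "(\<lambda>q::('a \<times> 'a) \<times> 'a. F (fst q)) \<in> borel_measurable borel"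
        by (rule measurable_compose[OF _ Fm]) (intro borel_measurable_continuous_onI continuous_intros)
      from borel_measurable_times[OF this em] show ?thesis
        by (simp add: case_prod_beta' lborel_prod)
    qed
    show "integrable lborel (\<lambda>p. LINT \<xi>|lborel. norm (case (p, \<xi>) of (p, \<xi>) \<Rightarrow> F p * e p \<xi>))"
      using Fint by (simp add: norm_mult ne)
    show "AE p in lborel. integrable lborel (\<lambda>\<xi>. case (p, \<xi>) of (p, \<xi>) \<Rightarrow> F p * e p \<xi>)"
      unfolding e_def prod.case by (intro AE_I2 integrable_mult_right fourier_gauss(1) \<sigma>)
  qed
  have "complex_of_real (LINT \<xi>|lborel. gauss \<sigma> \<xi> * (norm (fourier_integral f \<xi>))\<^sup>2)
      = (LINT \<xi>|lborel. complex_of_real (gauss \<sigma> \<xi> * (norm (fourier_integral f \<xi>))\<^sup>2))"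
    by (rule integral_complex_of_real[symmetric])
  also have "\<dots> = (LINT \<xi>|lborel. (LINT p|lborel. F p * e p \<xi>))"
    by (simp only: sq)
  also have "\<dots> = (LINT p|lborel. (LINT \<xi>|lborel. F p * e p \<xi>))"
    by (rule lborel_pair.Fubini_integral[OF int])
  also have "\<dots> = (LINT p|lborel. F p * complex_of_real (gauss_kernel \<sigma> (snd p - fst p)))"
    unfolding e_def by (simp add: fourier_gauss(2)[OF \<sigma>])
  finally show ?thesis unfolding F_def .
qed

lemma nn_integral_shifted_kernel:
  fixes g K :: "'a::euclidean_space \<Rightarrow> real"
  assumes [measurable]: "g \<in> borel_measurable borel" and K: "integrable lborel K"
    and nonneg: "\<And>x. 0 \<le> g x" "\<And>x. 0 \<le> K x"
  shows "(\<integral>\<^sup>+x. \<integral>\<^sup>+y. ennreal (g x * K (y - x)) \<partial>lborel \<partial>lborel)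
      = ennreal (LINT z|lborel. K z) * (\<integral>\<^sup>+x. ennreal (g x) \<partial>lborel)"
    and "(\<integral>\<^sup>+x. \<integral>\<^sup>+y. ennreal (g y * K (y - x)) \<partial>lborel \<partial>lborel)
      = ennreal (LINT z|lborel. K z) * (\<integral>\<^sup>+x. ennreal (g x) \<partial>lborel)"
proof -
  have [measurable]: "K \<in> borel_measurable borel" using K by auto
  have 1: "(\<integral>\<^sup>+y. ennreal (K (y - x)) \<partial>lborel) = ennreal (LINT z|lborel. K z)" for x
    using lborel_integral_translate[OF K, of x] nonneg by (simp add: nn_integral_eq_integral)
  have 2: "(\<integral>\<^sup>+x. ennreal (K (y - x)) \<partial>lborel) = ennreal (LINT z|lborel. K z)" for y
    using lborel_integral_reflect[OF K, of y] nonneg by (simp add: nn_integral_eq_integral)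
  show "(\<integral>\<^sup>+x. \<integral>\<^sup>+y. ennreal (g x * K (y - x)) \<partial>lborel \<partial>lborel)
      = ennreal (LINT z|lborel. K z) * (\<integral>\<^sup>+x. ennreal (g x) \<partial>lborel)"
    by (simp add: ennreal_mult nonneg nn_integral_cmult 1 nn_integral_multc mult.commute)
  have "(\<integral>\<^sup>+x. \<integral>\<^sup>+y. ennreal (g y * K (y - x)) \<partial>lborel \<partial>lborel)
      = (\<integral>\<^sup>+y. \<integral>\<^sup>+x. ennreal (g y * K (y - x)) \<partial>lborel \<partial>lborel)"
    by (rule lborel_pair.Fubini') measurable
  also have "\<dots> = ennreal (LINT z|lborel. K z) * (\<integral>\<^sup>+x. ennreal (g x) \<partial>lborel)"
    by (simp add: ennreal_mult nonneg nn_integral_cmult 2 nn_integral_multc mult.commute)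
  finally show "(\<integral>\<^sup>+x. \<integral>\<^sup>+y. ennreal (g y * K (y - x)) \<partial>lborel \<partial>lborel)
      = ennreal (LINT z|lborel. K z) * (\<integral>\<^sup>+x. ennreal (g x) \<partial>lborel)" .
qed

text \<open>Schur's test: \<open>\<bar>f(x)\<bar> \<bar>f(y)\<bar> \<le> (\<bar>f(x)\<bar>\<^sup>2 + \<bar>f(y)\<bar>\<^sup>2) / 2\<close>, and each half is integrated against the kernel in
  the other variable first.\<close>

lemma gauss_fourier_sq_le:
  fixes f :: "'a::euclidean_space \<Rightarrow> complex"
  assumes f: "integrable lborel f" "f \<in> L2_space" and \<sigma>: "\<sigma> > 0"
  shows "(\<integral>\<^sup>+\<xi>. ennreal (gauss \<sigma> \<xi> * (norm (fourier_integral f \<xi>))\<^sup>2) \<partial>lborel)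
     \<le> ennreal ((2 * pi) ^ DIM('a)) * ennreal ((L2_norm f)\<^sup>2)"
proof -
  have [measurable]: "f \<in> borel_measurable borel" using f by auto
  have [measurable]: "fourier_integral f \<in> borel_measurable borel" by (rule fourier_integral_measurable) fact
  let ?K = "gauss_kernel \<sigma> :: 'a \<Rightarrow> real"
  let ?G = "\<lambda>\<xi>. gauss \<sigma> \<xi> * (norm (fourier_integral f \<xi>))\<^sup>2"
  have int: "integrable lborel ?G"
  proof (rule Bochner_Integration.integrable_bound)
    show "integrable lborel (\<lambda>\<xi>::'a. gauss \<sigma> \<xi> * (LINT x|lborel. norm (f x))\<^sup>2)"
      by (intro integrable_mult_left gauss_integral(1) \<sigma>)
    show "AE \<xi> in lborel. norm (?G \<xi>) \<le> norm (gauss \<sigma> \<xi> * (LINT x|lborel. norm (f x))\<^sup>2)"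
      using norm_fourier_integral_le[of f]
      by (intro AE_I2) (auto simp: gauss_nonneg abs_mult intro!: mult_left_mono power_mono)
  qed simp
  have "(\<integral>\<^sup>+\<xi>. ennreal (?G \<xi>) \<partial>lborel) = ennreal (LINT \<xi>|lborel. ?G \<xi>)"
    by (rule nn_integral_eq_integral[OF int]) (simp add: gauss_nonneg)
  also have "\<dots> \<le> ennreal (norm (complex_of_real (LINT \<xi>|lborel. ?G \<xi>)))"
    by (intro ennreal_leI) simp
  also have "\<dots> \<le> (\<integral>\<^sup>+p. ennreal (norm (f (fst p) * cnj (f (snd p)) * complex_of_real (?K (snd p - fst p)))) \<partial>lborel)"
    unfolding integral_gauss_fourier_sq[OF f(1) \<sigma>]
  proof (rule integral_norm_bound_ennreal)
    let ?c = "\<Prod>b\<in>(Basis::'a set). 2 * pi / sqrt (2 * pi * \<sigma>\<^sup>2)"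
    show "integrable lborel (\<lambda>p::'a \<times> 'a. f (fst p) * cnj (f (snd p)) * complex_of_real (?K (snd p - fst p)))"
    proof (rule Bochner_Integration.integrable_bound)
      have "integrable lborel (\<lambda>p. f (fst p) * cnj (f (snd p)))"
        using integrable_tensor[OF f(1), of "\<lambda>y. cnj (f y)"] f
        by (simp add: lborel_prod case_prod_beta')
      then show "integrable lborel (\<lambda>p. complex_of_real ?c * (f (fst p) * cnj (f (snd p))))"
        by (rule integrable_mult_right)
      have "?K z \<le> ?c" for z
        unfolding gauss_kernel_def
      proof (intro prod_mono conjI)
        fix b :: 'a
        have "exp (- ((z \<bullet> b)\<^sup>2 / (2 * \<sigma>\<^sup>2))) \<le> 1" by simp
        from mult_left_mono[OF this, of "2 * pi / sqrt (2 * pi * \<sigma>\<^sup>2)"]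
        show "2 * pi * normal_density 0 \<sigma> (z \<bullet> b) \<le> 2 * pi / sqrt (2 * pi * \<sigma>\<^sup>2)"
          by (simp add: normal_density_def)
      qed simp
      then have "norm (f (fst p) * cnj (f (snd p)) * complex_of_real (?K (snd p - fst p)))
        \<le> norm (complex_of_real ?c * (f (fst p) * cnj (f (snd p))))" for p
        unfolding norm_mult norm_of_real
        by (subst mult.commute) (intro mult_right_mono, auto simp: gauss_kernel_nonneg intro: order_trans[OF _ abs_ge_self])
      then show "AE p in lborel. norm (f (fst p) * cnj (f (snd p)) * complex_of_real (?K (snd p - fst p)))
        \<le> norm (complex_of_real ?c * (f (fst p) * cnj (f (snd p))))"
        by simp
      have [measurable]: "cnj \<in> borel_measurable borel"
        by (intro borel_measurable_continuous_onI continuous_intros)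
      show "(\<lambda>p::'a \<times> 'a. f (fst p) * cnj (f (snd p)) * complex_of_real (?K (snd p - fst p))) \<in> borel_measurable lborel"
        unfolding measurable_lborel2 borel_prod[symmetric] by measurable
    qed
  qed
  also have "\<dots> = (\<integral>\<^sup>+x. \<integral>\<^sup>+y. ennreal (norm (f x) * norm (f y) * ?K (y - x)) \<partial>lborel \<partial>lborel)"
    unfolding lborel_prod[symmetric]
    by (subst lborel.nn_integral_fst[symmetric]) (auto simp: norm_mult gauss_kernel_nonneg)
  also have "\<dots> \<le> (\<integral>\<^sup>+x. \<integral>\<^sup>+y. ennreal (((norm (f x))\<^sup>2 / 2) * ?K (y - x)) + ennreal (((norm (f y))\<^sup>2 / 2) * ?K (y - x)) \<partial>lborel \<partial>lborel)"
  proof (intro nn_integral_mono)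
    fix x y :: 'a
    have "norm (f x) * norm (f y) \<le> (norm (f x))\<^sup>2 / 2 + (norm (f y))\<^sup>2 / 2"
      using sum_squares_bound[of "norm (f x)" "norm (f y)"] by simp
    from mult_right_mono[OF this gauss_kernel_nonneg[of \<sigma> "y - x"]]
    show "ennreal (norm (f x) * norm (f y) * ?K (y - x))
      \<le> ennreal (((norm (f x))\<^sup>2 / 2) * ?K (y - x)) + ennreal (((norm (f y))\<^sup>2 / 2) * ?K (y - x))"
      by (subst ennreal_plus[symmetric]) (simp_all add: gauss_kernel_nonneg distrib_right ennreal_leI del: ennreal_plus)
  qed
  also have "\<dots> = (\<integral>\<^sup>+x. \<integral>\<^sup>+y. ennreal (((norm (f x))\<^sup>2 / 2) * ?K (y - x)) \<partial>lborel \<partial>lborel)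
      + (\<integral>\<^sup>+x. \<integral>\<^sup>+y. ennreal (((norm (f y))\<^sup>2 / 2) * ?K (y - x)) \<partial>lborel \<partial>lborel)"
    by (simp add: nn_integral_add)
  also have "\<dots> = ennreal ((2 * pi) ^ DIM('a)) * (\<integral>\<^sup>+x. ennreal ((norm (f x))\<^sup>2 / 2) \<partial>lborel)
      + ennreal ((2 * pi) ^ DIM('a)) * (\<integral>\<^sup>+x. ennreal ((norm (f x))\<^sup>2 / 2) \<partial>lborel)"
  proof -
    have m: "(\<lambda>x. (norm (f x))\<^sup>2 / 2) \<in> borel_measurable borel" by simp
    have "0 \<le> (norm (f x))\<^sup>2 / 2" for x by simp
    then show ?thesis
      by (simp only: nn_integral_shifted_kernel[OF m gauss_kernel_integral(1)[OF \<sigma>] _ gauss_kernel_nonneg]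
          gauss_kernel_integral(2)[OF \<sigma>])
  qed
  also have "\<dots> = ennreal ((2 * pi) ^ DIM('a)) * (\<integral>\<^sup>+x. ennreal ((norm (f x))\<^sup>2 / 2) + ennreal ((norm (f x))\<^sup>2 / 2) \<partial>lborel)"
    by (simp add: nn_integral_add distrib_left)
  also have "(\<integral>\<^sup>+x. ennreal ((norm (f x))\<^sup>2 / 2) + ennreal ((norm (f x))\<^sup>2 / 2) \<partial>lborel) = sq_int f"
    by (intro nn_integral_cong) (simp flip: ennreal_plus)
  also have "\<dots> = ennreal ((L2_norm f)\<^sup>2)" by (rule nn_integral_norm_sq[OF f(2)])
  finally show ?thesis .
qed

text \<open>As \<open>\<sigma>\<close> tends to \<open>0\<close> the weights tend to \<open>1\<close> while the bound stays fixed, so Fatou's lemma applies.\<close>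

lemma Plancherel_le:
  fixes f :: "'a::euclidean_space \<Rightarrow> complex"
  assumes f: "integrable lborel f" "f \<in> L2_space"
  shows "sq_int (fourier_integral f)
     \<le> ennreal ((2 * pi) ^ DIM('a)) * ennreal ((L2_norm f)\<^sup>2)"
proof -
  have [measurable]: "f \<in> borel_measurable borel" using f by auto
  have [measurable]: "fourier_integral f \<in> borel_measurable borel" by (rule fourier_integral_measurable) fact
  let ?G = "\<lambda>k \<xi>. ennreal (gauss (1 / real (Suc k)) \<xi> * (norm (fourier_integral f \<xi>))\<^sup>2)"
  have "sq_int (fourier_integral f) = (\<integral>\<^sup>+\<xi>. liminf (\<lambda>k. ?G k \<xi>) \<partial>lborel)"
  proof (intro nn_integral_cong)
    fix \<xi> :: 'a
    have "(\<lambda>k. gauss (1 / real (Suc k)) \<xi> * (norm (fourier_integral f \<xi>))\<^sup>2)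
        \<longlonglongrightarrow> exp (- (0\<^sup>2 * (norm \<xi>)\<^sup>2 / 2)) * (norm (fourier_integral f \<xi>))\<^sup>2"
      unfolding gauss_eq by (intro tendsto_intros LIMSEQ_Suc lim_1_over_n) simp
    then have "(\<lambda>k. ?G k \<xi>) \<longlonglongrightarrow> ennreal ((norm (fourier_integral f \<xi>))\<^sup>2)"
      by (intro tendsto_ennrealI) simp
    then show "ennreal ((norm (fourier_integral f \<xi>))\<^sup>2) = liminf (\<lambda>k. ?G k \<xi>)"
      by (metis lim_imp_Liminf sequentially_bot)
  qed
  also have "\<dots> \<le> liminf (\<lambda>k. \<integral>\<^sup>+\<xi>. ?G k \<xi> \<partial>lborel)"
    by (intro nn_integral_liminf) simp
  also have "\<dots> \<le> ennreal ((2 * pi) ^ DIM('a)) * ennreal ((L2_norm f)\<^sup>2)"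
    by (intro Liminf_le always_eventually allI gauss_fourier_sq_le f) auto
  finally show ?thesis .
qed

section \<open>Smooth bumps on the line\<close>

text \<open>The functions \<open>p(1/x) e\<^bsup>-1/x\<^esup>\<close> on the positive half-line are closed under differentiation, which makes
  them smooth without any discussion of higher derivatives at \<open>0\<close>.\<close>

definition exp_tail :: "real poly \<Rightarrow> real \<Rightarrow> real" where
  "exp_tail p x = (if x > 0 then poly p (1 / x) * exp (- (1 / x)) else 0)"

lemma poly_exp_tendsto_0: "((\<lambda>y. poly p y * exp (- y)) \<longlongrightarrow> 0) at_top" for p :: "real poly"
proof (induction p)
  case (pCons a p)
  have "((\<lambda>y. poly p y * y / exp y) \<longlongrightarrow> 0) at_top"
  proof -
    have "((\<lambda>y. (\<Sum>i\<le>degree p. coeff p i * (y ^ Suc i / exp y))) \<longlongrightarrow> (\<Sum>i\<le>degree p. coeff p i * 0)) at_top"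
      by (intro tendsto_intros tendsto_power_div_exp_0)
    moreover have "poly p y * y / exp y = (\<Sum>i\<le>degree p. coeff p i * (y ^ Suc i / exp y))" for y
      unfolding poly_altdef sum_distrib_right sum_divide_distrib by (intro sum.cong) auto
    ultimately show ?thesis by simp
  qed
  moreover have "((\<lambda>y. a / exp y) \<longlongrightarrow> 0) at_top"
    using tendsto_mult[OF tendsto_const[of a] tendsto_power_div_exp_0[of 0]] by simp
  ultimately have "((\<lambda>y. a / exp y + poly p y * y / exp y) \<longlongrightarrow> 0 + 0) at_top"
    by (rule tendsto_add[rotated])
  then show ?case by (simp add: exp_minus field_simps)
qed simp

text \<open>Away from \<open>0\<close> this is the chain rule. At \<open>0\<close> the difference quotient is again a polynomial in \<open>1/h\<close>
  times \<open>e\<^bsup>-1/h\<^esup>\<close>, which tends to \<open>0\<close>.\<close>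

lemma exp_tail_deriv:
  "(exp_tail p has_real_derivative exp_tail ([:0, 0, 1:] * (p - pderiv p)) x) (at x)"
proof -
  consider "x > 0" | "x < 0" | "x = 0" by linarith
  then show ?thesis
  proof cases
    case 1
    have "((\<lambda>x. poly p (1 / x) * exp (- (1 / x))) has_real_derivative
        (poly (pderiv p) (1 / x) * (- (1 / x\<^sup>2)) * exp (- (1 / x)) + poly p (1 / x) * (exp (- (1 / x)) * (1 / x\<^sup>2)))) (at x)"
      using 1 by (auto intro!: derivative_eq_intros simp: power2_eq_square)
    moreover have "poly (pderiv p) (1 / x) * (- (1 / x\<^sup>2)) * exp (- (1 / x)) + poly p (1 / x) * (exp (- (1 / x)) * (1 / x\<^sup>2))
        = exp_tail ([:0, 0, 1:] * (p - pderiv p)) x"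
      using 1 by (simp add: exp_tail_def field_simps power2_eq_square)
    ultimately have "((\<lambda>x. poly p (1 / x) * exp (- (1 / x))) has_real_derivative exp_tail ([:0, 0, 1:] * (p - pderiv p)) x) (at x)"
      by simp
    then show ?thesis
      by (rule DERIV_cong_ev[THEN iffD1, rotated -1])
         (use 1 in \<open>auto simp: exp_tail_def eventually_nhds intro!: exI[of _ "{0<..}"]\<close>)
  next
    case 2
    have "((\<lambda>_. 0) has_real_derivative 0) (at x)" by simp
    then have "(exp_tail p has_real_derivative 0) (at x)"
      by (rule DERIV_cong_ev[THEN iffD1, rotated -1])
         (use 2 in \<open>auto simp: exp_tail_def eventually_nhds intro!: exI[of _ "{..<0}"]\<close>)
    then show ?thesis using 2 by (simp add: exp_tail_def)
  next
    case 3
    have "((\<lambda>h. exp_tail p h / h) \<longlongrightarrow> 0) (at_right 0)"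
    proof -
      have "((\<lambda>h. poly ([:0, 1:] * p) (inverse h) * exp (- inverse h)) \<longlongrightarrow> 0) (at_right 0)"
        by (rule filterlim_compose[OF poly_exp_tendsto_0 filterlim_inverse_at_top_right])
      then show ?thesis
        by (rule Lim_transform_eventually)
           (auto simp: eventually_at_right_field exp_tail_def field_simps intro!: exI[of _ 1])
    qed
    moreover have "((\<lambda>h. exp_tail p h / h) \<longlongrightarrow> 0) (at_left 0)"
      by (rule tendsto_eventually) (auto simp: eventually_at_left_field exp_tail_def intro!: exI[of _ "-1"])
    ultimately have "((\<lambda>h. exp_tail p h / h) \<longlongrightarrow> 0) (at 0)"
      by (simp add: filterlim_split_at)
    then show ?thesis using 3 by (simp add: DERIV_def exp_tail_def)
  qed
qed

text \<open>Products of two such tails vanish outside \<open>\<bar>\<kappa> s\<bar> < 1\<close>; closing them under addition accommodates the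
  product rule.\<close>

inductive_set bump_family :: "real \<Rightarrow> (real \<Rightarrow> real) set" for \<kappa> :: real where
  prod: "(\<lambda>s. exp_tail p (1 + \<kappa> * s) * exp_tail q (1 - \<kappa> * s)) \<in> bump_family \<kappa>"
| add: "f \<in> bump_family \<kappa> \<Longrightarrow> g \<in> bump_family \<kappa> \<Longrightarrow> (\<lambda>s. f s + g s) \<in> bump_family \<kappa>"

lemma bump_family_deriv:
  assumes "f \<in> bump_family \<kappa>"
  shows "\<exists>g\<in>bump_family \<kappa>. \<forall>s. (f has_real_derivative g s) (at s)"
  using assms
proof induction
  case (prod p q)
  define D where "D = (\<lambda>p::real poly. [:0, 0, 1:] * (p - pderiv p))"
  have *: "(exp_tail p has_real_derivative exp_tail (D p) x) (at x)" for p x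
    unfolding D_def by (rule exp_tail_deriv)
  have smult: "c * exp_tail p x = exp_tail (smult c p) x" for c p x
    by (simp add: exp_tail_def)
  have 1: "((\<lambda>s. exp_tail p (1 + \<kappa> * s)) has_real_derivative \<kappa> * exp_tail (D p) (1 + \<kappa> * s)) (at s)" for s
    by (rule DERIV_chain2[OF *, THEN DERIV_cong]) (auto intro!: derivative_eq_intros)
  have 2: "((\<lambda>s. exp_tail q (1 - \<kappa> * s)) has_real_derivative (-\<kappa>) * exp_tail (D q) (1 - \<kappa> * s)) (at s)" for s
    by (rule DERIV_chain2[OF *, THEN DERIV_cong]) (auto intro!: derivative_eq_intros)
  show ?case
  proof (rule bexI)
    show "\<forall>s. ((\<lambda>s. exp_tail p (1 + \<kappa> * s) * exp_tail q (1 - \<kappa> * s)) has_real_derivative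
       exp_tail (smult \<kappa> (D p)) (1 + \<kappa> * s) * exp_tail q (1 - \<kappa> * s)
       + exp_tail p (1 + \<kappa> * s) * exp_tail (smult (- \<kappa>) (D q)) (1 - \<kappa> * s)) (at s)"
      by (intro allI DERIV_cong[OF DERIV_mult[OF 1 2]], simp only: smult[symmetric]) (simp add: mult_ac)
    show "(\<lambda>s. exp_tail (smult \<kappa> (D p)) (1 + \<kappa> * s) * exp_tail q (1 - \<kappa> * s)
       + exp_tail p (1 + \<kappa> * s) * exp_tail (smult (- \<kappa>) (D q)) (1 - \<kappa> * s)) \<in> bump_family \<kappa>"
      by (intro bump_family.intros)
  qed
next
  case (add f g)
  then obtain f' g' where "f' \<in> bump_family \<kappa>" "g' \<in> bump_family \<kappa>"
    "\<forall>s. (f has_real_derivative f' s) (at s)" "\<forall>s. (g has_real_derivative g' s) (at s)" by blast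
  then show ?case
    by (intro bexI[of _ "\<lambda>s. f' s + g' s"]) (auto intro: bump_family.add DERIV_add)
qed

lemma bump_family_support:
  assumes "f \<in> bump_family \<kappa>" "\<bar>\<kappa> * s\<bar> \<ge> 1"
  shows "f s = 0"
  using assms by induction (auto simp: exp_tail_def)

text \<open>A sequence of functions of which each is the derivative of its predecessor stands for one
  smooth function; the index counts derivatives.\<close>

definition smooth_bump :: "real \<Rightarrow> (nat \<Rightarrow> real \<Rightarrow> real) \<Rightarrow> bool" where
  "smooth_bump \<rho> d \<longleftrightarrow> (\<forall>j s. (d j has_real_derivative d (Suc j) s) (at s)) \<and> (\<forall>j s. \<bar>s\<bar> \<ge> \<rho> \<longrightarrow> d j s = 0)"

lemma smooth_bump_exists:
  assumes "\<kappa> > 0"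
  shows "\<exists>d. smooth_bump (1 / \<kappa>) d \<and> (\<forall>s. 0 \<le> d 0 s) \<and> d 0 0 > 0"
proof -
  define f where "f = (\<lambda>s. exp_tail 1 (1 + \<kappa> * s) * exp_tail 1 (1 - \<kappa> * s))"
  obtain D where D: "\<And>f. f \<in> bump_family \<kappa> \<Longrightarrow> D f \<in> bump_family \<kappa> \<and> (\<forall>s. (f has_real_derivative D f s) (at s))"
  proof
    fix f assume "f \<in> bump_family \<kappa>"
    then have "\<exists>g. g \<in> bump_family \<kappa> \<and> (\<forall>s. (f has_real_derivative g s) (at s))"
      using bump_family_deriv by blast
    from someI_ex[OF this] show "(SOME g. g \<in> bump_family \<kappa> \<and> (\<forall>s. (f has_real_derivative g s) (at s))) \<in> bump_family \<kappa> \<and>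
        (\<forall>s. (f has_real_derivative (SOME g. g \<in> bump_family \<kappa> \<and> (\<forall>s. (f has_real_derivative g s) (at s))) s) (at s))" .
  qed
  define d where "d j = (D ^^ j) f" for j
  have fam: "d j \<in> bump_family \<kappa>" for j
    unfolding d_def by (induction j) (auto simp: f_def bump_family.prod D)
  have "(d j has_real_derivative d (Suc j) s) (at s)" for j s
    using D[OF fam] by (simp add: d_def)
  moreover have "d j s = 0" if "\<bar>s\<bar> \<ge> 1 / \<kappa>" for j s
    using that assms by (intro bump_family_support[OF fam]) (simp add: abs_mult field_simps)
  moreover have "0 \<le> d 0 s" "0 < d 0 0" for s
    by (simp_all add: d_def f_def exp_tail_def)
  ultimately show ?thesis unfolding smooth_bump_def by blast
qed

lemma smooth_bump_continuous:
  assumes "smooth_bump \<rho> d"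
  shows "continuous_on UNIV (d j)"
  using assms by (meson DERIV_isCont continuous_at_imp_continuous_on smooth_bump_def)

lemma smooth_bump_integrable:
  assumes "smooth_bump \<rho> d"
  shows "integrable lborel (\<lambda>s. complex_of_real (d j s) * iexp (\<sigma> * s))"
proof -
  have "integrable lborel (\<lambda>s. indicator {-\<bar>\<rho>\<bar>..\<bar>\<rho>\<bar>} s *\<^sub>R (complex_of_real (d j s) * iexp (\<sigma> * s)))"
    by (intro borel_integrable_compact continuous_intros continuous_on_subset[OF smooth_bump_continuous[OF assms]]) auto
  moreover have "indicator {-\<bar>\<rho>\<bar>..\<bar>\<rho>\<bar>} s *\<^sub>R (complex_of_real (d j s) * iexp (\<sigma> * s))
     = complex_of_real (d j s) * iexp (\<sigma> * s)" for s
    using assms by (auto simp: smooth_bump_def indicator_def)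
  ultimately show ?thesis by (simp only:)
qed

text \<open>Integration by parts has no boundary terms, so each derivative contributes a factor \<open>- i \<sigma>\<close>.\<close>

lemma smooth_bump_fourier_Suc:
  assumes "smooth_bump \<rho> d"
  shows "(LINT s|lborel. complex_of_real (d (Suc j) s) * iexp (\<sigma> * s))
    = - \<i> * complex_of_real \<sigma> * (LINT s|lborel. complex_of_real (d j s) * iexp (\<sigma> * s))"
proof -
  let ?e = "\<lambda>s. iexp (\<sigma> * s)"
  let ?F = "\<lambda>s. complex_of_real (d j s) * ?e s"
  let ?f = "\<lambda>s. complex_of_real (d (Suc j) s) * ?e s + \<i> * complex_of_real \<sigma> * ?F s"
  define r where "r = \<bar>\<rho>\<bar>"
  have z: "d i s = 0" if "\<bar>s\<bar> \<ge> r" for i s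
    using assms that by (auto simp: smooth_bump_def r_def)
  have der: "(?F has_vector_derivative ?f s) (at s)" for s
  proof -
    have 1: "((\<lambda>s. complex_of_real (d j s)) has_vector_derivative complex_of_real (d (Suc j) s)) (at s)"
      using assms by (intro has_vector_derivative_of_real) (auto simp: smooth_bump_def has_real_derivative_iff_has_vector_derivative)
    have 2: "(?e has_vector_derivative \<i> * complex_of_real \<sigma> * ?e s) (at s)"
    proof -
      have "((\<lambda>z. exp (\<i> * (complex_of_real \<sigma> * z))) has_field_derivative \<i> * complex_of_real \<sigma> * ?e s) (at (complex_of_real s))"
        by (auto intro!: derivative_eq_intros)
      from has_vector_derivative_real_field[OF this] show ?thesis by simp
    qed
    show ?thesis
      using has_vector_derivative_mult[OF 1 2] by (simp add: algebra_simps)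
  qed
  have cont: "continuous_on A ?f" for A
    by (intro continuous_intros continuous_on_subset[OF smooth_bump_continuous[OF assms]]) auto
  have "(LINT s|lborel. indicator {-r..r} s *\<^sub>R ?f s) = ?F r - ?F (-r)"
    by (rule integral_FTC_Icc[OF _ has_vector_derivative_at_within[OF der] cont]) (simp add: r_def)
  moreover have "indicator {-r..r} s *\<^sub>R ?f s = ?f s" for s
    using z by (auto simp: indicator_def)
  ultimately have "(LINT s|lborel. ?f s) = 0" using z by simp
  moreover have "(LINT s|lborel. ?f s) = (LINT s|lborel. complex_of_real (d (Suc j) s) * ?e s)
      + \<i> * complex_of_real \<sigma> * (LINT s|lborel. ?F s)"
    using smooth_bump_integrable[OF assms] by simp
  ultimately show ?thesis by (simp add: eq_neg_iff_add_eq_0)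
qed

lemma smooth_bump_fourier:
  assumes "smooth_bump \<rho> d"
  shows "(LINT s|lborel. complex_of_real (d j s) * iexp (\<sigma> * s))
    = (- \<i> * complex_of_real \<sigma>) ^ j * (LINT s|lborel. complex_of_real (d 0 s) * iexp (\<sigma> * s))"
  by (induction j) (simp, simp only: smooth_bump_fourier_Suc[OF assms] power_Suc mult.assoc)

text \<open>On the support of a narrow bump the phase is so small that \<open>cos\<close> stays positive.\<close>

lemma smooth_bump_fourier_nonzero:
  assumes d: "smooth_bump (1 / \<kappa>) d" "\<And>s. 0 \<le> d 0 s" "d 0 0 > 0" and \<kappa>: "\<kappa> > 0" "\<bar>\<sigma>\<bar> \<le> \<kappa>"
  shows "(LINT s|lborel. complex_of_real (d 0 s) * iexp (\<sigma> * s)) \<noteq> 0"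
proof -
  note cont = smooth_bump_continuous[OF d(1)]
  have int: "integrable lborel (\<lambda>s. complex_of_real (d 0 s) * iexp (\<sigma> * s))"
    by (rule smooth_bump_integrable[OF d(1)])
  have Re: "Re (complex_of_real (d 0 s) * iexp (\<sigma> * s)) = d 0 s * cos (\<sigma> * s)" for s
    by (simp add: Re_exp)
  have cos: "cos (\<sigma> * s) > 0" if "\<bar>s\<bar> < 1 / \<kappa>" for s
  proof (rule cos_gt_zero_pi)
    have "\<bar>\<sigma> * s\<bar> \<le> \<kappa> * (1 / \<kappa>)" unfolding abs_mult using \<kappa> that by (intro mult_mono) auto
    then have "\<bar>\<sigma> * s\<bar> \<le> 1" using \<kappa> by simp
    then show "- (pi / 2) < \<sigma> * s" "\<sigma> * s < pi / 2" using pi_gt3 by auto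
  qed
  have nn: "0 \<le> d 0 s * cos (\<sigma> * s)" for s
    using cos[of s] d(2)[of s] d(1) by (cases "\<bar>s\<bar> < 1 / \<kappa>") (auto simp: smooth_bump_def)
  have int': "integrable lborel (\<lambda>s. d 0 s * cos (\<sigma> * s))"
    using integrable_Re[OF int] unfolding Re .
  have "(LINT s|lborel. d 0 s * cos (\<sigma> * s)) \<noteq> 0"
  proof
    assume "(LINT s|lborel. d 0 s * cos (\<sigma> * s)) = 0"
    then have ae: "AE s in lborel. d 0 s * cos (\<sigma> * s) = 0"
      using integral_nonneg_eq_0_iff_AE[OF int'] nn by simp
    have "open {s. d 0 s * cos (\<sigma> * s) \<noteq> 0}"
      by (intro open_Collect_neq continuous_intros cont)
    moreover have "0 \<in> {s. d 0 s * cos (\<sigma> * s) \<noteq> 0}" using d(3) by simp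
    ultimately obtain e where e: "e > 0" "ball 0 e \<subseteq> {s. d 0 s * cos (\<sigma> * s) \<noteq> 0}"
      by (meson open_contains_ball)
    from ae have "AE s in lborel. s \<notin> {-e<..<e}"
      by eventually_elim (use e in \<open>auto simp: subset_eq dist_real_def\<close>)
    then have "emeasure lborel {-e<..<e} = 0"
      by (subst (asm) AE_iff_measurable[of "{-e<..<e}"]) auto
    then show False using e(1) by simp
  qed
  then have "Re (LINT s|lborel. complex_of_real (d 0 s) * iexp (\<sigma> * s)) \<noteq> 0"
    using integral_Re[OF int] unfolding Re by simp
  then show ?thesis by auto
qed

section \<open>Test functions in product form\<close>

text \<open>The multi-index \<open>m\<close> counts derivatives: a partial derivative of a tensor is again a tensor.\<close>

definition tensor :: "(nat \<Rightarrow> real \<Rightarrow> real) \<Rightarrow> ('a \<Rightarrow> nat) \<Rightarrow> 'a::euclidean_space \<Rightarrow> real" where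
  "tensor d m x = (\<Prod>b\<in>Basis. d (m b) (x \<bullet> b))"

lemma tensor_has_derivative:
  fixes c :: "'a::euclidean_space"
  assumes d: "smooth_bump \<rho> d"
  shows "((\<lambda>x. tensor d m (x - c)) has_derivative
    (\<lambda>h. \<Sum>b\<in>Basis. (h \<bullet> b) * tensor d (m(b := Suc (m b))) (x - c))) (at x)"
proof -
  have 1: "((\<lambda>x. d (m b) ((x - c) \<bullet> b)) has_derivative (\<lambda>h. (h \<bullet> b) * d (Suc (m b)) ((x - c) \<bullet> b))) (at x)" for b
  proof -
    have "(d (m b) has_derivative (\<lambda>s. s * d (Suc (m b)) ((x - c) \<bullet> b))) (at ((x - c) \<bullet> b))"
    proof -
      have "(d (m b) has_real_derivative d (Suc (m b)) ((x - c) \<bullet> b)) (at ((x - c) \<bullet> b))"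
        using d by (simp add: smooth_bump_def)
      then show ?thesis unfolding has_field_derivative_def by (metis mult_commute_abs)
    qed
    moreover have "((\<lambda>x. (x - c) \<bullet> b) has_derivative (\<lambda>h. h \<bullet> b)) (at x)"
      by (auto intro!: derivative_eq_intros)
    ultimately show ?thesis by (rule has_derivative_compose[rotated])
  qed
  have "((\<lambda>x. tensor d m (x - c)) has_derivative
      (\<lambda>h. \<Sum>b\<in>Basis. (h \<bullet> b) * d (Suc (m b)) ((x - c) \<bullet> b) * (\<Prod>b'\<in>Basis - {b}. d (m b') ((x - c) \<bullet> b')))) (at x)"
    unfolding tensor_def by (rule has_derivative_prod) (rule 1)
  moreover have "(h \<bullet> b) * d (Suc (m b)) ((x - c) \<bullet> b) * (\<Prod>b'\<in>Basis - {b}. d (m b') ((x - c) \<bullet> b'))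
      = (h \<bullet> b) * tensor d (m(b := Suc (m b))) (x - c)" if "b \<in> Basis" for h b
    unfolding tensor_def using that by (subst prod.remove[of _ b]) auto
  ultimately show ?thesis by (simp cong: sum.cong)
qed

lemma tensor_differentiable:
  assumes "smooth_bump \<rho> d"
  shows "(\<lambda>x. tensor d m (x - c)) differentiable (at x)"
  using tensor_has_derivative[OF assms] unfolding differentiable_def by blast

lemma partial_deriv_tensor:
  fixes c :: "'a::euclidean_space"
  assumes d: "smooth_bump \<rho> d" and b: "b \<in> Basis"
  shows "partial_deriv b (\<lambda>x. tensor d m (x - c)) = (\<lambda>x. tensor d (m(b := Suc (m b))) (x - c))"
proof
  fix x
  have "partial_deriv b (\<lambda>x. tensor d m (x - c)) x = (\<Sum>b'\<in>Basis. (b \<bullet> b') * tensor d (m(b' := Suc (m b'))) (x - c))"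
    unfolding partial_deriv_def frechet_derivative_at[OF tensor_has_derivative[OF d], symmetric] ..
  also have "\<dots> = (\<Sum>b'\<in>Basis. if b' = b then tensor d (m(b' := Suc (m b'))) (x - c) else 0)"
    by (intro sum.cong) (use b in \<open>auto simp: inner_Basis\<close>)
  finally show "partial_deriv b (\<lambda>x. tensor d m (x - c)) x = tensor d (m(b := Suc (m b))) (x - c)"
    using b by simp
qed

lemma tensor_continuous:
  fixes c :: "'a::euclidean_space"
  assumes d: "smooth_bump \<rho> d"
  shows "continuous_on A (\<lambda>x. tensor d m (x - c))"
  by (intro continuous_at_imp_continuous_on ballI differentiable_imp_continuous_within tensor_differentiable[OF d])

lemma tensor_support:
  fixes x :: "'a::euclidean_space"
  assumes d: "smooth_bump \<rho> d" and x: "x \<notin> cball 0 (real DIM('a) * \<rho>)"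
  shows "tensor d m x = 0"
proof -
  have "\<exists>b\<in>Basis. \<bar>x \<bullet> b\<bar> \<ge> \<rho>"
  proof (rule ccontr)
    assume "\<not> ?thesis"
    then have "(\<Sum>b\<in>Basis. \<bar>x \<bullet> b\<bar>) \<le> (\<Sum>b\<in>(Basis :: 'a set). \<rho>)" by (intro sum_mono) auto
    then show False using x norm_le_l1[of x] by simp
  qed
  then show ?thesis
    using d unfolding tensor_def smooth_bump_def by (intro prod_zero) fastforce+
qed

lemma tensor_test_function:
  fixes c :: "'a::euclidean_space"
  assumes d: "smooth_bump \<rho> d"
  shows "(\<lambda>x. tensor d m (x - c)) \<in> test_functions"
proof -
  have "(\<lambda>x. tensor d m (x - c)) \<in> Ck_fun k" for k m
  proof (induction k arbitrary: m)
    case 0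
    then show ?case using tensor_continuous[OF d] by simp
  next
    case (Suc k)
    then show ?case
      by (simp add: partial_deriv_tensor[OF d] differentiable_on_def)
         (blast intro: differentiable_at_withinI tensor_differentiable[OF d])
  qed
  moreover have "{x. tensor d m (x - c) \<noteq> 0} \<subseteq> cball c (real DIM('a) * \<rho>)"
    using tensor_support[OF d] by (force simp: dist_norm norm_minus_commute)
  then have "bounded {x. tensor d m (x - c) \<noteq> 0}"
    using bounded_cball bounded_subset by blast
  ultimately show ?thesis by (simp add: test_functions_def)
qed

lemma partial_deriv_sum:
  assumes "\<And>i x. i \<in> I \<Longrightarrow> f i differentiable (at x)"
  shows "partial_deriv b (\<lambda>x. \<Sum>i\<in>I. f i x) = (\<lambda>x. \<Sum>i\<in>I. partial_deriv b (f i) x)"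
proof
  fix x
  have "((\<lambda>x. \<Sum>i\<in>I. f i x) has_derivative (\<lambda>h. \<Sum>i\<in>I. frechet_derivative (f i) (at x) h)) (at x)"
    using assms by (intro has_derivative_sum) (simp flip: frechet_derivative_works)
  from frechet_derivative_at[OF this]
  show "partial_deriv b (\<lambda>x. \<Sum>i\<in>I. f i x) x = (\<Sum>i\<in>I. partial_deriv b (f i) x)"
    unfolding partial_deriv_def by metis
qed

lemma laplacian_tensor_sum:
  fixes c :: "'a::euclidean_space"
  assumes d: "smooth_bump \<rho> d"
  shows "laplacian (\<lambda>x. \<Sum>i\<in>I. tensor d (m i) (x - c))
    = (\<lambda>x. \<Sum>b\<in>Basis. \<Sum>i\<in>I. tensor d ((m i)(b := Suc (Suc (m i b)))) (x - c))"
proof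
  fix x
  have "partial_deriv b (partial_deriv b (\<lambda>x. \<Sum>i\<in>I. tensor d (m i) (x - c)))
     = (\<lambda>x. \<Sum>i\<in>I. tensor d ((m i)(b := Suc (Suc (m i b)))) (x - c))" if "b \<in> Basis" for b
    by (simp add: partial_deriv_sum[OF tensor_differentiable[OF d]] partial_deriv_tensor[OF d that])
  then show "laplacian (\<lambda>x. \<Sum>i\<in>I. tensor d (m i) (x - c)) x
    = (\<Sum>b\<in>Basis. \<Sum>i\<in>I. tensor d ((m i)(b := Suc (Suc (m i b)))) (x - c))"
    unfolding laplacian_def by (simp cong: sum.cong)
qed

text \<open>The Laplacian and the bilaplacian of \<open>tensor d (\<lambda>_. 0)\<close>. In the second the index at \<open>c\<close> is updated
  after the one at \<open>b\<close>, so that it becomes \<open>4\<close> when the two directions coincide.\<close>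

definition tensor_lap :: "(nat \<Rightarrow> real \<Rightarrow> real) \<Rightarrow> 'a::euclidean_space \<Rightarrow> real" where
  "tensor_lap d z = (\<Sum>b\<in>Basis. tensor d ((\<lambda>_. 0)(b := 2)) z)"

definition tensor_bilap :: "(nat \<Rightarrow> real \<Rightarrow> real) \<Rightarrow> 'a::euclidean_space \<Rightarrow> real" where
  "tensor_bilap d z = (\<Sum>c\<in>Basis. \<Sum>b\<in>Basis. tensor d (((\<lambda>_. 0)(b := 2))(c := ((\<lambda>_. 0)(b := 2)) c + 2)) z)"

lemma laplacian_tensor:
  assumes d: "smooth_bump \<rho> d"
  shows "laplacian (\<lambda>x. tensor d (\<lambda>_. 0) (x - c)) = (\<lambda>x. tensor_lap d (x - c))"
    and "laplacian (\<lambda>x. tensor_lap d (x - c)) = (\<lambda>x. tensor_bilap d (x - c))"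
  using laplacian_tensor_sum[OF d, where m = "\<lambda>_ _. 0" and I = "{()}" and c = c]
    laplacian_tensor_sum[OF d, where m = "\<lambda>b. (\<lambda>_. 0)(b := 2)" and I = Basis and c = c]
  by (simp_all add: tensor_lap_def[abs_def] tensor_bilap_def[abs_def] numeral_2_eq_2)

text \<open>The sign of the exponent is opposite to that of \<open>fourier_integral\<close>, because the kernel \<open>\<psi>\<close> enters a
  correlation through \<open>\<psi> (y - x)\<close> rather than a convolution through \<open>\<psi> (x - y)\<close>.\<close>

definition transform :: "('a::euclidean_space \<Rightarrow> real) \<Rightarrow> 'a \<Rightarrow> complex" where
  "transform \<psi> \<xi> = (LINT z|lborel. complex_of_real (\<psi> z) * iexp (\<xi> \<bullet> z))"

definition symbol :: "('a \<Rightarrow> nat) \<Rightarrow> 'a::euclidean_space \<Rightarrow> complex" where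
  "symbol m \<xi> = (\<Prod>b\<in>Basis. (- \<i> * complex_of_real (\<xi> \<bullet> b)) ^ m b)"

lemma transform_tensor:
  fixes \<xi> :: "'a::euclidean_space"
  assumes d: "smooth_bump \<rho> d"
  shows "integrable lborel (\<lambda>z. complex_of_real (tensor d m z) * iexp (\<xi> \<bullet> z))"
    and "transform (tensor d m) \<xi> = symbol m \<xi> * transform (tensor d (\<lambda>_. 0)) \<xi>"
proof -
  let ?f = "\<lambda>m b s. complex_of_real (d (m b) s) * iexp ((\<xi> \<bullet> b) * s)"
  have eq: "complex_of_real (tensor d m z) * iexp (\<xi> \<bullet> z) = (\<Prod>b\<in>Basis. ?f m b (z \<bullet> b))" for m z
    unfolding tensor_def iexp_inner_Basis of_real_prod prod.distrib ..
  note int = smooth_bump_integrable[OF d]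
  show "integrable lborel (\<lambda>z. complex_of_real (tensor d m z) * iexp (\<xi> \<bullet> z))"
    unfolding eq by (rule integrable_prod_Basis[OF int])
  have val: "transform (tensor d m) \<xi> = (\<Prod>b\<in>Basis. LINT s|lborel. ?f m b s)" for m
    unfolding transform_def eq by (rule integral_prod_Basis[OF int])
  show "transform (tensor d m) \<xi> = symbol m \<xi> * transform (tensor d (\<lambda>_. 0)) \<xi>"
    unfolding val symbol_def prod.distrib[symmetric] by (intro prod.cong refl smooth_bump_fourier[OF d])
qed

lemma transform_tensor_nonzero:
  fixes \<xi> :: "'a::euclidean_space"
  assumes d: "smooth_bump (1 / \<kappa>) d" "\<And>s. 0 \<le> d 0 s" "d 0 0 > 0" and \<kappa>: "\<kappa> > 0" "norm \<xi> \<le> \<kappa>"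
  shows "transform (tensor d (\<lambda>_. 0)) \<xi> \<noteq> 0"
proof -
  have "complex_of_real (tensor d (\<lambda>_. 0) z) * iexp (\<xi> \<bullet> z)
     = (\<Prod>b\<in>Basis. complex_of_real (d 0 (z \<bullet> b)) * iexp ((\<xi> \<bullet> b) * (z \<bullet> b)))" for z
    unfolding tensor_def iexp_inner_Basis of_real_prod prod.distrib ..
  then have "transform (tensor d (\<lambda>_. 0)) \<xi>
     = (\<Prod>b\<in>Basis. LINT s|lborel. complex_of_real (d 0 s) * iexp ((\<xi> \<bullet> b) * s))"
    unfolding transform_def using integral_prod_Basis[OF smooth_bump_integrable[OF d(1)]] by simp
  moreover have "\<bar>\<xi> \<bullet> b\<bar> \<le> \<kappa>" if "b \<in> Basis" for b
    using Basis_le_norm[OF that, of \<xi>] \<kappa> by linarith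
  ultimately show ?thesis
    using smooth_bump_fourier_nonzero[OF d \<kappa>(1)] by simp
qed

lemma symbol_Suc_Suc:
  assumes "b \<in> Basis"
  shows "symbol (m(b := m b + 2)) \<xi> = - complex_of_real ((\<xi> \<bullet> b)\<^sup>2) * symbol m \<xi>"
proof -
  have "symbol (m(b := m b + 2)) \<xi> = (- \<i> * complex_of_real (\<xi> \<bullet> b)) ^ (m b + 2) * (\<Prod>b'\<in>Basis - {b}. (- \<i> * complex_of_real (\<xi> \<bullet> b')) ^ m b')"
    unfolding symbol_def using assms by (subst prod.remove[of _ b]) auto
  also have "\<dots> = (- \<i> * complex_of_real (\<xi> \<bullet> b))\<^sup>2 * symbol m \<xi>"
    unfolding symbol_def using assms
    by (subst prod.remove[of Basis b]) (auto simp: power_add power2_eq_square)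
  finally show ?thesis by (simp add: power_mult_distrib)
qed

lemma norm_sq_sum_Basis: "(norm \<xi>)\<^sup>2 = (\<Sum>b\<in>Basis. (\<xi> \<bullet> b)\<^sup>2)" for \<xi> :: "'a::euclidean_space"
  unfolding power2_norm_eq_inner by (subst euclidean_inner) (simp add: power2_eq_square)

lemma transform_sum:
  assumes "\<And>i. i \<in> I \<Longrightarrow> integrable lborel (\<lambda>z. complex_of_real (\<psi> i z) * iexp (\<xi> \<bullet> z))"
  shows "transform (\<lambda>z. \<Sum>i\<in>I. \<psi> i z) \<xi> = (\<Sum>i\<in>I. transform (\<psi> i) \<xi>)"
  unfolding transform_def using assms by (simp add: sum_distrib_right)

lemma transform_tensor_lap:
  fixes \<xi> :: "'a::euclidean_space"
  assumes d: "smooth_bump \<rho> d"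
  shows "transform (tensor_lap d) \<xi> = - complex_of_real ((norm \<xi>)\<^sup>2) * transform (tensor d (\<lambda>_. 0)) \<xi>"
    and "transform (tensor_bilap d) \<xi> = complex_of_real ((norm \<xi>) ^ 4) * transform (tensor d (\<lambda>_. 0)) \<xi>"
    and "integrable lborel (\<lambda>z. complex_of_real (tensor_lap d z) * iexp (\<xi> \<bullet> z))"
    and "integrable lborel (\<lambda>z. complex_of_real (tensor_bilap d z) * iexp (\<xi> \<bullet> z))"
proof -
  note int = transform_tensor(1)[OF d] and val = transform_tensor(2)[OF d]
  let ?\<Phi> = "transform (tensor d (\<lambda>_. 0)) \<xi>"
  have s0: "symbol (\<lambda>_. 0) \<xi> = 1" by (simp add: symbol_def)
  have s2: "symbol ((\<lambda>_. 0)(b := 2)) \<xi> = - complex_of_real ((\<xi> \<bullet> b)\<^sup>2)" if "b \<in> Basis" for b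
    using symbol_Suc_Suc[OF that, of "\<lambda>_. 0" \<xi>, unfolded s0] unfolding add_0 by simp
  show ilap: "integrable lborel (\<lambda>z. complex_of_real (tensor_lap d z) * iexp (\<xi> \<bullet> z))"
    unfolding tensor_lap_def of_real_sum sum_distrib_right by (intro Bochner_Integration.integrable_sum int)
  show "integrable lborel (\<lambda>z. complex_of_real (tensor_bilap d z) * iexp (\<xi> \<bullet> z))"
    unfolding tensor_bilap_def of_real_sum sum_distrib_right by (intro Bochner_Integration.integrable_sum int)
  have "transform (tensor_lap d) \<xi> = (\<Sum>b\<in>Basis. symbol ((\<lambda>_. 0)(b := 2)) \<xi> * ?\<Phi>)"
    unfolding tensor_lap_def[abs_def] by (subst transform_sum[OF int]) (simp only: val[of "(\<lambda>_. 0)(_ := 2)"])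
  also have "\<dots> = - complex_of_real ((norm \<xi>)\<^sup>2) * ?\<Phi>"
    unfolding norm_sq_sum_Basis by (simp add: s2 sum_distrib_right sum_negf)
  finally show "transform (tensor_lap d) \<xi> = - complex_of_real ((norm \<xi>)\<^sup>2) * ?\<Phi>" .
  have "transform (tensor_bilap d) \<xi> = (\<Sum>c\<in>Basis. \<Sum>b\<in>Basis. symbol (((\<lambda>_. 0)(b := 2))(c := ((\<lambda>_. 0)(b := 2)) c + 2)) \<xi> * ?\<Phi>)"
    unfolding tensor_bilap_def[abs_def]
    apply (subst transform_sum)
    subgoal unfolding of_real_sum sum_distrib_right by (intro Bochner_Integration.integrable_sum int)
    apply (subst transform_sum[OF int])
    apply (subst val)
    apply (rule refl)
    done
  also have "\<dots> = (\<Sum>c\<in>Basis. \<Sum>b\<in>Basis. complex_of_real ((\<xi> \<bullet> c)\<^sup>2) * complex_of_real ((\<xi> \<bullet> b)\<^sup>2)) * ?\<Phi>"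
    unfolding sum_distrib_right
    by (intro sum.cong refl) (simp only: symbol_Suc_Suc s2, simp)
  also have "(\<Sum>c\<in>Basis. \<Sum>b\<in>Basis. complex_of_real ((\<xi> \<bullet> c)\<^sup>2) * complex_of_real ((\<xi> \<bullet> b)\<^sup>2)) = complex_of_real ((norm \<xi>) ^ 4)"
  proof -
    have "(norm \<xi>) ^ 4 = (norm \<xi>)\<^sup>2 * (norm \<xi>)\<^sup>2" by simp
    also have "\<dots> = (\<Sum>c\<in>Basis. \<Sum>b\<in>Basis. (\<xi> \<bullet> c)\<^sup>2 * (\<xi> \<bullet> b)\<^sup>2)"
      unfolding norm_sq_sum_Basis by (rule sum_product)
    finally show ?thesis by simp
  qed
  finally show "transform (tensor_bilap d) \<xi> = complex_of_real ((norm \<xi>) ^ 4) * ?\<Phi>" .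
qed

section \<open>The equation on the Fourier side\<close>

text \<open>The cross-correlation: for real \<open>\<psi>\<close>, the pairing of \<open>g\<close> with the translate of \<open>\<psi>\<close> by \<open>x\<close>.\<close>

definition corr :: "('a::euclidean_space \<Rightarrow> complex) \<Rightarrow> ('a \<Rightarrow> real) \<Rightarrow> 'a \<Rightarrow> complex" where
  "corr g \<psi> x = (LINT y|lborel. \<psi> (y - x) *\<^sub>R g y)"

text \<open>The radius is a parameter because one ball has to contain the supports of several kernels.\<close>

definition cpt_kernel :: "real \<Rightarrow> ('a::euclidean_space \<Rightarrow> real) \<Rightarrow> bool" where
  "cpt_kernel r \<psi> \<longleftrightarrow> continuous_on UNIV \<psi> \<and> (\<forall>z. z \<notin> cball 0 r \<longrightarrow> \<psi> z = 0)"

lemma cpt_kernel_measurable: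
  assumes "cpt_kernel r \<psi>"
  shows "\<psi> \<in> borel_measurable borel"
  using assms by (simp add: cpt_kernel_def borel_measurable_continuous_onI)

lemma cpt_kernel_integrable:
  assumes "cpt_kernel r \<psi>"
  shows "integrable lborel \<psi>"
proof -
  have "integrable lborel (\<lambda>x. indicator (cball 0 r) x *\<^sub>R \<psi> x)"
    using assms by (intro borel_integrable_compact) (auto simp: cpt_kernel_def intro: continuous_on_subset)
  moreover have "indicator (cball 0 r) x *\<^sub>R \<psi> x = \<psi> x" for x
    using assms by (auto simp: cpt_kernel_def indicator_def)
  ultimately show ?thesis by (simp only:)
qed

lemma cpt_kernel_bound:
  assumes "cpt_kernel r \<psi>"
  shows "\<exists>B\<ge>0. \<forall>z. \<bar>\<psi> z\<bar> \<le> B * indicator (cball 0 r) z"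
proof -
  have "compact (\<psi> ` cball 0 r)"
    using assms by (intro compact_continuous_image) (auto simp: cpt_kernel_def intro: continuous_on_subset)
  then obtain B where "\<forall>z\<in>\<psi> ` cball 0 r. norm z \<le> B"
    using compact_imp_bounded bounded_iff by blast
  then have B: "\<And>z. z \<in> cball 0 r \<Longrightarrow> \<bar>\<psi> z\<bar> \<le> B" by simp
  show ?thesis
    by (rule exI[of _ "max 0 B"]) (use assms B in \<open>auto simp: cpt_kernel_def indicator_def intro: max.coboundedI2\<close>)
qed

lemma
  fixes g :: "'a::euclidean_space \<Rightarrow> complex"
  assumes g: "integrable lborel g" and \<psi>: "cpt_kernel r \<psi>"
  shows corr_integrable: "integrable lborel (corr g \<psi>)"
    and fourier_integral_corr: "fourier_integral (corr g \<psi>) \<xi> = fourier_integral g \<xi> * transform \<psi> \<xi>"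
proof -
  have [measurable]: "g \<in> borel_measurable borel" "\<psi> \<in> borel_measurable borel"
    using g cpt_kernel_measurable[OF \<psi>] by auto
  have \<psi>int: "integrable lborel \<psi>" by (rule cpt_kernel_integrable[OF \<psi>])
  define e where "e = (\<lambda>\<xi> x::'a. exp (- (\<i> * complex_of_real (\<xi> \<bullet> x))))"
  have ne: "norm (e \<xi> x) = 1" for \<xi> x by (simp add: e_def)
  have [measurable]: "e \<xi> \<in> borel_measurable borel" for \<xi> unfolding e_def by measurable
  have int: "integrable (lborel \<Otimes>\<^sub>M lborel) (\<lambda>(y, x). \<psi> (y - x) *\<^sub>R g y * e \<xi> x)" for \<xi>
  proof (rule lborel_pair.Fubini_integrable)
    show "integrable lborel (\<lambda>y. LINT x|lborel. norm (case (y, x) of (y, x) \<Rightarrow> \<psi> (y - x) *\<^sub>R g y * e \<xi> x))"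
    proof -
      have "(LINT x|lborel. norm (\<psi> (y - x) *\<^sub>R g y * e \<xi> x)) = (LINT x|lborel. \<bar>\<psi> x\<bar>) * norm (g y)" for y
        using lborel_integral_reflect(2)[of "\<lambda>x. \<bar>\<psi> x\<bar>" y] \<psi>int by (simp add: norm_mult ne)
      then show ?thesis using g by simp
    qed
    show "AE y in lborel. integrable lborel (\<lambda>x. case (y, x) of (y, x) \<Rightarrow> \<psi> (y - x) *\<^sub>R g y * e \<xi> x)"
    proof (rule AE_I2)
      fix y :: 'a
      have "integrable lborel (\<lambda>x. norm (g y) * \<bar>\<psi> (y - x)\<bar>)"
        using lborel_integral_reflect(1)[of "\<lambda>x. \<bar>\<psi> x\<bar>" y] \<psi>int by simp
      then show "integrable lborel (\<lambda>x. case (y, x) of (y, x) \<Rightarrow> \<psi> (y - x) *\<^sub>R g y * e \<xi> x)"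
        by (rule Bochner_Integration.integrable_bound) (auto simp: norm_mult ne)
    qed
  qed simp
  have corr_e: "(LINT y|lborel. \<psi> (y - x) *\<^sub>R g y * e \<xi> x) = corr g \<psi> x * e \<xi> x" for x \<xi>
    unfolding corr_def by (rule integral_mult_left_zero)
  have "integrable lborel (\<lambda>x. LINT y|lborel. \<psi> (y - x) *\<^sub>R g y * e 0 x)"
    by (rule lborel_pair.integrable_snd[OF int])
  then show "integrable lborel (corr g \<psi>)"
    unfolding corr_e by (simp add: e_def)
  have "fourier_integral (corr g \<psi>) \<xi> = (LINT x|lborel. LINT y|lborel. \<psi> (y - x) *\<^sub>R g y * e \<xi> x)"
    unfolding corr_e by (simp add: fourier_integral_def e_def)
  also have "\<dots> = (LINT y|lborel. LINT x|lborel. \<psi> (y - x) *\<^sub>R g y * e \<xi> x)"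
    by (rule lborel_pair.Fubini_integral[OF int])
  also have "\<dots> = (LINT y|lborel. g y * e \<xi> y * transform \<psi> \<xi>)"
  proof (intro Bochner_Integration.integral_cong refl)
    fix y :: 'a
    let ?f = "\<lambda>z. complex_of_real (\<psi> z) * iexp (\<xi> \<bullet> z)"
    have f: "integrable lborel ?f"
      by (rule Bochner_Integration.integrable_bound[OF \<psi>int]) (auto simp: norm_mult)
    have "\<psi> (y - x) *\<^sub>R g y * e \<xi> x = g y * e \<xi> y * ?f (y - x)" for x
    proof -
      have "e \<xi> x = e \<xi> y * iexp (\<xi> \<bullet> (y - x))"
        unfolding e_def by (simp add: inner_diff_right algebra_simps flip: exp_add)
      then show ?thesis by (simp add: scaleR_conv_of_real)
    qed
    then show "(LINT x|lborel. \<psi> (y - x) *\<^sub>R g y * e \<xi> x) = g y * e \<xi> y * transform \<psi> \<xi>"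
      using lborel_integral_reflect(2)[OF f, of y] by (simp add: transform_def)
  qed
  also have "\<dots> = fourier_integral g \<xi> * transform \<psi> \<xi>"
    by (simp add: fourier_integral_def e_def)
  finally show "fourier_integral (corr g \<psi>) \<xi> = fourier_integral g \<xi> * transform \<psi> \<xi>" .
qed

lemma transform_bounded:
  assumes "cpt_kernel r \<psi>"
  shows "norm (transform \<psi> \<xi>) \<le> (LINT z|lborel. \<bar>\<psi> z\<bar>)"
  unfolding transform_def by (rule order_trans[OF integral_norm_bound]) (simp add: norm_mult)

lemma transform_measurable:
  assumes "cpt_kernel r \<psi>"
  shows "transform \<psi> \<in> borel_measurable borel"
proof -
  note [measurable] = cpt_kernel_measurable[OF assms]
  have "(\<lambda>\<xi>. LINT z|lborel. complex_of_real (\<psi> z) * iexp (\<xi> \<bullet> z)) \<in> borel_measurable lborel"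
    by measurable
  then show ?thesis by (simp add: transform_def[abs_def])
qed

text \<open>Young's inequality for the indicator of a ball, by Cauchy--Schwarz in the inner integral.\<close>

lemma nn_integral_ball_average_sq_le:
  fixes q :: "'a::euclidean_space \<Rightarrow> real" and r :: real
  assumes [measurable]: "q \<in> borel_measurable borel" and q: "\<And>y. 0 \<le> q y"
  defines "J \<equiv> measure lborel (cball (0::'a) r)"
  shows "(\<integral>\<^sup>+x. (\<integral>\<^sup>+y. ennreal (q y * indicator (cball 0 r) (y - x)) \<partial>lborel)\<^sup>2 \<partial>lborel)
    \<le> ennreal (J\<^sup>2) * (\<integral>\<^sup>+y. ennreal ((q y)\<^sup>2) \<partial>lborel)"
proof -
  let ?I = "\<lambda>z::'a. indicator (cball 0 r) z :: real"
  have I: "integrable lborel ?I" "(LINT z|lborel. ?I z) = J"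
    using emeasure_bounded_finite[of "cball (0::'a) r"] by (auto simp: J_def intro!: integrable_real_indicator)
  have "(\<integral>\<^sup>+y. ennreal (q y * ?I (y - x)) \<partial>lborel)\<^sup>2 \<le> ennreal J * (\<integral>\<^sup>+y. ennreal ((q y)\<^sup>2 * ?I (y - x)) \<partial>lborel)" for x
  proof -
    have "(\<integral>\<^sup>+y. ennreal (q y * ?I (y - x)) \<partial>lborel)\<^sup>2 = (\<integral>\<^sup>+y. ennreal (?I (y - x)) * ennreal (q y * ?I (y - x)) \<partial>lborel)\<^sup>2"
      by (intro arg_cong[where f = "\<lambda>t. t\<^sup>2"] nn_integral_cong) (auto simp: indicator_def)
    also have "\<dots> \<le> (\<integral>\<^sup>+y. (ennreal (?I (y - x)))\<^sup>2 \<partial>lborel) * (\<integral>\<^sup>+y. (ennreal (q y * ?I (y - x)))\<^sup>2 \<partial>lborel)"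
      by (rule Cauchy_Schwarz_nn_integral) measurable
    also have "(\<integral>\<^sup>+y. (ennreal (?I (y - x)))\<^sup>2 \<partial>lborel) = (\<integral>\<^sup>+y. ennreal (?I (y - x)) \<partial>lborel)"
      by (intro nn_integral_cong) (auto simp: indicator_def)
    also have "\<dots> = ennreal J"
      using lborel_integral_translate[OF I(1), of x] I(2) by (simp add: nn_integral_eq_integral)
    also have "(\<integral>\<^sup>+y. (ennreal (q y * ?I (y - x)))\<^sup>2 \<partial>lborel) = (\<integral>\<^sup>+y. ennreal ((q y)\<^sup>2 * ?I (y - x)) \<partial>lborel)"
      by (intro nn_integral_cong) (auto simp: indicator_def q ennreal_power)
    finally show ?thesis .
  qed
  then have "(\<integral>\<^sup>+x. (\<integral>\<^sup>+y. ennreal (q y * ?I (y - x)) \<partial>lborel)\<^sup>2 \<partial>lborel)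
    \<le> (\<integral>\<^sup>+x. ennreal J * (\<integral>\<^sup>+y. ennreal ((q y)\<^sup>2 * ?I (y - x)) \<partial>lborel) \<partial>lborel)"
    by (intro nn_integral_mono)
  also have "\<dots> = ennreal J * (\<integral>\<^sup>+x. \<integral>\<^sup>+y. ennreal ((q y)\<^sup>2 * ?I (y - x)) \<partial>lborel \<partial>lborel)"
    by (intro nn_integral_cmult) measurable
  also have "\<dots> = ennreal J * (ennreal J * (\<integral>\<^sup>+y. ennreal ((q y)\<^sup>2) \<partial>lborel))"
    using nn_integral_shifted_kernel(2)[of "\<lambda>y. (q y)\<^sup>2" ?I] I by simp
  also have "\<dots> = ennreal (J\<^sup>2) * (\<integral>\<^sup>+y. ennreal ((q y)\<^sup>2) \<partial>lborel)"
    by (simp add: J_def power2_eq_square ennreal_mult mult.assoc)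
  finally show ?thesis .
qed

lemma L2_space_sum:
  fixes f :: "'i \<Rightarrow> 'a::euclidean_space \<Rightarrow> complex"
  assumes "finite I" "\<And>i. i \<in> I \<Longrightarrow> f i \<in> L2_space"
  shows "(\<lambda>x. \<Sum>i\<in>I. f i x) \<in> L2_space"
  using assms by (induction I) (auto simp: L2_space_add, simp add: L2_space_def)

definition L2_null_seq :: "(nat \<Rightarrow> 'a::euclidean_space \<Rightarrow> complex) \<Rightarrow> bool" where
  "L2_null_seq A \<longleftrightarrow> (\<forall>k. A k \<in> borel_measurable borel) \<and>
     ((\<lambda>k. sq_int (A k)) \<longlonglongrightarrow> 0)"

lemma L2_null_seq_add:
  assumes "L2_null_seq A" "L2_null_seq B"
  shows "L2_null_seq (\<lambda>k \<xi>. A k \<xi> + B k \<xi>)"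
proof -
  have m: "A k \<in> borel_measurable borel" "B k \<in> borel_measurable borel" for k
    using assms by (auto simp: L2_null_seq_def)
  have "(\<lambda>k. sq_int (\<lambda>\<xi>. A k \<xi> + B k \<xi>)) \<longlonglongrightarrow> 0"
    by (rule tendsto_0_sum_bound_ennreal[where
          f = "\<lambda>k. sq_int (A k)" and g = "\<lambda>k. sq_int (B k)"])
       (use assms nn_integral_sq_add_le[OF m(1) m(2)] in \<open>auto simp: L2_null_seq_def distrib_left\<close>)
  then show ?thesis using m by (simp add: L2_null_seq_def)
qed

lemma L2_null_seq_sum:
  assumes "finite I" "\<And>i. i \<in> I \<Longrightarrow> L2_null_seq (A i)"
  shows "L2_null_seq (\<lambda>k \<xi>. \<Sum>i\<in>I. A i k \<xi>)"
  using assms by (induction I) (auto simp: L2_null_seq_add, simp add: L2_null_seq_def)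

lemma L2_null_seq_mult:
  assumes "L2_null_seq A" and [measurable]: "\<Psi> \<in> borel_measurable borel" and B: "\<And>\<xi>. norm (\<Psi> \<xi>) \<le> B"
  shows "L2_null_seq (\<lambda>k \<xi>. A k \<xi> * \<Psi> \<xi>)"
proof -
  have m [measurable]: "A k \<in> borel_measurable borel" for k
    using assms by (auto simp: L2_null_seq_def)
  have B0: "0 \<le> B" using order_trans[OF norm_ge_zero B] .
  have "sq_int (\<lambda>\<xi>. A k \<xi> * \<Psi> \<xi>) \<le> ennreal (B\<^sup>2) * sq_int (A k)" for k
  proof -
    have "(norm (A k \<xi> * \<Psi> \<xi>))\<^sup>2 \<le> B\<^sup>2 * (norm (A k \<xi>))\<^sup>2" for \<xi>
      unfolding norm_mult power_mult_distrib
      by (subst mult.commute) (intro mult_right_mono power_mono B, auto)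
    then have "sq_int (\<lambda>\<xi>. A k \<xi> * \<Psi> \<xi>) \<le> (\<integral>\<^sup>+\<xi>. ennreal (B\<^sup>2) * ennreal ((norm (A k \<xi>))\<^sup>2) \<partial>lborel)"
      by (intro nn_integral_mono, subst ennreal_mult[symmetric]) (auto intro: ennreal_leI)
    then show ?thesis by (simp add: nn_integral_cmult)
  qed
  note le = this
  have "(\<lambda>k. sq_int (A k)) \<longlonglongrightarrow> 0"
    using assms(1) by (simp add: L2_null_seq_def)
  then have "(\<lambda>k. sq_int (\<lambda>\<xi>. A k \<xi> * \<Psi> \<xi>)) \<longlonglongrightarrow> 0"
    by (rule tendsto_0_mult_bound_ennreal[OF _ _ always_eventually[OF allI[OF le]]]) simp
  then show ?thesis by (simp add: L2_null_seq_def)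
qed

lemma L2_null_seq_const:
  assumes "L2_null_seq (\<lambda>_. H)"
  shows "AE \<xi> in lborel. H \<xi> = 0"
proof -
  have [measurable]: "H \<in> borel_measurable borel" using assms by (simp add: L2_null_seq_def)
  have "sq_int H = 0"
    using assms by (simp add: L2_null_seq_def tendsto_const_iff)
  then have "AE \<xi> in lborel. ennreal ((norm (H \<xi>))\<^sup>2) = 0"
    by (subst (asm) nn_integral_0_iff_AE) auto
  then show ?thesis by eventually_elim simp
qed

lemma corr_integrand_integrable:
  fixes g :: "'a::euclidean_space \<Rightarrow> complex"
  assumes g: "g \<in> L2_space" and \<psi>: "cpt_kernel r \<psi>"
  shows "integrable lborel (\<lambda>y. \<psi> (y - x) *\<^sub>R g y)"
proof -
  obtain B where B: "B \<ge> 0" "\<And>z. \<bar>\<psi> z\<bar> \<le> B * indicator (cball 0 r) z"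
    using cpt_kernel_bound[OF \<psi>] by blast
  show ?thesis
  proof (rule Bochner_Integration.integrable_bound)
    show "integrable lborel (\<lambda>y. B *\<^sub>R cut (norm x + r) g y)"
      using cut_integrable[OF g] by simp
    note [measurable] = cpt_kernel_measurable[OF \<psi>] L2_spaceD(1)[OF g]
    show "(\<lambda>y. \<psi> (y - x) *\<^sub>R g y) \<in> borel_measurable lborel" by simp
    show "AE y in lborel. norm (\<psi> (y - x) *\<^sub>R g y) \<le> norm (B *\<^sub>R cut (norm x + r) g y)"
    proof (rule AE_I2)
      fix y :: 'a
      have "y \<in> cball 0 (norm x + r)" if "y - x \<in> cball 0 r"
        using that norm_triangle_ineq[of "y - x" x] by simp
      then show "norm (\<psi> (y - x) *\<^sub>R g y) \<le> norm (B *\<^sub>R cut (norm x + r) g y)"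
        using B(2)[of "y - x"] B(1)
        by (cases "y - x \<in> cball 0 r") (simp_all add: cut_def mult_right_mono)
    qed
  qed
qed

text \<open>Once the \<open>f\<^sub>i\<close> are truncated to the ball of radius \<open>R\<close>, the correlations cancel except where the
  shifted kernels meet the boundary of that ball, and there the \<open>f\<^sub>i\<close> have little \<open>L\<^sup>2\<close> mass.\<close>

lemma truncated_corr_null:
  fixes f :: "'i \<Rightarrow> 'a::euclidean_space \<Rightarrow> complex" and \<psi> :: "'i \<Rightarrow> 'a \<Rightarrow> real"
  assumes I: "finite I" and f: "\<And>i. i \<in> I \<Longrightarrow> f i \<in> L2_space"
    and \<psi>: "\<And>i. i \<in> I \<Longrightarrow> cpt_kernel r (\<psi> i)"
    and weak: "\<And>x. (LINT y|lborel. (\<Sum>i\<in>I. \<psi> i (y - x) *\<^sub>R f i y)) = 0"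
  defines "h \<equiv> \<lambda>k x. \<Sum>i\<in>I. corr (cut (real k) (f i)) (\<psi> i) x"
  shows "L2_null_seq h"
proof -
  have cint: "integrable lborel (cut (real k) (f i))" if "i \<in> I" for i k
    by (rule cut_integrable[OF f[OF that]])
  have "h k \<in> borel_measurable borel" for k
  proof -
    have "integrable lborel (h k)"
      unfolding h_def using corr_integrable[OF cint \<psi>] by (intro Bochner_Integration.integrable_sum) blast
    then show ?thesis by auto
  qed
  note hm [measurable] = this
  have "\<exists>B. \<forall>i\<in>I. B i \<ge> 0 \<and> (\<forall>z. \<bar>\<psi> i z\<bar> \<le> B i * indicator (cball 0 r) z)"
    using cpt_kernel_bound[OF \<psi>] by (intro bchoice) blast
  then obtain b where b: "\<And>i. i \<in> I \<Longrightarrow> b i \<ge> 0" "\<And>i z. i \<in> I \<Longrightarrow> \<bar>\<psi> i z\<bar> \<le> b i * indicator (cball 0 r) z"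
    by blast
  define B where "B = (\<Sum>i\<in>I. b i)"
  have B0: "B \<ge> 0" unfolding B_def using b by (intro sum_nonneg) auto
  have B: "\<bar>\<psi> i z\<bar> \<le> B * indicator (cball 0 r) z" if "i \<in> I" for i z
  proof -
    have "b i \<le> B" unfolding B_def using b I that by (intro member_le_sum) auto
    then show ?thesis using b(2)[OF that, of z] by (auto simp: indicator_def split: if_splits)
  qed
  define F where "F = (\<lambda>y. \<Sum>i\<in>I. complex_of_real (norm (f i y)))"
  have "(\<lambda>y. complex_of_real (norm (f i y))) \<in> L2_space" if "i \<in> I" for i
    using f[OF that] by (auto simp: L2_space_def)
  then have F: "F \<in> L2_space" unfolding F_def by (intro L2_space_sum I)
  note [measurable] = L2_spaceD(1)[OF F]
  have nF: "norm (F y) = (\<Sum>i\<in>I. norm (f i y))" for y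
    unfolding F_def by (simp flip: of_real_sum add: sum_nonneg)
  define q where "q = (\<lambda>k y. indicator (- cball 0 (real k - 2 * r)) y * norm (F y))"
  have q0: "0 \<le> q k y" for k y by (simp add: q_def)
  have [measurable]: "q k \<in> borel_measurable borel" for k unfolding q_def by measurable
  let ?I = "\<lambda>z::'a. indicator (cball 0 r) z :: real"
  have le: "ennreal (norm (h k x)) \<le> ennreal B * (\<integral>\<^sup>+y. ennreal (q k y * ?I (y - x)) \<partial>lborel)" for k x
  proof (cases "norm x \<le> real k - r")
    case True
    have "h k x = (\<Sum>i\<in>I. LINT y|lborel. \<psi> i (y - x) *\<^sub>R f i y)"
      unfolding h_def corr_def
    proof (intro sum.cong refl Bochner_Integration.integral_cong)
      fix i y assume i: "i \<in> I"
      show "\<psi> i (y - x) *\<^sub>R cut (real k) (f i) y = \<psi> i (y - x) *\<^sub>R f i y"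
      proof (cases "y - x \<in> cball 0 r")
        case True
        then have "norm y \<le> real k" using norm_triangle_ineq[of "y - x" x] \<open>norm x \<le> real k - r\<close> by simp
        then show ?thesis by (simp add: cut_def)
      qed (use \<psi>[OF i] in \<open>simp add: cpt_kernel_def\<close>)
    qed
    also have "\<dots> = (LINT y|lborel. (\<Sum>i\<in>I. \<psi> i (y - x) *\<^sub>R f i y))"
      by (intro Bochner_Integration.integral_sum[symmetric] corr_integrand_integrable[OF f \<psi>])
    finally show ?thesis using weak by simp
  next
    case False
    have ci: "integrable lborel (\<lambda>y. \<psi> i (y - x) *\<^sub>R cut (real k) (f i) y)" if "i \<in> I" for i
      by (rule corr_integrand_integrable[OF cut_L2[OF f[OF that]] \<psi>[OF that]])
    have "ennreal (norm (h k x)) = ennreal (norm (LINT y|lborel. (\<Sum>i\<in>I. \<psi> i (y - x) *\<^sub>R cut (real k) (f i) y)))"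
      unfolding h_def corr_def using ci by (subst Bochner_Integration.integral_sum) auto
    also have "\<dots> \<le> (\<integral>\<^sup>+y. ennreal (norm (\<Sum>i\<in>I. \<psi> i (y - x) *\<^sub>R cut (real k) (f i) y)) \<partial>lborel)"
      by (intro integral_norm_bound_ennreal Bochner_Integration.integrable_sum ci)
    also have "\<dots> \<le> (\<integral>\<^sup>+y. ennreal B * ennreal (q k y * ?I (y - x)) \<partial>lborel)"
    proof (rule nn_integral_mono)
      fix y :: 'a
      have "norm (\<Sum>i\<in>I. \<psi> i (y - x) *\<^sub>R cut (real k) (f i) y) \<le> (\<Sum>i\<in>I. B * ?I (y - x) * norm (f i y))"
      proof (rule sum_norm_le)
        fix i assume "i \<in> I"
        have "norm (\<psi> i (y - x) *\<^sub>R cut (real k) (f i) y) = \<bar>\<psi> i (y - x)\<bar> * norm (cut (real k) (f i) y)"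
          by simp
        also have "\<dots> \<le> (B * ?I (y - x)) * norm (f i y)"
          by (intro mult_mono B \<open>i \<in> I\<close>) (auto simp: cut_def indicator_def B0)
        finally show "norm (\<psi> i (y - x) *\<^sub>R cut (real k) (f i) y) \<le> B * ?I (y - x) * norm (f i y)" .
      qed
      also have "\<dots> = B * (?I (y - x) * norm (F y))"
        unfolding nF sum_distrib_left by (simp add: mult.assoc)
      also have "\<dots> = B * (q k y * ?I (y - x))"
      proof (cases "y - x \<in> cball 0 r")
        case True
        then have "y \<notin> cball 0 (real k - 2 * r)"
          using norm_triangle_ineq2[of x "x - y"] False by (simp add: norm_minus_commute)
        then show ?thesis by (simp add: q_def)
      qed simp
      finally show "ennreal (norm (\<Sum>i\<in>I. \<psi> i (y - x) *\<^sub>R cut (real k) (f i) y)) \<le> ennreal B * ennreal (q k y * ?I (y - x))"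
        using B0 q0 by (subst ennreal_mult[symmetric]) (auto intro: ennreal_leI)
    qed
    also have "\<dots> = ennreal B * (\<integral>\<^sup>+y. ennreal (q k y * ?I (y - x)) \<partial>lborel)"
      by (rule nn_integral_cmult) measurable
    finally show ?thesis .
  qed
  define J where "J = measure lborel (cball (0::'a) r)"
  have main: "sq_int (h k)
      \<le> (ennreal B)\<^sup>2 * ennreal (J\<^sup>2) * ennreal (LINT y|lborel. indicator (- cball 0 (real k - 2 * r)) y * (norm (F y))\<^sup>2)" for k
  proof -
    have "sq_int (h k)
      \<le> (\<integral>\<^sup>+x. (ennreal B)\<^sup>2 * (\<integral>\<^sup>+y. ennreal (q k y * ?I (y - x)) \<partial>lborel)\<^sup>2 \<partial>lborel)"
    proof (rule nn_integral_mono)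
      fix x :: 'a
      have "ennreal ((norm (h k x))\<^sup>2) = (ennreal (norm (h k x)))\<^sup>2"
        by (rule ennreal_power[symmetric]) simp
      also have "\<dots> \<le> (ennreal B * (\<integral>\<^sup>+y. ennreal (q k y * ?I (y - x)) \<partial>lborel))\<^sup>2"
        by (intro power_mono le) simp
      finally show "ennreal ((norm (h k x))\<^sup>2) \<le> (ennreal B)\<^sup>2 * (\<integral>\<^sup>+y. ennreal (q k y * ?I (y - x)) \<partial>lborel)\<^sup>2"
        by (simp only: power_mult_distrib)
    qed
    also have "\<dots> = (ennreal B)\<^sup>2 * (\<integral>\<^sup>+x. (\<integral>\<^sup>+y. ennreal (q k y * ?I (y - x)) \<partial>lborel)\<^sup>2 \<partial>lborel)"
      by (rule nn_integral_cmult) measurable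
    also have "\<dots> \<le> (ennreal B)\<^sup>2 * (ennreal (J\<^sup>2) * (\<integral>\<^sup>+y. ennreal ((q k y)\<^sup>2) \<partial>lborel))"
      unfolding J_def by (intro mult_left_mono nn_integral_ball_average_sq_le q0) auto
    also have "(\<integral>\<^sup>+y. ennreal ((q k y)\<^sup>2) \<partial>lborel) = (\<integral>\<^sup>+y. ennreal (indicator (- cball 0 (real k - 2 * r)) y * (norm (F y))\<^sup>2) \<partial>lborel)"
      by (intro nn_integral_cong) (auto simp: q_def indicator_def)
    also have "\<dots> = ennreal (LINT y|lborel. indicator (- cball 0 (real k - 2 * r)) y * (norm (F y))\<^sup>2)"
    proof (rule nn_integral_eq_integral)
      show "integrable lborel (\<lambda>y. indicator (- cball 0 (real k - 2 * r)) y * (norm (F y))\<^sup>2)"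
        by (rule Bochner_Integration.integrable_bound[OF L2_spaceD(2)[OF F]]) (auto simp: indicator_def)
    qed simp
    finally show ?thesis by (simp add: mult.assoc)
  qed
  have "(\<lambda>k. sq_int (h k)) \<longlonglongrightarrow> 0"
  proof (rule tendsto_0_mult_bound_ennreal)
    show "(\<lambda>k. ennreal (LINT y|lborel. indicator (- cball 0 (real k - 2 * r)) y * (norm (F y))\<^sup>2)) \<longlonglongrightarrow> 0"
      using tendsto_ennrealI[OF L2_tail_tendsto_0[OF F, of "2 * r"]] by simp
    show "(ennreal B)\<^sup>2 * ennreal (J\<^sup>2) < top"
      using B0 by (simp add: ennreal_power ennreal_mult_less_top)
  qed (use main in auto)
  then show ?thesis using hm by (simp add: L2_null_seq_def)
qed

text \<open>The transforms of the truncated correlations tend to \<open>0\<close> by Plancherel's inequality. They are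
  products of the transforms of the truncated \<open>f\<^sub>i\<close>, which tend to \<open>g\<^sub>i\<close>, with fixed bounded factors, and
  this identifies the limit in a second way.\<close>

lemma weak_equation_fourier:
  fixes f g :: "'i \<Rightarrow> 'a::euclidean_space \<Rightarrow> complex" and \<psi> :: "'i \<Rightarrow> 'a \<Rightarrow> real"
  assumes I: "finite I" and fg: "\<And>i. i \<in> I \<Longrightarrow> has_fourier_L2 (f i) (g i)"
    and \<psi>: "\<And>i. i \<in> I \<Longrightarrow> cpt_kernel r (\<psi> i)"
    and weak: "\<And>x. (LINT y|lborel. (\<Sum>i\<in>I. \<psi> i (y - x) *\<^sub>R f i y)) = 0"
  shows "AE \<xi> in lborel. (\<Sum>i\<in>I. g i \<xi> * transform (\<psi> i) \<xi>) = 0"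
proof -
  note D = has_fourier_L2D[OF fg]
  define h where "h k x = (\<Sum>i\<in>I. corr (cut (real k) (f i)) (\<psi> i) x)" for k x
  have h: "L2_null_seq h"
    using truncated_corr_null[OF I D(1) \<psi> weak] unfolding h_def by blast
  have cint: "integrable lborel (cut (real k) (f i))" if "i \<in> I" for i k
    by (rule cut_integrable[OF D(1)[OF that]])
  have hint: "integrable lborel (h k)" for k
    unfolding h_def using corr_integrable[OF cint \<psi>] by (intro Bochner_Integration.integrable_sum) blast
  have hhat: "fourier_integral (h k) \<xi> = (\<Sum>i\<in>I. fourier_integral (cut (real k) (f i)) \<xi> * transform (\<psi> i) \<xi>)" for k \<xi>
  proof -
    have "fourier_integral (h k) \<xi> = (\<Sum>i\<in>I. fourier_integral (corr (cut (real k) (f i)) (\<psi> i)) \<xi>)"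
      unfolding fourier_integral_def h_def sum_distrib_right
      using integrable_fourier_integrand[OF corr_integrable[OF cint \<psi>]]
      by (intro Bochner_Integration.integral_sum) blast
    then show ?thesis
      using fourier_integral_corr[OF cint \<psi>] by (simp cong: sum.cong)
  qed
  have "L2_null_seq (\<lambda>k \<xi>. fourier_integral (h k) \<xi>)"
  proof -
    have hm: "h k \<in> borel_measurable borel" for k using hint[of k] by auto
    let ?c = "ennreal ((2 * pi) ^ DIM('a))"
    have hl: "(\<lambda>k. sq_int (h k)) \<longlonglongrightarrow> 0"
      using h by (simp add: L2_null_seq_def)
    then have "\<forall>\<^sub>F k in sequentially. sq_int (h k) < 1"
      by (rule order_tendstoD(2)) simp
    then have "\<forall>\<^sub>F k in sequentially. sq_int (fourier_integral (h k))
        \<le> ?c * sq_int (h k)"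
    proof eventually_elim
      case (elim k)
      then have L2: "h k \<in> L2_space"
        unfolding L2_space_iff_nn_integral[OF hm] by (rule order.strict_trans) simp
      show ?case
        using Plancherel_le[OF hint L2] by (simp only: nn_integral_norm_sq[OF L2])
    qed
    then have "(\<lambda>k. sq_int (fourier_integral (h k))) \<longlonglongrightarrow> 0"
      by (rule tendsto_0_mult_bound_ennreal[OF hl, rotated]) simp
    then show ?thesis
      unfolding L2_null_seq_def using fourier_integral_measurable[OF hm] by blast
  qed
  moreover have "L2_null_seq (\<lambda>k \<xi>. \<Sum>i\<in>I. (g i \<xi> - fourier_integral (cut (real k) (f i)) \<xi>) * transform (\<psi> i) \<xi>)"
  proof (intro L2_null_seq_sum I L2_null_seq_mult[OF _ transform_measurable[OF \<psi>] transform_bounded[OF \<psi>]])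
    fix i assume i: "i \<in> I"
    have "(\<lambda>k. sq_int (\<lambda>\<xi>. g i \<xi> - fourier_integral (cut (real k) (f i)) \<xi>)) \<longlonglongrightarrow> 0"
      using filterlim_compose[OF D(3)[OF i] filterlim_real_sequentially] by (simp add: norm_minus_commute)
    then show "L2_null_seq (\<lambda>k \<xi>. g i \<xi> - fourier_integral (cut (real k) (f i)) \<xi>)"
      unfolding L2_null_seq_def
      using truncated_error_measurable(2)[OF L2_spaceD(1)[OF D(1)[OF i]] L2_spaceD(1)[OF D(2)[OF i]]] by blast
  qed
  ultimately have "L2_null_seq (\<lambda>k \<xi>. fourier_integral (h k) \<xi> +
      (\<Sum>i\<in>I. (g i \<xi> - fourier_integral (cut (real k) (f i)) \<xi>) * transform (\<psi> i) \<xi>))"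
    by (rule L2_null_seq_add)
  then have "L2_null_seq (\<lambda>k::nat. \<lambda>\<xi>. \<Sum>i\<in>I. g i \<xi> * transform (\<psi> i) \<xi>)"
    unfolding hhat by (simp add: left_diff_distrib flip: sum.distrib)
  then show ?thesis by (rule L2_null_seq_const)
qed

text \<open>The transform of a bump of width \<open>1 / \<kappa>\<close> has no zeros in the ball of radius \<open>\<kappa>\<close>, so countably
  many bumps determine the equation almost everywhere.\<close>

lemma cauchy_equation_fourier:
  fixes u v w :: "'a::euclidean_space \<Rightarrow> complex"
  assumes hu: "has_fourier_L2 u gu" and hv: "has_fourier_L2 v gv" and hw: "has_fourier_L2 w gw"
    and weak: "\<And>\<phi>. \<phi> \<in> test_functions \<Longrightarrow>
        (LINT x|lborel. (\<phi> x - laplacian \<phi> x) *\<^sub>R w x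
          + (laplacian (laplacian \<phi>) x - laplacian \<phi> x) *\<^sub>R u x + \<phi> x *\<^sub>R v x) = 0"
  shows "AE \<xi> in lborel. complex_of_real (1 + (norm \<xi>)\<^sup>2) * gw \<xi>
     + complex_of_real ((norm \<xi>) ^ 4 + (norm \<xi>)\<^sup>2) * gu \<xi> + gv \<xi> = 0"
proof -
  let ?E = "\<lambda>\<xi>. complex_of_real (1 + (norm \<xi>)\<^sup>2) * gw \<xi>
     + complex_of_real ((norm \<xi>) ^ 4 + (norm \<xi>)\<^sup>2) * gu \<xi> + gv \<xi>"
  have "AE \<xi> in lborel. norm \<xi> \<le> real (Suc k) \<longrightarrow> ?E \<xi> = 0" for k
  proof -
    define \<kappa> where "\<kappa> = real (Suc k)"
    have \<kappa>: "\<kappa> > 0" by (simp add: \<kappa>_def)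
    obtain d where d: "smooth_bump (1 / \<kappa>) d" "\<And>s. 0 \<le> d 0 s" "d 0 0 > 0"
      using smooth_bump_exists[OF \<kappa>] by blast
    define T where "T = (tensor d (\<lambda>_. 0) :: 'a \<Rightarrow> real)"
    define r where "r = real DIM('a) * (1 / \<kappa>)"
    have T: "cpt_kernel r (tensor d m :: 'a \<Rightarrow> real)" for m
      using tensor_support[OF d(1), of _ m] tensor_continuous[OF d(1), of UNIV m 0]
      by (auto simp: cpt_kernel_def r_def)
    have K1: "cpt_kernel r (tensor_lap d :: 'a \<Rightarrow> real)" and K2: "cpt_kernel r (tensor_bilap d :: 'a \<Rightarrow> real)"
      using T unfolding tensor_lap_def[abs_def] tensor_bilap_def[abs_def] cpt_kernel_def
      by (auto intro!: continuous_intros sum.neutral)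
    define f g \<psi> where "f i = (if i = 0 then w else if i = 1 then u else v)"
      and "g i = (if i = 0 then gw else if i = 1 then gu else gv)"
      and "\<psi> i = (if i = 0 then (\<lambda>z. T z - tensor_lap d z) else if i = 1 then (\<lambda>z. tensor_bilap d z - tensor_lap d z) else T)"
      for i :: nat
    have "AE \<xi> in lborel. (\<Sum>i\<in>{0,1,2}. g i \<xi> * transform (\<psi> i) \<xi>) = 0"
    proof (rule weak_equation_fourier)
      show "has_fourier_L2 (f i) (g i)" for i using hu hv hw by (simp add: f_def g_def)
      show "cpt_kernel r (\<psi> i)" for i
        using T[of "\<lambda>_. 0"] K1 K2 unfolding \<psi>_def T_def cpt_kernel_def
        by (auto intro!: continuous_intros)
      show "(LINT y|lborel. (\<Sum>i\<in>{0,1,2}. \<psi> i (y - x) *\<^sub>R f i y)) = 0" for x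
        using weak[OF tensor_test_function[OF d(1), of "\<lambda>_. 0" x]]
        by (simp add: laplacian_tensor[OF d(1)] \<psi>_def f_def T_def add.assoc)
    qed simp
    then show ?thesis
    proof eventually_elim
      case (elim \<xi>)
      note int = transform_tensor(1)[OF d(1), of "\<lambda>_. 0" \<xi>] and L = transform_tensor_lap[OF d(1), of \<xi>]
      let ?\<Phi> = "transform T \<xi>"
      have "transform (\<lambda>z. T z - tensor_lap d z) \<xi> = ?\<Phi> - transform (tensor_lap d) \<xi>"
        "transform (\<lambda>z. tensor_bilap d z - tensor_lap d z) \<xi> = transform (tensor_bilap d) \<xi> - transform (tensor_lap d) \<xi>"
        unfolding transform_def T_def using int L(3,4) by (simp_all add: left_diff_distrib)
      then have "transform (\<psi> 0) \<xi> = complex_of_real (1 + (norm \<xi>)\<^sup>2) * ?\<Phi>"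
        "transform (\<psi> 1) \<xi> = complex_of_real ((norm \<xi>) ^ 4 + (norm \<xi>)\<^sup>2) * ?\<Phi>" "transform (\<psi> 2) \<xi> = ?\<Phi>"
        using L(1,2) by (simp_all add: \<psi>_def T_def algebra_simps)
      then have "(\<Sum>i\<in>{0,1,2}. g i \<xi> * transform (\<psi> i) \<xi>) = ?E \<xi> * ?\<Phi>"
        by (simp add: g_def algebra_simps)
      then have "?E \<xi> * ?\<Phi> = 0" using elim by simp
      moreover have "?\<Phi> \<noteq> 0" if "norm \<xi> \<le> \<kappa>"
        unfolding T_def by (rule transform_tensor_nonzero[OF d \<kappa> that])
      ultimately show ?case unfolding \<kappa>_def by auto
    qed
  qed
  then have "AE \<xi> in lborel. \<forall>k. norm \<xi> \<le> real (Suc k) \<longrightarrow> ?E \<xi> = 0"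
    unfolding AE_all_countable by blast
  then show ?thesis
  proof eventually_elim
    case (elim \<xi>)
    obtain k where "norm \<xi> \<le> real k" using real_arch_simple by blast
    then have "norm \<xi> \<le> real (Suc k)" by simp
    then show ?case using elim by blast
  qed
qed

section \<open>Evolution in time\<close>

lemma L2_norm_le_combination:
  fixes f g h e :: "'a::euclidean_space \<Rightarrow> complex"
  assumes "f \<in> borel_measurable borel" "g \<in> L2_space" "h \<in> L2_space" "e \<in> L2_space"
    and abc: "a \<ge> 0" "b \<ge> 0" "c \<ge> 0"
    and le: "AE x in lborel. norm (f x) \<le> a * norm (g x) + b * norm (h x) + c * norm (e x)"
  shows "L2_norm f \<le> a * L2_norm g + b * L2_norm h + c * L2_norm e" "f \<in> L2_space"
proof -
  define N where "N = (\<lambda>(g::'a \<Rightarrow> complex) x. complex_of_real (norm (g x)))"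
  have N: "N g \<in> L2_space" if "g \<in> L2_space" for g
    using that by (auto simp: L2_space_def N_def)
  have nN: "L2_norm (N g) = L2_norm g" for g
    by (simp add: L2_norm_def N_def)
  define F where "F x = complex_of_real a * N g x + (complex_of_real b * N h x + complex_of_real c * N e x)" for x
  have in1: "(\<lambda>x. complex_of_real b * N h x + complex_of_real c * N e x) \<in> L2_space"
    and in2: "(\<lambda>x. complex_of_real a * N g x) \<in> L2_space"
    and in3: "(\<lambda>x. complex_of_real b * N h x) \<in> L2_space" "(\<lambda>x. complex_of_real c * N e x) \<in> L2_space"
    using assms N by (auto intro!: L2_space_add L2_space_scale)
  have F: "F \<in> L2_space" unfolding F_def by (rule L2_space_add[OF in2 in1])
  have "norm (F x) = a * norm (g x) + b * norm (h x) + c * norm (e x)" for x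
  proof -
    have "F x = complex_of_real (a * norm (g x) + b * norm (h x) + c * norm (e x))"
      by (simp add: F_def N_def)
    then show ?thesis using abc by (simp only: norm_of_real) simp
  qed
  then have le': "AE x in lborel. norm (f x) \<le> norm (F x)" using le by simp
  show f: "f \<in> L2_space" by (rule L2_space_dominated[OF F assms(1) le'])
  have "L2_norm f \<le> L2_norm F" by (rule L2_norm_mono[OF f F le'])
  also have "\<dots> \<le> L2_norm (\<lambda>x. complex_of_real a * N g x) + L2_norm (\<lambda>x. complex_of_real b * N h x + complex_of_real c * N e x)"
    unfolding F_def by (rule L2_norm_triangle[OF in2 in1])
  also have "\<dots> \<le> L2_norm (\<lambda>x. complex_of_real a * N g x) + (L2_norm (\<lambda>x. complex_of_real b * N h x) + L2_norm (\<lambda>x. complex_of_real c * N e x))"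
    by (intro add_left_mono L2_norm_triangle in3)
  also have "\<dots> = a * L2_norm g + b * L2_norm h + c * L2_norm e"
    using abc by (simp add: L2_norm_scale nN)
  finally show "L2_norm f \<le> a * L2_norm g + b * L2_norm h + c * L2_norm e" .
qed

text \<open>\<open>e\<^bsup>-\<mu>t\<^esup> p(t)\<close> is constant in \<open>L\<^sup>2\<close>: its distance \<open>D(t)\<close> to the initial value is a real function with
  vanishing derivative. This real function replaces pointwise calculus in \<open>t\<close>, which is not
  available because \<open>p(t)\<close> is only determined up to a null set that depends on \<open>t\<close>.\<close>

lemma L2_exponential_flow:
  fixes p q :: "real \<Rightarrow> 'a::euclidean_space \<Rightarrow> complex" and \<mu> :: "'a \<Rightarrow> complex"
  assumes p: "\<And>t. t \<ge> 0 \<Longrightarrow> p t \<in> L2_space" and q: "\<And>t. t \<ge> 0 \<Longrightarrow> q t \<in> L2_space"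
    and \<mu> [measurable]: "\<mu> \<in> borel_measurable borel" and M: "\<And>\<xi>. norm (\<mu> \<xi>) \<le> M"
    and der: "\<And>t. t \<ge> 0 \<Longrightarrow> has_L2_deriv p q t"
    and eq: "\<And>t. t > 0 \<Longrightarrow> AE \<xi> in lborel. q t \<xi> = \<mu> \<xi> * p t \<xi>"
    and T: "T > 0"
  shows "AE \<xi> in lborel. p T \<xi> = exp (\<mu> \<xi> * complex_of_real T) * p 0 \<xi>"
proof -
  have M0: "0 \<le> M" using order_trans[OF norm_ge_zero M] .
  note pm [measurable] = p[THEN L2_spaceD(1)] and qm [measurable] = q[THEN L2_spaceD(1)]
  define P where "P t \<xi> = exp (- (\<mu> \<xi> * complex_of_real t)) * p t \<xi>" for t \<xi>
  define D where "D t = L2_norm (\<lambda>\<xi>. P t \<xi> - P 0 \<xi>)" for t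
  define \<rho> where "\<rho> t \<tau> \<xi> = (p \<tau> \<xi> - p t \<xi>) /\<^sub>R (\<tau> - t) - q t \<xi>" for t \<tau> \<xi>
  define G where "G t = exp (M * (t + 1))" for t :: real
  have nexp: "norm (exp (- (\<mu> \<xi> * complex_of_real \<tau>))) \<le> G t" if "0 \<le> \<tau>" "\<tau> \<le> t + 1" for \<xi> \<tau> t
  proof -
    have "norm (exp (- (\<mu> \<xi> * complex_of_real \<tau>))) \<le> exp (norm (- (\<mu> \<xi> * complex_of_real \<tau>)))"
      by (rule norm_exp)
    also have "\<dots> \<le> G t"
      unfolding G_def exp_le_cancel_iff using M[of \<xi>] M0 that by (simp add: norm_mult mult_mono)
    finally show ?thesis .
  qed
  have Pm: "P t \<in> borel_measurable borel" if "t \<ge> 0" for t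
    using pm[OF that] unfolding P_def by measurable
  have P: "P t \<in> L2_space" if "t \<ge> 0" for t
  proof (rule L2_norm_le_combination(2)[OF Pm[OF that] p[OF that] p[OF that] p[OF that]])
    show "AE \<xi> in lborel. norm (P t \<xi>) \<le> G t * norm (p t \<xi>) + 0 * norm (p t \<xi>) + 0 * norm (p t \<xi>)"
      using that by (intro AE_I2) (simp add: P_def norm_mult mult_right_mono nexp del: norm_exp_eq_Re)
  qed (simp_all add: G_def)
  have \<rho>: "\<rho> t \<tau> \<in> L2_space" if "t \<ge> 0" "\<tau> \<ge> 0" for t \<tau>
  proof -
    have "(\<lambda>\<xi>. complex_of_real (inverse (\<tau> - t)) * (p \<tau> \<xi> - p t \<xi>) - q t \<xi>) \<in> L2_space"
      using that by (intro L2_space_diff L2_space_scale p q)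
    then show ?thesis unfolding \<rho>_def scaleR_conv_of_real .
  qed
  have P_diff: "P \<tau> \<xi> - P t \<xi> = exp (- (\<mu> \<xi> * complex_of_real \<tau>)) *
      (complex_of_real (\<tau> - t) * \<rho> t \<tau> \<xi> + complex_of_real (\<tau> - t) * q t \<xi>
       - (exp (\<mu> \<xi> * complex_of_real (\<tau> - t)) - 1) * p t \<xi>)" if "\<tau> \<noteq> t" for \<tau> t \<xi>
  proof -
    have "complex_of_real (\<tau> - t) * \<rho> t \<tau> \<xi> + complex_of_real (\<tau> - t) * q t \<xi> = p \<tau> \<xi> - p t \<xi>"
      using that unfolding \<rho>_def scaleR_conv_of_real right_diff_distrib
      by (simp flip: of_real_diff of_real_mult mult.assoc right_diff_distrib)
    moreover have "exp (- (\<mu> \<xi> * complex_of_real \<tau>)) * exp (\<mu> \<xi> * complex_of_real (\<tau> - t)) = exp (- (\<mu> \<xi> * complex_of_real t))"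
      by (simp add: algebra_simps flip: exp_add)
    ultimately show ?thesis unfolding P_def by (simp add: algebra_simps)
  qed
  have taylor0: "norm (exp z - 1) \<le> exp (norm z) * norm z" and taylor1: "norm (exp z - 1 - z) \<le> exp (norm z) * (norm z)\<^sup>2" for z :: complex
  proof -
    have e: "exp \<bar>Re z\<bar> \<le> exp (norm z)" using abs_Re_le_cmod by simp
    have "norm (exp z - (\<Sum>i\<le>0. z ^ i / fact i)) \<le> exp \<bar>Re z\<bar> * norm z ^ Suc 0 / fact 0" by (rule Taylor_exp)
    also have "\<dots> \<le> exp (norm z) * norm z" using e by (simp add: mult_right_mono)
    finally show "norm (exp z - 1) \<le> exp (norm z) * norm z" by simp
    have "norm (exp z - (\<Sum>i\<le>1. z ^ i / fact i)) \<le> exp \<bar>Re z\<bar> * norm z ^ Suc 1 / fact 1" by (rule Taylor_exp)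
    also have "\<dots> \<le> exp (norm z) * (norm z)\<^sup>2" using e by (simp add: mult_right_mono power2_eq_square)
    finally show "norm (exp z - 1 - z) \<le> exp (norm z) * (norm z)\<^sup>2" by (simp add: algebra_simps)
  qed
  have step: "norm (\<mu> \<xi> * complex_of_real k) \<le> M * \<bar>k\<bar>" "norm (\<mu> \<xi> * complex_of_real k) \<le> M" if "\<bar>k\<bar> \<le> 1" for k \<xi>
  proof -
    show 1: "norm (\<mu> \<xi> * complex_of_real k) \<le> M * \<bar>k\<bar>" using M by (simp add: norm_mult mult_right_mono)
    have "M * \<bar>k\<bar> \<le> M * 1" by (intro mult_left_mono that M0)
    then show "norm (\<mu> \<xi> * complex_of_real k) \<le> M" using 1 by simp
  qed
  have D_diff: "\<bar>D \<tau> - D t\<bar> \<le> L2_norm (\<lambda>\<xi>. P \<tau> \<xi> - P t \<xi>)" if "\<tau> \<ge> 0" "t \<ge> 0" for \<tau> t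
  proof -
    have "D \<tau> \<le> L2_norm (\<lambda>\<xi>. P \<tau> \<xi> - P t \<xi>) + D t"
      unfolding D_def using L2_norm_triangle[OF L2_space_diff[OF P P] L2_space_diff[OF P P], of \<tau> t t 0] that by simp
    moreover have "D t \<le> L2_norm (\<lambda>\<xi>. P \<tau> \<xi> - P t \<xi>) + D \<tau>"
      unfolding D_def using L2_norm_triangle_diff[OF L2_space_diff[OF P P] L2_space_diff[OF P P], of \<tau> 0 \<tau> t] that
      by (simp add: add.commute)
    ultimately show ?thesis by linarith
  qed
  \<comment> \<open>At time \<open>0\<close> the equation is not known, but continuity needs only the existence of \<open>q\<close>.\<close>
  have cont0: "((\<lambda>\<tau>. D \<tau> - D 0) \<longlongrightarrow> 0) (at 0 within {0..})"
  proof (rule Lim_null_comparison)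
    let ?R = "\<lambda>\<tau>. (G 0 * \<bar>\<tau>\<bar>) * L2_norm (\<rho> 0 \<tau>) + (G 0 * \<bar>\<tau>\<bar>) * L2_norm (q 0) + (G 0 * (exp M * (M * \<bar>\<tau>\<bar>))) * L2_norm (p 0)"
    have "\<forall>\<^sub>F \<tau> in at 0 within {0..}. \<tau> \<in> {0..} \<and> \<tau> \<noteq> 0 \<and> \<tau> < (1::real)"
      unfolding eventually_at by (rule exI[of _ 1]) auto
    then show "\<forall>\<^sub>F \<tau> in at 0 within {0..}. norm (D \<tau> - D 0)
        \<le> ?R \<tau>"
    proof eventually_elim
      case (elim \<tau>)
      then have \<tau>: "0 \<le> \<tau>" "\<tau> \<noteq> 0" "\<tau> < 1" by auto
      have "norm (D \<tau> - D 0) \<le> L2_norm (\<lambda>\<xi>. P \<tau> \<xi> - P 0 \<xi>)" using D_diff[of \<tau> 0] \<tau> by simp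
      also have "\<dots> \<le> ?R \<tau>"
      proof (rule L2_norm_le_combination(1))
        show "(\<lambda>\<xi>. P \<tau> \<xi> - P 0 \<xi>) \<in> borel_measurable borel"
          using Pm[of \<tau>] Pm[of 0] \<tau> by simp
        show "AE \<xi> in lborel. norm (P \<tau> \<xi> - P 0 \<xi>) \<le> G 0 * \<bar>\<tau>\<bar> * norm (\<rho> 0 \<tau> \<xi>) + G 0 * \<bar>\<tau>\<bar> * norm (q 0 \<xi>)
            + G 0 * (exp M * (M * \<bar>\<tau>\<bar>)) * norm (p 0 \<xi>)"
        proof (rule AE_I2)
          fix \<xi> :: 'a
          let ?z = "\<mu> \<xi> * complex_of_real \<tau>"
          have z: "norm (exp ?z - 1) \<le> exp M * (M * \<bar>\<tau>\<bar>)"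
            by (rule order_trans[OF taylor0], rule mult_mono) (use step[of \<tau> \<xi>] \<tau> in auto)
          have "norm (P \<tau> \<xi> - P 0 \<xi>) \<le> G 0 * norm (complex_of_real \<tau> * \<rho> 0 \<tau> \<xi> + complex_of_real \<tau> * q 0 \<xi> - (exp ?z - 1) * p 0 \<xi>)"
            using P_diff[of \<tau> 0 \<xi>] \<tau> nexp[of \<tau> 0 \<xi>] by (simp add: norm_mult mult_right_mono)
          also have "\<dots> \<le> G 0 * (\<bar>\<tau>\<bar> * norm (\<rho> 0 \<tau> \<xi>) + \<bar>\<tau>\<bar> * norm (q 0 \<xi>) + (exp M * (M * \<bar>\<tau>\<bar>)) * norm (p 0 \<xi>))"
          proof (rule mult_left_mono)
            have "norm (complex_of_real \<tau> * \<rho> 0 \<tau> \<xi> + complex_of_real \<tau> * q 0 \<xi> - (exp ?z - 1) * p 0 \<xi>)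
                \<le> norm (complex_of_real \<tau> * \<rho> 0 \<tau> \<xi>) + norm (complex_of_real \<tau> * q 0 \<xi>) + norm ((exp ?z - 1) * p 0 \<xi>)"
              by (intro order_trans[OF norm_triangle_ineq4] add_right_mono norm_triangle_ineq)
            moreover have "norm ((exp ?z - 1) * p 0 \<xi>) \<le> (exp M * (M * \<bar>\<tau>\<bar>)) * norm (p 0 \<xi>)"
              unfolding norm_mult by (intro mult_right_mono z) simp
            ultimately show "norm (complex_of_real \<tau> * \<rho> 0 \<tau> \<xi> + complex_of_real \<tau> * q 0 \<xi> - (exp ?z - 1) * p 0 \<xi>)
               \<le> \<bar>\<tau>\<bar> * norm (\<rho> 0 \<tau> \<xi>) + \<bar>\<tau>\<bar> * norm (q 0 \<xi>) + (exp M * (M * \<bar>\<tau>\<bar>)) * norm (p 0 \<xi>)"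
              by (simp add: norm_mult)
          qed (simp add: G_def)
          finally show "norm (P \<tau> \<xi> - P 0 \<xi>) \<le> G 0 * \<bar>\<tau>\<bar> * norm (\<rho> 0 \<tau> \<xi>) + G 0 * \<bar>\<tau>\<bar> * norm (q 0 \<xi>)
            + G 0 * (exp M * (M * \<bar>\<tau>\<bar>)) * norm (p 0 \<xi>)" by (simp add: algebra_simps)
        qed
      qed (use \<tau> \<rho> p q M0 in \<open>auto simp: G_def\<close>)
      finally show ?case .
    qed
    have t0: "((\<lambda>\<tau>. \<bar>\<tau>\<bar>) \<longlongrightarrow> 0) (at (0::real) within {0..})"
      using tendsto_rabs[OF tendsto_ident_at, of "0::real" "{0..}"] by simp
    have r0: "((\<lambda>\<tau>. L2_norm (\<rho> 0 \<tau>)) \<longlongrightarrow> 0) (at 0 within {0..})"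
      using der[of 0] unfolding \<rho>_def by simp
    have "((\<lambda>\<tau>. ?R \<tau>)
        \<longlongrightarrow> (G 0 * 0) * 0 + (G 0 * 0) * L2_norm (q 0) + (G 0 * (exp M * (M * 0))) * L2_norm (p 0)) (at 0 within {0..})"
      by (intro tendsto_intros t0 r0)
    then show "((\<lambda>\<tau>. ?R \<tau>)
        \<longlongrightarrow> 0) (at 0 within {0..})" by simp
  qed
  have deriv: "(D has_real_derivative 0) (at t)" if t: "t > 0" for t
  proof -
    have at: "at t within {0..} = at t" using at_within_interior[of t "{0..}"] t by simp
    have "((\<lambda>\<tau>. (D \<tau> - D t) / (\<tau> - t)) \<longlongrightarrow> 0) (at t)"
    proof (rule Lim_null_comparison)
      let ?R = "\<lambda>\<tau>. G t * L2_norm (\<rho> t \<tau>) + G t * (exp M * M\<^sup>2 * \<bar>\<tau> - t\<bar>) * L2_norm (p t)"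
      have "\<forall>\<^sub>F \<tau> in at t. \<tau> \<noteq> t \<and> dist \<tau> t < min t 1"
        unfolding eventually_at by (rule exI[of _ "min t 1"]) (use t in auto)
      then show "\<forall>\<^sub>F \<tau> in at t. norm ((D \<tau> - D t) / (\<tau> - t))
          \<le> ?R \<tau>"
      proof eventually_elim
        case (elim \<tau>)
        define k where "k = \<tau> - t"
        have \<tau>: "0 \<le> \<tau>" "\<tau> \<noteq> t" "\<bar>k\<bar> \<le> 1" "\<tau> \<le> t + 1" "k \<noteq> 0"
          using elim by (auto simp: dist_real_def k_def)
        have "\<bar>D \<tau> - D t\<bar> \<le> L2_norm (\<lambda>\<xi>. P \<tau> \<xi> - P t \<xi>)" using D_diff[of \<tau> t] \<tau> t by simp
        also have "\<dots> \<le> (G t * \<bar>k\<bar>) * L2_norm (\<rho> t \<tau>) + (G t * (exp M * M\<^sup>2 * \<bar>k\<bar>\<^sup>2)) * L2_norm (p t) + 0 * L2_norm (p t)"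
        proof (rule L2_norm_le_combination(1))
          show "(\<lambda>\<xi>. P \<tau> \<xi> - P t \<xi>) \<in> borel_measurable borel"
            using Pm[of \<tau>] Pm[of t] \<tau> t by simp
          show "AE \<xi> in lborel. norm (P \<tau> \<xi> - P t \<xi>) \<le> G t * \<bar>k\<bar> * norm (\<rho> t \<tau> \<xi>)
              + G t * (exp M * M\<^sup>2 * \<bar>k\<bar>\<^sup>2) * norm (p t \<xi>) + 0 * norm (p t \<xi>)"
            using eq[OF t]
          proof eventually_elim
            case (elim \<xi>)
            let ?z = "\<mu> \<xi> * complex_of_real k"
            have z: "norm (exp ?z - 1 - ?z) \<le> exp M * M\<^sup>2 * \<bar>k\<bar>\<^sup>2"
            proof -
              have "exp (norm ?z) * (norm ?z)\<^sup>2 \<le> exp M * (M * \<bar>k\<bar>)\<^sup>2"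
                using step[of k \<xi>] \<tau> by (intro mult_mono power_mono) auto
              then show ?thesis using taylor1[of ?z] by (simp add: power_mult_distrib mult.assoc)
            qed
            have "P \<tau> \<xi> - P t \<xi> = exp (- (\<mu> \<xi> * complex_of_real \<tau>)) * (complex_of_real k * \<rho> t \<tau> \<xi> - (exp ?z - 1 - ?z) * p t \<xi>)"
              using P_diff[of \<tau> t \<xi>] \<tau> elim unfolding k_def[symmetric] by (simp add: algebra_simps)
            then have "norm (P \<tau> \<xi> - P t \<xi>) \<le> G t * norm (complex_of_real k * \<rho> t \<tau> \<xi> - (exp ?z - 1 - ?z) * p t \<xi>)"
              using \<tau> nexp[of \<tau> t \<xi>] by (simp add: norm_mult mult_right_mono)
            also have "\<dots> \<le> G t * (\<bar>k\<bar> * norm (\<rho> t \<tau> \<xi>) + exp M * M\<^sup>2 * \<bar>k\<bar>\<^sup>2 * norm (p t \<xi>))"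
            proof (rule mult_left_mono)
              have "norm (complex_of_real k * \<rho> t \<tau> \<xi> - (exp ?z - 1 - ?z) * p t \<xi>)
                 \<le> norm (complex_of_real k * \<rho> t \<tau> \<xi>) + norm ((exp ?z - 1 - ?z) * p t \<xi>)"
                by (rule norm_triangle_ineq4)
              moreover have "norm ((exp ?z - 1 - ?z) * p t \<xi>) \<le> exp M * M\<^sup>2 * \<bar>k\<bar>\<^sup>2 * norm (p t \<xi>)"
                unfolding norm_mult[of "exp ?z - 1 - ?z"] by (intro mult_right_mono z) simp
              ultimately show "norm (complex_of_real k * \<rho> t \<tau> \<xi> - (exp ?z - 1 - ?z) * p t \<xi>)
                 \<le> \<bar>k\<bar> * norm (\<rho> t \<tau> \<xi>) + exp M * M\<^sup>2 * \<bar>k\<bar>\<^sup>2 * norm (p t \<xi>)"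
                by (simp add: norm_mult[of "complex_of_real k"])
            qed (simp add: G_def)
            finally show ?case by (simp add: algebra_simps)
          qed
        qed (use \<tau> t \<rho> p M0 in \<open>auto simp: G_def\<close>)
        also have "\<dots> = \<bar>k\<bar> * (G t * L2_norm (\<rho> t \<tau>) + G t * (exp M * M\<^sup>2 * \<bar>k\<bar>) * L2_norm (p t))"
          by (simp only: power2_eq_square[of "\<bar>k\<bar>"]) (simp only: algebra_simps mult_zero_left add_0_right)
        finally have "\<bar>D \<tau> - D t\<bar> \<le> \<bar>k\<bar> * (G t * L2_norm (\<rho> t \<tau>) + G t * (exp M * M\<^sup>2 * \<bar>k\<bar>) * L2_norm (p t))" .
        then show ?case
          using \<tau>(5) unfolding k_def[symmetric] by (simp add: abs_divide divide_le_eq mult.commute)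
      qed
      have k0: "((\<lambda>\<tau>. \<bar>\<tau> - t\<bar>) \<longlongrightarrow> 0) (at t)"
        by (intro tendsto_rabs_zero LIM_zero tendsto_ident_at)
      have r0: "((\<lambda>\<tau>. L2_norm (\<rho> t \<tau>)) \<longlongrightarrow> 0) (at t)"
        using der[of t] t unfolding \<rho>_def at by simp
      have "((\<lambda>\<tau>. ?R \<tau>) \<longlongrightarrow>
          G t * 0 + G t * (exp M * M\<^sup>2 * 0) * L2_norm (p t)) (at t)"
        by (intro tendsto_intros k0 r0)
      then show "((\<lambda>\<tau>. ?R \<tau>) \<longlongrightarrow> 0) (at t)"
        by simp
    qed
    then show ?thesis by (simp add: has_field_derivative_iff)
  qed
  have "continuous_on {0..T} D"
  proof (unfold continuous_on_def, intro ballI)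
    fix x assume "x \<in> {0..T}"
    then consider "x = 0" | "x > 0" by fastforce
    then show "(D \<longlongrightarrow> D x) (at x within {0..T})"
    proof cases
      case 1
      have "(D \<longlongrightarrow> D 0) (at 0 within {0..})" using cont0 by (simp add: LIM_zero_iff)
      then show ?thesis using 1 tendsto_within_subset by fastforce
    next
      case 2
      then show ?thesis using DERIV_isCont[OF deriv] by (simp add: isCont_def tendsto_within_subset[where S = UNIV])
    qed
  qed
  then have "D T = D 0"
    by (rule DERIV_isconst2[OF T]) (use T deriv in auto)
  then have "D T = 0" by (simp add: D_def L2_norm_def)
  then have "AE \<xi> in lborel. P T \<xi> - P 0 \<xi> = 0"
    unfolding D_def using T by (intro L2_norm_eq_0_AE L2_space_diff P) auto
  then show ?thesis
  proof eventually_elim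
    case (elim \<xi>)
    then have "exp (\<mu> \<xi> * complex_of_real T) * (exp (- (\<mu> \<xi> * complex_of_real T)) * p T \<xi>) = exp (\<mu> \<xi> * complex_of_real T) * p 0 \<xi>"
      by (simp add: P_def)
    then show ?case by (simp add: mult.assoc[symmetric] flip: exp_add)
  qed
qed

text \<open>A factorisation of the second order equation into first order ones, in each ball of frequencies,
  where the characteristic roots are bounded.\<close>

lemma characteristic_flow:
  fixes U V W :: "real \<Rightarrow> 'a::euclidean_space \<Rightarrow> complex" and \<mu> \<nu> :: "'a \<Rightarrow> complex"
  assumes U: "\<And>t. t \<ge> 0 \<Longrightarrow> U t \<in> L2_space" and V: "\<And>t. t \<ge> 0 \<Longrightarrow> V t \<in> L2_space" and W: "\<And>t. t \<ge> 0 \<Longrightarrow> W t \<in> L2_space"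
    and UV: "\<And>t. t \<ge> 0 \<Longrightarrow> has_L2_deriv U V t"
    and VW: "\<And>t. t \<ge> 0 \<Longrightarrow> has_L2_deriv V W t"
    and eq: "\<And>t. t > 0 \<Longrightarrow> AE \<xi> in lborel. W t \<xi> = (\<mu> \<xi> + \<nu> \<xi>) * V t \<xi> - \<mu> \<xi> * \<nu> \<xi> * U t \<xi>"
    and [measurable]: "\<mu> \<in> borel_measurable borel" "\<nu> \<in> borel_measurable borel"
    and bd: "\<And>\<xi>. norm (\<mu> \<xi>) \<le> B (norm \<xi>)" "\<And>\<xi>. norm (\<nu> \<xi>) \<le> B (norm \<xi>)" "mono B"
    and T: "T > 0"
  shows "AE \<xi> in lborel. V T \<xi> - \<nu> \<xi> * U T \<xi> = exp (\<mu> \<xi> * complex_of_real T) * (V 0 \<xi> - \<nu> \<xi> * U 0 \<xi>)"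
proof -
  have "AE \<xi> in lborel. norm \<xi> \<le> real m \<longrightarrow> V T \<xi> - \<nu> \<xi> * U T \<xi> = exp (\<mu> \<xi> * complex_of_real T) * (V 0 \<xi> - \<nu> \<xi> * U 0 \<xi>)" for m :: nat
  proof -
    define \<theta> where "\<theta> \<xi> = (indicator (cball 0 (real m)) \<xi> :: complex)" for \<xi> :: 'a
    have [measurable]: "\<theta> \<in> borel_measurable borel" unfolding \<theta>_def by measurable
    define M where "M = max 0 (B (real m))"
    have M0: "0 \<le> M" by (simp add: M_def)
    have bM: "norm (\<theta> \<xi> * \<mu> \<xi>) \<le> M" "norm (\<theta> \<xi> * \<nu> \<xi>) \<le> M" for \<xi>
      using bd(1,2)[of \<xi>] monoD[OF bd(3), of "norm \<xi>" "real m"]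
      by (auto simp: \<theta>_def M_def indicator_def)
    have n\<theta>: "norm (\<theta> \<xi>) \<le> 1" for \<xi> by (simp add: \<theta>_def indicator_def)
    define p where "p t \<xi> = \<theta> \<xi> * V t \<xi> - \<theta> \<xi> * \<nu> \<xi> * U t \<xi>" for t \<xi>
    define q where "q t \<xi> = \<theta> \<xi> * W t \<xi> - \<theta> \<xi> * \<nu> \<xi> * V t \<xi>" for t \<xi>
    have comb: "L2_norm (\<lambda>\<xi>. \<theta> \<xi> * f \<xi> - \<theta> \<xi> * \<nu> \<xi> * g \<xi>) \<le> 1 * L2_norm f + M * L2_norm g + 0 * L2_norm g"
      "(\<lambda>\<xi>. \<theta> \<xi> * f \<xi> - \<theta> \<xi> * \<nu> \<xi> * g \<xi>) \<in> L2_space"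
      if f: "f \<in> L2_space" and g: "g \<in> L2_space" for f g
    proof -
      have m: "(\<lambda>\<xi>. \<theta> \<xi> * f \<xi> - \<theta> \<xi> * \<nu> \<xi> * g \<xi>) \<in> borel_measurable borel"
        using L2_spaceD(1)[OF f] L2_spaceD(1)[OF g] by measurable
      have le: "AE \<xi> in lborel. norm (\<theta> \<xi> * f \<xi> - \<theta> \<xi> * \<nu> \<xi> * g \<xi>) \<le> 1 * norm (f \<xi>) + M * norm (g \<xi>) + 0 * norm (g \<xi>)"
      proof (rule AE_I2)
        fix \<xi> :: 'a
        have "norm (\<theta> \<xi> * f \<xi>) \<le> 1 * norm (f \<xi>)" "norm (\<theta> \<xi> * \<nu> \<xi> * g \<xi>) \<le> M * norm (g \<xi>)"
          unfolding norm_mult[of _ "f \<xi>"] norm_mult[of _ "g \<xi>"] by (intro mult_right_mono n\<theta> bM; simp)+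
        then show "norm (\<theta> \<xi> * f \<xi> - \<theta> \<xi> * \<nu> \<xi> * g \<xi>) \<le> 1 * norm (f \<xi>) + M * norm (g \<xi>) + 0 * norm (g \<xi>)"
          using norm_triangle_ineq4[of "\<theta> \<xi> * f \<xi>" "\<theta> \<xi> * \<nu> \<xi> * g \<xi>"] by linarith
      qed
      show "L2_norm (\<lambda>\<xi>. \<theta> \<xi> * f \<xi> - \<theta> \<xi> * \<nu> \<xi> * g \<xi>) \<le> 1 * L2_norm f + M * L2_norm g + 0 * L2_norm g"
        "(\<lambda>\<xi>. \<theta> \<xi> * f \<xi> - \<theta> \<xi> * \<nu> \<xi> * g \<xi>) \<in> L2_space"
        using L2_norm_le_combination[OF m f g g _ M0 _ le] by simp_all
    qed
    have "AE \<xi> in lborel. p T \<xi> = exp (\<theta> \<xi> * \<mu> \<xi> * complex_of_real T) * p 0 \<xi>"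
    proof (rule L2_exponential_flow[where q = q, OF _ _ _ bM(1) _ _ T])
      fix t :: real assume t: "t \<ge> 0"
      show "p t \<in> L2_space" "q t \<in> L2_space"
        unfolding p_def q_def using comb(2) U[OF t] V[OF t] W[OF t] by blast+
      let ?d = "\<lambda>Y Z \<tau> \<xi>. (Y \<tau> \<xi> - Y t \<xi>) /\<^sub>R (\<tau> - t) - Z t \<xi> :: complex"
      have d: "?d Y Z \<tau> \<in> L2_space" if "Y \<tau> \<in> L2_space" "Y t \<in> L2_space" "Z t \<in> L2_space" for Y Z \<tau>
      proof -
        have "(\<lambda>\<xi>. complex_of_real (inverse (\<tau> - t)) * (Y \<tau> \<xi> - Y t \<xi>) - Z t \<xi>) \<in> L2_space"
          using that by (intro L2_space_diff L2_space_scale)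
        then show ?thesis unfolding scaleR_conv_of_real .
      qed
      have pq: "?d p q \<tau> \<xi> = \<theta> \<xi> * ?d V W \<tau> \<xi> - \<theta> \<xi> * \<nu> \<xi> * ?d U V \<tau> \<xi>" for \<tau> \<xi>
        unfolding p_def q_def scaleR_conv_of_real by (simp add: algebra_simps)
      show "((\<lambda>\<tau>. L2_norm (?d p q \<tau>)) \<longlongrightarrow> 0) (at t within {0..})"
      proof (rule Lim_null_comparison)
        have "\<forall>\<^sub>F \<tau> in at t within {0..}. \<tau> \<in> {0..}"
          unfolding eventually_at by (rule exI[of _ 1]) auto
        then show "\<forall>\<^sub>F \<tau> in at t within {0..}. norm (L2_norm (?d p q \<tau>)) \<le> L2_norm (?d V W \<tau>) + M * L2_norm (?d U V \<tau>)"
        proof eventually_elim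
          case (elim \<tau>)
          then have \<tau>: "\<tau> \<ge> 0" by simp
          have "L2_norm (\<lambda>\<xi>. \<theta> \<xi> * ?d V W \<tau> \<xi> - \<theta> \<xi> * \<nu> \<xi> * ?d U V \<tau> \<xi>)
            \<le> 1 * L2_norm (?d V W \<tau>) + M * L2_norm (?d U V \<tau>) + 0 * L2_norm (?d U V \<tau>)"
            by (rule comb(1)[OF d d]) (use \<tau> t U V W in auto)
          then show ?case unfolding pq by (simp add: L2_norm_nonneg)
        qed
        have "((\<lambda>\<tau>. L2_norm (?d V W \<tau>) + M * L2_norm (?d U V \<tau>)) \<longlongrightarrow> 0 + M * 0) (at t within {0..})"
          by (intro tendsto_intros VW UV t)
        then show "((\<lambda>\<tau>. L2_norm (?d V W \<tau>) + M * L2_norm (?d U V \<tau>)) \<longlongrightarrow> 0) (at t within {0..})" by simp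
      qed
    next
      fix t :: real assume "t > 0"
      show "AE \<xi> in lborel. q t \<xi> = \<theta> \<xi> * \<mu> \<xi> * p t \<xi>"
        using eq[OF \<open>t > 0\<close>]
      proof eventually_elim
        case (elim \<xi>)
        have "\<theta> \<xi> = 0 \<or> \<theta> \<xi> = 1" by (auto simp: \<theta>_def indicator_def)
        then have "\<theta> \<xi> * \<mu> \<xi> * p t \<xi> = \<theta> \<xi> * (\<mu> \<xi> * (V t \<xi> - \<nu> \<xi> * U t \<xi>))"
          unfolding p_def by (elim disjE) simp_all
        then show ?case unfolding q_def elim by (simp add: algebra_simps)
      qed
    qed measurable
    then show ?thesis
      by eventually_elim (auto simp: p_def \<theta>_def)
  qed
  then have "AE \<xi> in lborel. \<forall>m::nat. norm \<xi> \<le> real m \<longrightarrow> V T \<xi> - \<nu> \<xi> * U T \<xi> = exp (\<mu> \<xi> * complex_of_real T) * (V 0 \<xi> - \<nu> \<xi> * U 0 \<xi>)"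
    unfolding AE_all_countable by blast
  then show ?thesis
    by eventually_elim (meson real_arch_simple)
qed

section \<open>Pointwise estimates at low and high frequencies\<close>

text \<open>The damping rate \<open>a\<close> in \<open>y'' + 2 a y' + r\<^sup>2 y = 0\<close>, the equation divided by \<open>1 + r\<^sup>2\<close>.\<close>

definition damp :: "real \<Rightarrow> real" where
  "damp r = 1 / (2 * (1 + r\<^sup>2))"

text \<open>A square root of \<open>(damp r)\<^sup>2 - r\<^sup>2\<close> with nonnegative real part: real in the overdamped range of low
  frequencies, imaginary in the oscillating range.\<close>

definition osc :: "real \<Rightarrow> complex" where
  "osc r = (if r \<le> damp r then complex_of_real (sqrt ((damp r)\<^sup>2 - r\<^sup>2))
            else \<i> * complex_of_real (sqrt (r\<^sup>2 - (damp r)\<^sup>2)))"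

text \<open>For \<open>s = 1\<close> and \<open>s = -1\<close> these are the two roots of \<open>z\<^sup>2 + 2 a z + r\<^sup>2\<close> with \<open>a = damp r\<close>.\<close>

definition char_root :: "complex \<Rightarrow> real \<Rightarrow> complex" where
  "char_root s r = - complex_of_real (damp r) + s * osc r"

lemma damp_pos: "0 < damp r"
  by (simp add: damp_def add_pos_nonneg)

lemma damp_le_half: "damp r \<le> 1 / 2"
  by (simp add: damp_def divide_simps add_pos_nonneg)

lemma osc_square:
  assumes "r \<ge> 0"
  shows "osc r * osc r = complex_of_real ((damp r)\<^sup>2 - r\<^sup>2)"
proof (cases "r \<le> damp r")
  case True
  then have "r\<^sup>2 \<le> (damp r)\<^sup>2" using assms by (intro power_mono)
  then show ?thesis using True by (simp add: osc_def flip: of_real_mult)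
next
  case False
  then have "(damp r)\<^sup>2 \<le> r\<^sup>2" using damp_pos[of r] by (intro power_mono) auto
  then have "sqrt (r\<^sup>2 - (damp r)\<^sup>2) * sqrt (r\<^sup>2 - (damp r)\<^sup>2) = r\<^sup>2 - (damp r)\<^sup>2" by simp
  then have "complex_of_real (sqrt (r\<^sup>2 - (damp r)\<^sup>2)) * complex_of_real (sqrt (r\<^sup>2 - (damp r)\<^sup>2)) = complex_of_real (r\<^sup>2 - (damp r)\<^sup>2)"
    by (metis of_real_mult)
  then show ?thesis using False by (simp add: osc_def algebra_simps)
qed

lemma norm_osc_le:
  assumes "r \<ge> 0"
  shows "norm (osc r) \<le> 1 + r"
proof (cases "r \<le> damp r")
  case True
  have "sqrt ((damp r)\<^sup>2 - r\<^sup>2) \<le> sqrt ((damp r)\<^sup>2)" by (intro real_sqrt_le_mono) simp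
  moreover have "r\<^sup>2 \<le> (damp r)\<^sup>2" using True assms by (intro power_mono)
  ultimately show ?thesis
    using True damp_pos[of r] damp_le_half[of r] assms by (simp add: osc_def)
next
  case False
  have "sqrt (r\<^sup>2 - (damp r)\<^sup>2) \<le> sqrt (r\<^sup>2)" by (intro real_sqrt_le_mono) simp
  moreover have "(damp r)\<^sup>2 \<le> r\<^sup>2" using False damp_pos[of r] by (intro power_mono) auto
  ultimately show ?thesis using False assms by (simp add: osc_def norm_mult)
qed

lemma char_root_sum: "char_root 1 r + char_root (-1) r = - complex_of_real (2 * damp r)"
  by (simp add: char_root_def)

lemma char_root_prod:
  assumes "r \<ge> 0"
  shows "char_root 1 r * char_root (-1) r = complex_of_real (r\<^sup>2)"
proof -
  have "char_root 1 r * char_root (-1) r = complex_of_real ((damp r)\<^sup>2) - osc r * osc r"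
    by (simp add: char_root_def algebra_simps power2_eq_square)
  then show ?thesis using osc_square[OF assms] by simp
qed

lemma norm_char_root_le:
  assumes "r \<ge> 0" "norm s = 1"
  shows "norm (char_root s r) \<le> 2 + r"
proof -
  have "norm (char_root s r) \<le> damp r + norm (osc r)"
    unfolding char_root_def using assms damp_pos[of r]
    by (intro order_trans[OF norm_triangle_ineq]) (simp add: norm_mult)
  then show ?thesis using norm_osc_le[OF assms(1)] damp_le_half[of r] by linarith
qed

lemma char_root_measurable [measurable]: "char_root s \<in> borel_measurable borel"
proof -
  have [measurable]: "damp \<in> borel_measurable borel" unfolding damp_def[abs_def] by measurable
  have [measurable]: "osc \<in> borel_measurable borel" unfolding osc_def[abs_def] by measurable
  show ?thesis unfolding char_root_def[abs_def] by measurable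
qed

lemma exp_diff_le:
  assumes "Re w \<le> Re z"
  shows "norm (exp z - exp w) \<le> norm (z - w) * exp (Re z)"
proof -
  have "norm (exp (z - w) - (\<Sum>i\<le>0. (z - w) ^ i / fact i)) \<le> exp \<bar>Re (z - w)\<bar> * norm (z - w) ^ Suc 0 / fact 0"
    by (rule Taylor_exp)
  then have "norm (exp (z - w) - 1) \<le> exp (Re z - Re w) * norm (z - w)" using assms by simp
  then have "exp (Re w) * norm (exp (z - w) - 1) \<le> exp (Re w) * (exp (Re z - Re w) * norm (z - w))"
    by (intro mult_left_mono) auto
  moreover have "exp z - exp w = exp w * (exp (z - w) - 1)"
    by (simp add: algebra_simps flip: exp_add)
  moreover have "exp (Re w) * (exp (Re z - Re w) * norm (z - w)) = norm (z - w) * exp (Re z)"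
    by (simp add: exp_diff)
  ultimately show ?thesis by (simp only: norm_mult norm_exp_eq_Re)
qed

lemma t_exp_le: "t * exp (- (t / 8)) \<le> 16 * exp (- (t / 16))" for t :: real
proof -
  have "t / 16 \<le> exp (t / 16)" using exp_ge_add_one_self[of "t / 16"] by linarith
  then have "t * exp (- (t / 8)) \<le> (16 * exp (t / 16)) * exp (- (t / 8))" by (intro mult_right_mono) auto
  also have "\<dots> = 16 * exp (- (t / 16))" by (simp flip: exp_add)
  finally show ?thesis .
qed

abbreviation mode :: "complex \<Rightarrow> real \<Rightarrow> real \<Rightarrow> complex" where
  "mode s r t \<equiv> exp (char_root s r * complex_of_real t)"

text \<open>The fundamental solution with data \<open>(0, 1)\<close>; the one with data \<open>(1, 0)\<close> is
  \<open>mode 1 r t - char_root 1 r * fund r t\<close>.\<close>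

definition fund :: "real \<Rightarrow> real \<Rightarrow> complex" where
  "fund r t = (mode 1 r t - mode (-1) r t) / (2 * osc r)"

lemma solution_via_fund:
  assumes "osc r \<noteq> 0"
    and "2 * osc r * y = mode 1 r t * (y1 - char_root (-1) r * y0)
                        - mode (-1) r t * (y1 - char_root 1 r * y0)"
  shows "y = y1 * fund r t + y0 * (mode 1 r t - char_root 1 r * fund r t)"
proof -
  let ?p = "mode 1 r t" and ?m = "mode (-1) r t"
  have f: "2 * osc r * fund r t = ?p - ?m" using assms(1) by (simp add: fund_def)
  have "2 * osc r * (y1 * fund r t + y0 * (?p - char_root 1 r * fund r t))
      = y1 * (?p - ?m) + y0 * (2 * osc r * ?p - char_root 1 r * (?p - ?m))"
    unfolding f[symmetric] by (simp add: algebra_simps)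
  also have "2 * osc r * ?p = (char_root 1 r - char_root (-1) r) * ?p" by (simp add: char_root_def)
  also have "y1 * (?p - ?m) + y0 * ((char_root 1 r - char_root (-1) r) * ?p - char_root 1 r * (?p - ?m)) = 2 * osc r * y"
    unfolding assms(2) by (simp add: algebra_simps)
  finally show ?thesis using assms(1) by simp
qed

lemma Re_osc:
  assumes "0 \<le> r" "r \<le> 1"
  shows "0 \<le> Re (osc r)" "r\<^sup>2 / 4 \<le> damp r - Re (osc r)" "1 / 4 \<le> damp r"
proof -
  have "r\<^sup>2 \<le> 1" using assms by (simp add: power_le_one)
  then show d: "1 / 4 \<le> damp r"
    unfolding damp_def by (simp add: divide_simps add_pos_nonneg)
  show "0 \<le> Re (osc r)"
  proof (cases "r \<le> damp r")
    case True
    then have "r\<^sup>2 \<le> (damp r)\<^sup>2" using assms by (intro power_mono)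
    then show ?thesis using True by (simp add: osc_def)
  qed (simp add: osc_def)
  show "r\<^sup>2 / 4 \<le> damp r - Re (osc r)"
  proof (cases "r \<le> damp r")
    case True
    define x where "x = sqrt ((damp r)\<^sup>2 - r\<^sup>2)"
    have "r\<^sup>2 \<le> (damp r)\<^sup>2" using True assms by (intro power_mono)
    then have x2: "x\<^sup>2 = (damp r)\<^sup>2 - r\<^sup>2" "x \<ge> 0" unfolding x_def by simp_all
    have "x \<le> damp r"
      by (rule power2_le_imp_le) (use x2 damp_pos[of r] in auto)
    then have "(damp r - x) * (damp r + x) \<le> (damp r - x) * 1"
      using damp_le_half[of r] by (intro mult_left_mono) auto
    moreover have "(damp r - x) * (damp r + x) = r\<^sup>2" using x2 by (simp add: algebra_simps power2_eq_square)
    ultimately have "r\<^sup>2 \<le> damp r - x" by simp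
    then have "r\<^sup>2 / 4 \<le> damp r - x" using zero_le_power2[of r] by linarith
    then show ?thesis using True by (simp add: osc_def x_def)
  next
    case False
    then show ?thesis using d \<open>r\<^sup>2 \<le> 1\<close> by (simp add: osc_def)
  qed
qed

text \<open>Near the double root and in the oscillating range the quotient in \<open>fund\<close> is controlled by the mean value theorem at the price of a
  factor \<open>t\<close>; the real part of \<open>osc r\<close> is less than half the damping rate there, and the remaining
  exponential decay absorbs the factor. Elsewhere the denominator is bounded below.\<close>

lemma norm_fund_le:
  assumes r: "0 \<le> r" "r \<le> 1" and t: "t \<ge> 0" and o: "osc r \<noteq> 0"
  shows "norm (fund r t) \<le> 16 * exp (- (r\<^sup>2 * t / 16))"
proof -
  note R = Re_osc[OF r]
  let ?p = "char_root 1 r * complex_of_real t" and ?m = "char_root (-1) r * complex_of_real t"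
  have Re: "Re ?p = - ((damp r - Re (osc r)) * t)" "Re ?m = - ((damp r + Re (osc r)) * t)"
    by (simp_all add: char_root_def algebra_simps)
  have le: "Re ?m \<le> Re ?p" unfolding Re using R t by (simp add: mult_right_mono)
  have r2: "r\<^sup>2 \<le> 1" using r by (simp add: power_le_one)
  have rt: "0 \<le> r\<^sup>2 * t" using t by simp
  show ?thesis
  proof (cases "Re (osc r) \<ge> damp r / 2")
    case True
    have d: "1 / 8 \<le> norm (osc r)"
      using True R(3) complex_Re_le_cmod[of "osc r"] by linarith
    have "norm (exp ?p - exp ?m) \<le> norm (exp ?p) + norm (exp ?m)" by (rule norm_triangle_ineq4)
    also have "\<dots> \<le> 2 * exp (Re ?p)" using le by (simp only: norm_exp_eq_Re) simp
    also have "Re ?p \<le> - (r\<^sup>2 * t / 16)"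
      unfolding Re using mult_right_mono[OF R(2) t] rt by simp
    finally have "norm (exp ?p - exp ?m) \<le> 2 * exp (- (r\<^sup>2 * t / 16))" by simp
    then have "norm (fund r t) \<le> 2 * exp (- (r\<^sup>2 * t / 16)) / (2 * (1 / 8))"
      unfolding fund_def norm_divide norm_mult using d by (intro frac_le) auto
    also have "\<dots> \<le> 16 * exp (- (r\<^sup>2 * t / 16))" by simp
    finally show ?thesis .
  next
    case False
    have "norm (exp ?p - exp ?m) \<le> norm (?p - ?m) * exp (Re ?p)" by (rule exp_diff_le[OF le])
    also have "?p - ?m = 2 * osc r * complex_of_real t" by (simp add: char_root_def algebra_simps)
    also have "norm \<dots> * exp (Re ?p) = norm (2 * osc r) * (t * exp (Re ?p))" using t by (simp add: norm_mult)
    finally have "norm (fund r t) \<le> t * exp (Re ?p)"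
      unfolding fund_def norm_divide using o by (simp add: divide_le_eq mult.commute)
    also have "\<dots> \<le> t * exp (- (t / 8))"
    proof -
      have "1 / 8 * t \<le> (damp r - Re (osc r)) * t" using False R(3) by (intro mult_right_mono t) linarith
      then show ?thesis unfolding Re using t by (intro mult_left_mono) auto
    qed
    also have "\<dots> \<le> 16 * exp (- (t / 16))" by (rule t_exp_le)
    also have "\<dots> \<le> 16 * exp (- (r\<^sup>2 * t / 16))" using mult_right_mono[OF r2 t] by simp
    finally show ?thesis .
  qed
qed

text \<open>The asymptotic profile as a function of \<open>r = \<bar>\<xi>\<bar>\<close> and of the values \<open>y0\<close>, \<open>y1\<close> of the transformed data.\<close>

definition profile_at :: "complex \<Rightarrow> complex \<Rightarrow> real \<Rightarrow> real \<Rightarrow> complex" where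
  "profile_at y0 y1 t r = y1 * complex_of_real (exp (- t / (2 * r\<^sup>2)) * (sin (t * r) / r))
    + y0 * complex_of_real (exp (- t / (2 * r\<^sup>2)) * cos (t * r))"

text \<open>At low frequencies no cancellation is needed: the solution and the profile both decay at least like a heat kernel.\<close>

lemma low_frequency_bound:
  assumes r: "0 < r" "r \<le> 1" and t: "t \<ge> 0" and o: "osc r \<noteq> 0"
    and y: "y = y1 * fund r t + y0 * (mode 1 r t - char_root 1 r * fund r t)"
  shows "norm (y - profile_at y0 y1 t r) \<le> 80 * exp (- (r\<^sup>2 * t / 16)) * (norm y0 + norm y1)"
proof -
  have r': "0 \<le> r" using r by simp
  note R = Re_osc[OF r' r(2)]
  define E where "E = exp (- (r\<^sup>2 * t / 16))"
  have E0: "0 \<le> E" by (simp add: E_def)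
  have rt: "0 \<le> r\<^sup>2 * t" "r\<^sup>2 * t \<le> t" using t r mult_right_mono[of "r\<^sup>2" 1 t] by (auto simp: power_le_one)
  have f: "norm (fund r t) \<le> 16 * E" unfolding E_def by (rule norm_fund_le[OF r' r(2) t o])
  have p: "norm (mode 1 r t) \<le> E"
    unfolding norm_exp_eq_Re E_def using mult_right_mono[OF R(2) t] rt by (simp add: char_root_def algebra_simps)
  have "norm (char_root 1 r) \<le> 3" using norm_char_root_le[OF r', of 1] r by simp
  then have "norm (char_root 1 r * fund r t) \<le> 3 * (16 * E)" unfolding norm_mult by (intro mult_mono f) auto
  then have "norm (mode 1 r t - char_root 1 r * fund r t) \<le> 49 * E"
    using norm_triangle_ineq4[of "mode 1 r t" "char_root 1 r * fund r t"] p by linarith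
  then have y': "norm y \<le> norm y1 * (16 * E) + norm y0 * (49 * E)"
    unfolding y by (intro order_trans[OF norm_triangle_ineq] add_mono) (auto simp: norm_mult intro!: mult_left_mono f)
  have e: "exp (- t / (2 * r\<^sup>2)) \<le> exp (- (t / 8))"
  proof -
    have "r\<^sup>2 \<le> 1" using r by (simp add: power_le_one)
    then have "t / 8 \<le> t / (2 * r\<^sup>2)" using t r by (intro frac_le) auto
    then show ?thesis by simp
  qed
  have "\<bar>sin (t * r) / r\<bar> \<le> t"
    using abs_sin_x_le_abs_x[of "t * r"] t r by (simp add: abs_mult divide_le_eq)
  then have "\<bar>exp (- t / (2 * r\<^sup>2)) * (sin (t * r) / r)\<bar> \<le> exp (- (t / 8)) * t"
    unfolding abs_mult by (intro mult_mono) (use e in auto)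
  also have "\<dots> \<le> 16 * exp (- (t / 16))" using t_exp_le[of t] by (simp add: mult.commute)
  also have "\<dots> \<le> 16 * E" unfolding E_def using rt by simp
  finally have 1: "\<bar>exp (- t / (2 * r\<^sup>2)) * (sin (t * r) / r)\<bar> \<le> 16 * E" .
  have "\<bar>exp (- t / (2 * r\<^sup>2)) * cos (t * r)\<bar> \<le> exp (- (t / 8)) * 1"
    unfolding abs_mult by (intro mult_mono) (use e in auto)
  also have "\<dots> \<le> E"
  proof -
    have "r\<^sup>2 * t / 16 \<le> t / 8" using rt t by linarith
    then show ?thesis unfolding E_def by simp
  qed
  finally have 2: "\<bar>exp (- t / (2 * r\<^sup>2)) * cos (t * r)\<bar> \<le> E" .
  have "norm (profile_at y0 y1 t r) \<le> norm y1 * (16 * E) + norm y0 * E"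
    unfolding profile_at_def
    by (intro order_trans[OF norm_triangle_ineq] add_mono; simp only: norm_mult norm_of_real)
       (intro mult_left_mono 1 2; simp)+
  then have "norm (y - profile_at y0 y1 t r) \<le> (norm y1 * (16 * E) + norm y0 * (49 * E)) + (norm y1 * (16 * E) + norm y0 * E)"
    using norm_triangle_ineq4[of y "profile_at y0 y1 t r"] y' by linarith
  also have "\<dots> \<le> 80 * E * (norm y0 + norm y1)"
    using mult_nonneg_nonneg[OF norm_ge_zero[of y1] E0] mult_nonneg_nonneg[OF norm_ge_zero[of y0] E0]
    by (simp add: algebra_simps)
  finally show ?thesis unfolding E_def .
qed

text \<open>For \<open>r \<ge> 1\<close> the roots are \<open>- damp r \<plusminus> i b\<close>, and \<open>r - b = (damp r)\<^sup>2 / (r + b)\<close> is small because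
  \<open>damp r\<close> is of order \<open>r\<^sup>-\<^sup>2\<close>.\<close>

lemma fund_high:
  assumes r: "1 \<le> r"
  defines "b \<equiv> sqrt (r\<^sup>2 - (damp r)\<^sup>2)"
  shows "osc r \<noteq> 0" and "b \<ge> r / 2" and "b \<le> r" and "r - b \<le> 1 / (4 * r ^ 5)"
    and "fund r t = complex_of_real (exp (- (damp r * t)) * (sin (b * t) / b))"
    and "mode 1 r t - char_root 1 r * fund r t
       = complex_of_real (exp (- (damp r * t)) * cos (b * t) + damp r * (exp (- (damp r * t)) * (sin (b * t) / b)))"
proof -
  have r0: "r > 0" using r by simp
  have dr: "damp r \<le> 1 / (2 * r\<^sup>2)"
    unfolding damp_def using r by (intro frac_le) auto
  have d: "\<not> r \<le> damp r" using damp_le_half[of r] r by linarith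
  have d2: "(damp r)\<^sup>2 \<le> (1 / 2)\<^sup>2" using damp_pos[of r] damp_le_half[of r] by (intro power_mono) auto
  have "1 \<le> r\<^sup>2" using r by simp
  then have "(r / 2)\<^sup>2 \<le> r\<^sup>2 - (damp r)\<^sup>2" using d2 by (simp add: power_divide)
  then show b: "b \<ge> r / 2" unfolding b_def by (rule real_le_rsqrt)
  show br: "b \<le> r" unfolding b_def using r by (intro real_le_lsqrt) auto
  have b0: "b > 0" using b r0 by linarith
  have b2: "b * b = r\<^sup>2 - (damp r)\<^sup>2"
    unfolding b_def using order_trans[OF zero_le_power2 \<open>(r / 2)\<^sup>2 \<le> r\<^sup>2 - (damp r)\<^sup>2\<close>]
    by (rule real_sqrt_mult_self[THEN trans, OF abs_of_nonneg])
  have o: "osc r = \<i> * complex_of_real b" using d by (simp add: osc_def b_def)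
  show "osc r \<noteq> 0" using o b0 by simp
  have "(r - b) * r \<le> (r - b) * (r + b)" using br b0 by (intro mult_left_mono) auto
  also have "\<dots> = (damp r)\<^sup>2" using b2 by (simp add: algebra_simps power2_eq_square)
  also have "\<dots> \<le> (1 / (2 * r\<^sup>2))\<^sup>2" using dr damp_pos[of r] by (intro power_mono) auto
  also have "\<dots> = 1 / (4 * r ^ 4)" by (simp add: power_divide power_mult_distrib flip: power_mult)
  finally have "(r - b) * r \<le> 1 / (4 * r ^ 4)" .
  then have "r - b \<le> 1 / (4 * r ^ 4) / r" using r0 by (subst pos_le_divide_eq)
  also have "\<dots> = 1 / (4 * r ^ 5)" by (simp add: eval_nat_numeral)
  finally show "r - b \<le> 1 / (4 * r ^ 5)" .
  let ?e = "complex_of_real (exp (- (damp r * t)))"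
  have p: "mode 1 r t = ?e * (complex_of_real (cos (b * t)) + \<i> * complex_of_real (sin (b * t)))"
  proof -
    have "char_root 1 r * complex_of_real t = complex_of_real (- (damp r * t)) + \<i> * complex_of_real (b * t)"
      by (simp add: char_root_def o algebra_simps)
    then show ?thesis
      by (simp only: exp_add exp_of_real cis_conv_exp[symmetric]) (simp add: complex_eq_iff)
  qed
  have m: "mode (-1) r t = ?e * (complex_of_real (cos (b * t)) - \<i> * complex_of_real (sin (b * t)))"
  proof -
    have "char_root (-1) r * complex_of_real t = complex_of_real (- (damp r * t)) + \<i> * complex_of_real (- (b * t))"
      by (simp add: char_root_def o algebra_simps)
    then show ?thesis
      by (simp only: exp_add exp_of_real cis_conv_exp[symmetric]) (simp add: complex_eq_iff)
  qed
  have "mode 1 r t - mode (-1) r t = 2 * osc r * complex_of_real (exp (- (damp r * t)) * (sin (b * t) / b))"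
    unfolding p m o using b0 by (simp add: algebra_simps)
  then show f: "fund r t = complex_of_real (exp (- (damp r * t)) * (sin (b * t) / b))"
    unfolding fund_def using \<open>osc r \<noteq> 0\<close> by simp
  show "mode 1 r t - char_root 1 r * fund r t
       = complex_of_real (exp (- (damp r * t)) * cos (b * t) + damp r * (exp (- (damp r * t)) * (sin (b * t) / b)))"
  proof -
    define S where "S = exp (- (damp r * t)) * (sin (b * t) / b)"
    have "b * S = exp (- (damp r * t)) * sin (b * t)" using b0 by (simp add: S_def)
    then have bS: "complex_of_real b * complex_of_real S = ?e * complex_of_real (sin (b * t))"
      by (simp only: of_real_mult[symmetric])
    have "char_root 1 r * complex_of_real S = - complex_of_real (damp r) * complex_of_real S + \<i> * (complex_of_real b * complex_of_real S)"
      by (simp add: char_root_def o algebra_simps)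
    then show ?thesis
      unfolding p f S_def[symmetric] bS by (simp add: algebra_simps)
  qed
qed

lemma abs_exp_diff_le: "\<bar>exp (- x) - exp (- y)\<bar> \<le> (y - x) * exp (- x)" if "x \<le> y" for x y :: real
proof -
  have "1 + (x - y) \<le> exp (x - y)" by (rule exp_ge_add_one_self)
  then have "exp (- x) * (1 + (x - y)) \<le> exp (- x) * exp (x - y)" by (intro mult_left_mono) auto
  also have "\<dots> = exp (- y)" by (simp flip: exp_add)
  finally have "exp (- x) - exp (- y) \<le> (y - x) * exp (- x)" by (simp add: algebra_simps)
  moreover have "exp (- y) \<le> exp (- x)" using that by simp
  ultimately show ?thesis by simp
qed

lemma abs_cos_diff_le: "\<bar>cos x - cos y\<bar> \<le> \<bar>x - y\<bar>" for x y :: real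
proof -
  have "\<bar>cos x - cos y\<bar> = 2 * \<bar>sin ((x + y) / 2)\<bar> * \<bar>sin ((y - x) / 2)\<bar>"
    by (simp add: cos_diff_cos abs_mult)
  also have "\<dots> \<le> 2 * 1 * \<bar>(y - x) / 2\<bar>" by (intro mult_mono abs_sin_x_le_abs_x) auto
  finally show ?thesis by simp
qed

lemma abs_sin_diff_le: "\<bar>sin x - sin y\<bar> \<le> \<bar>x - y\<bar>" for x y :: real
proof -
  have "\<bar>sin x - sin y\<bar> = 2 * \<bar>sin ((x - y) / 2)\<bar> * \<bar>cos ((x + y) / 2)\<bar>"
    by (simp add: sin_diff_sin abs_mult)
  also have "\<dots> \<le> 2 * \<bar>(x - y) / 2\<bar> * 1" by (intro mult_mono abs_sin_x_le_abs_x) auto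
  finally show ?thesis by simp
qed

text \<open>At high frequencies the damping rates \<open>damp r\<close> and \<open>1 / (2 r\<^sup>2)\<close> differ by \<open>O(r\<^sup>-\<^sup>4)\<close> and the phase speeds
  \<open>b\<close> and \<open>r\<close> by \<open>O(r\<^sup>-\<^sup>5)\<close>.\<close>

lemma high_frequency_difference:
  assumes r: "1 \<le> r" and t: "t \<ge> 1"
    and y: "y = y1 * fund r t + y0 * (mode 1 r t - char_root 1 r * fund r t)"
  shows "norm (y - profile_at y0 y1 t r)
     \<le> exp (- (t / (4 * r\<^sup>2))) * (2 * t / r ^ 5 * norm y1 + (t / r ^ 4 + 1 / r ^ 3) * norm y0)"
proof -
  define b where "b = sqrt (r\<^sup>2 - (damp r)\<^sup>2)"
  note H = fund_high[OF r, folded b_def]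
  have r0: "r > 0" and b0: "b > 0" using r H(2) by auto
  define a where "a = damp r"
  define al where "al = 1 / (2 * r\<^sup>2)"
  have r2: "1 \<le> r\<^sup>2" using r by simp
  have a1: "a \<le> al" unfolding a_def al_def damp_def using r by (intro frac_le) auto
  have a2: "1 / (4 * r\<^sup>2) \<le> a" unfolding a_def damp_def using r2 by (intro frac_le) auto
  have a3: "al - a \<le> 1 / (2 * r ^ 4)"
  proof -
    have "al - a = 1 / (2 * r\<^sup>2 * (1 + r\<^sup>2))"
    proof -
      have "1 + r\<^sup>2 \<noteq> 0" "r\<^sup>2 \<noteq> 0" using r2 by auto
      then show ?thesis
        unfolding al_def a_def damp_def by (simp add: divide_simps)
    qed
    also have "\<dots> \<le> 1 / (2 * r ^ 4)"
      using r0 by (intro frac_le) (auto simp: eval_nat_numeral algebra_simps)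
    finally show ?thesis .
  qed
  define e el where "e = exp (- (a * t))" and "el = exp (- (al * t))"
  have e0: "0 < e" "0 < el" by (simp_all add: e_def el_def)
  have ee: "e \<le> exp (- (t / (4 * r\<^sup>2)))"
    unfolding e_def using mult_right_mono[OF a2, of t] t by simp
  have ediff: "\<bar>e - el\<bar> \<le> t / (2 * r ^ 4) * e"
  proof -
    have "\<bar>e - el\<bar> \<le> (al * t - a * t) * e"
      unfolding e_def el_def using a1 t by (intro abs_exp_diff_le mult_right_mono) auto
    also have "\<dots> = ((al - a) * t) * e" by (simp add: algebra_simps)
    also have "\<dots> \<le> (1 / (2 * r ^ 4) * t) * e"
      using e0 t by (intro mult_right_mono a3) auto
    finally show ?thesis by simp
  qed
  have rb: "\<bar>b * t - t * r\<bar> \<le> t / (4 * r ^ 5)"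
  proof -
    have "\<bar>b * t - t * r\<bar> = (r - b) * t"
      using H(3) t by (simp add: algebra_simps abs_if not_less)
    also have "\<dots> \<le> (1 / (4 * r ^ 5)) * t" using H(4) t by (intro mult_right_mono) auto
    finally show ?thesis by simp
  qed
  have p54: "1 / r ^ 5 \<le> 1 / r ^ 4" using r by (intro frac_le power_increasing) auto
  have p65: "1 / r ^ 6 \<le> 1 / r ^ 5" using r by (intro frac_le power_increasing) auto
  have p75: "1 / r ^ 7 \<le> 1 / r ^ 5" using r by (intro frac_le power_increasing) auto
  define C1 where "C1 = e * cos (b * t)"
  define S1 where "S1 = e * (sin (b * t) / b)"
  have cosd: "\<bar>C1 - el * cos (t * r)\<bar> \<le> e * (t / r ^ 4)"
  proof -
    have "C1 - el * cos (t * r) = e * (cos (b * t) - cos (t * r)) + (e - el) * cos (t * r)"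
      by (simp add: C1_def algebra_simps)
    also have "\<bar>\<dots>\<bar> \<le> e * \<bar>cos (b * t) - cos (t * r)\<bar> + \<bar>e - el\<bar> * \<bar>cos (t * r)\<bar>"
      using e0 by (intro order_trans[OF abs_triangle_ineq]) (simp add: abs_mult)
    also have "\<dots> \<le> e * (t / (4 * r ^ 5)) + (t / (2 * r ^ 4) * e) * 1"
      using e0 t by (intro add_mono mult_mono ediff order_trans[OF abs_cos_diff_le rb]) (auto)
    also have "t / (4 * r ^ 5) \<le> t / (4 * r ^ 4)"
      using mult_left_mono[OF p54, of "t / 4"] t by simp
    finally have "\<bar>C1 - el * cos (t * r)\<bar> \<le> e * (t / (4 * r ^ 4)) + t / (2 * r ^ 4) * e * 1"
      using e0 by simp
    also have "\<dots> = e * (3 / 4 * (t / r ^ 4))" by (simp add: field_simps)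
    also have "\<dots> \<le> e * (t / r ^ 4)"
    proof -
      have "0 \<le> t / r ^ 4" using t r0 by simp
      then have "3 / 4 * (t / r ^ 4) \<le> t / r ^ 4" by linarith
      then show ?thesis using e0 by (intro mult_left_mono) auto
    qed
    finally show ?thesis .
  qed
  have sind: "\<bar>S1 - el * (sin (t * r) / r)\<bar> \<le> e * (2 * t / r ^ 5)"
  proof -
    have ib: "1 / b \<le> 2 / r" using H(2) r0 b0 by (simp add: field_simps)
    have "S1 - el * (sin (t * r) / r) = e * ((sin (b * t) - sin (t * r)) * (1 / b))
        + e * (sin (t * r) * ((r - b) * (1 / b) * (1 / r))) + (e - el) * (sin (t * r) * (1 / r))"
      using r0 b0 by (simp add: S1_def field_simps)
    also have "\<bar>\<dots>\<bar> \<le> e * (\<bar>sin (b * t) - sin (t * r)\<bar> * (1 / b))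
        + e * (\<bar>sin (t * r)\<bar> * ((r - b) * (1 / b) * (1 / r))) + \<bar>e - el\<bar> * (\<bar>sin (t * r)\<bar> * (1 / r))"
      using e0 r0 b0 H(3) by (intro order_trans[OF abs_triangle_ineq] add_mono) (simp_all add: abs_mult)
    also have "\<dots> \<le> e * ((t / (4 * r ^ 5)) * (2 / r))
        + e * (1 * ((1 / (4 * r ^ 5)) * (2 / r) * (1 / r))) + (t / (2 * r ^ 4) * e) * (1 * (1 / r))"
      using e0 t r0 b0 H(3,4) ib
      by (intro add_mono mult_mono ediff order_trans[OF abs_sin_diff_le rb]) auto
    also have "\<dots> = e * (1 / 2 * (t * (1 / r ^ 6)) + 1 / 2 * (1 / r ^ 7) + 1 / 2 * (t * (1 / r ^ 5)))"
      by (simp add: eval_nat_numeral algebra_simps)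
    also have "\<dots> \<le> e * (1 / 2 * (t * (1 / r ^ 5)) + 1 / 2 * (t * (1 / r ^ 5)) + 1 / 2 * (t * (1 / r ^ 5)))"
    proof -
      have "1 * (1 / r ^ 7) \<le> t * (1 / r ^ 5)" using t r0 p75 by (intro mult_mono) auto
      moreover have "t * (1 / r ^ 6) \<le> t * (1 / r ^ 5)" using t p65 by (intro mult_left_mono) auto
      ultimately show ?thesis using e0 by (intro mult_left_mono) linarith+
    qed
    also have "\<dots> \<le> e * (2 * t / r ^ 5)" using e0 t r0 by (intro mult_left_mono) (auto simp: field_simps)
    finally show ?thesis .
  qed
  have aS: "\<bar>a * S1\<bar> \<le> e * (1 / r ^ 3)"
  proof -
    have "\<bar>a * S1\<bar> = e * (a * (\<bar>sin (b * t)\<bar> * (1 / b)))"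
      using e0 b0 damp_pos[of r] by (simp add: S1_def a_def abs_mult)
    also have "\<dots> \<le> e * (al * (1 * (2 / r)))"
    proof -
      have ib: "1 / b \<le> 2 / r" using H(2) r0 b0 by (simp add: field_simps)
      show ?thesis using e0 b0 r0 a1 damp_pos[of r] ib
        by (intro mult_left_mono mult_mono) (auto simp: a_def al_def)
    qed
    also have "\<dots> = e * (1 / r ^ 3)" by (simp add: al_def eval_nat_numeral)
    finally show ?thesis .
  qed
  have yd: "y - profile_at y0 y1 t r = y1 * complex_of_real (S1 - el * (sin (t * r) / r))
      + y0 * complex_of_real ((C1 - el * cos (t * r)) + a * S1)"
  proof -
    have "exp (- t / (2 * r\<^sup>2)) = el" by (simp add: el_def al_def)
    moreover have "fund r t = complex_of_real S1"
      "mode 1 r t - char_root 1 r * fund r t = complex_of_real (C1 + a * S1)"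
      unfolding H(6) unfolding H(5) by (simp_all add: S1_def C1_def e_def a_def)
    ultimately show ?thesis unfolding y profile_at_def by (simp add: algebra_simps)
  qed
  have "norm (y - profile_at y0 y1 t r) \<le> norm y1 * (e * (2 * t / r ^ 5)) + norm y0 * (e * (t / r ^ 4) + e * (1 / r ^ 3))"
    unfolding yd
    by (intro order_trans[OF norm_triangle_ineq] add_mono; simp only: norm_mult norm_of_real)
       (intro mult_left_mono order_trans[OF abs_triangle_ineq] add_mono sind cosd aS; simp)+
  also have "\<dots> = e * (2 * t / r ^ 5 * norm y1 + (t / r ^ 4 + 1 / r ^ 3) * norm y0)"
    by (simp add: algebra_simps)
  also have "\<dots> \<le> exp (- (t / (4 * r\<^sup>2))) * (2 * t / r ^ 5 * norm y1 + (t / r ^ 4 + 1 / r ^ 3) * norm y0)"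
    using t r0 by (intro mult_right_mono ee) auto
  finally show ?thesis .
qed

text \<open>The exchange of regularity for decay: with \<open>x = t / r\<^sup>2\<close> this bounds \<open>x\<^sup>p e\<^bsup>-x/4\<^esup>\<close>, by
  \<open>e\<^sup>y \<ge> y\<close> at \<open>y = x / (4 p)\<close> raised to the power \<open>p\<close>.\<close>

lemma exp_decay_powr:
  fixes p t r :: real
  assumes p: "p > 0" and t: "t > 0" and r: "r > 0"
  shows "exp (- (t / (4 * r\<^sup>2))) \<le> (4 * p) powr p * (r powr (2 * p) * t powr (- p))"
proof -
  define x where "x = t / r\<^sup>2"
  have x: "x > 0" unfolding x_def using t r by (intro divide_pos_pos zero_less_power)
  have "(x / (4 * p)) powr p \<le> exp (x / (4 * p)) powr p"
  proof (rule powr_mono2)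
    show "x / (4 * p) \<le> exp (x / (4 * p))" using exp_ge_add_one_self[of "x / (4 * p)"] by linarith
  qed (use p x in auto)
  also have "\<dots> = exp (x / 4)" using p by (simp add: powr_def)
  finally have "x powr p / (4 * p) powr p \<le> exp (x / 4)"
    using p x by (subst (asm) powr_divide) auto
  then have "x powr p * exp (- (x / 4)) \<le> (4 * p) powr p"
    using p by (simp add: exp_minus field_simps)
  moreover have "x powr p = t powr p / r powr (2 * p)"
    using t r by (simp add: x_def powr_divide powr_powr[symmetric] powr_numeral)
  ultimately have "t powr p / r powr (2 * p) * exp (- (x / 4)) \<le> (4 * p) powr p" by simp
  then show ?thesis using t r by (simp add: x_def powr_minus field_simps)
qed

text \<open>The exponent \<open>p = (l + 5) / 2\<close> serves the two terms with a factor \<open>t\<close> and \<open>p = (l + 4) / 2\<close> the term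
  \<open>r\<^sup>-\<^sup>3\<close> that stems from \<open>damp r * fund r t\<close>; for \<open>t \<ge> 1\<close> the latter decays faster.\<close>

lemma high_frequency_bound:
  fixes l r t :: real
  assumes r: "1 \<le> r" and t: "t \<ge> 1" and l: "l \<ge> 0"
    and y: "y = y1 * fund r t + y0 * (mode 1 r t - char_root 1 r * fund r t)"
  defines "K \<equiv> 2 * (2 * (l + 5)) powr ((l + 5) / 2) + (2 * (l + 4)) powr ((l + 4) / 2)"
  shows "norm (y - profile_at y0 y1 t r)
     \<le> K * t powr (- (l + 3) / 2) * (r powr l * norm y1 + r powr (l + 1) * norm y0)"
proof -
  define E where "E = exp (- (t / (4 * r\<^sup>2)))"
  define A B where "A = (2 * (l + 5)) powr ((l + 5) / 2)" and "B = (2 * (l + 4)) powr ((l + 4) / 2)"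
  define \<tau> where "\<tau> = t powr (- (l + 3) / 2)"
  have r0: "r > 0" and t0: "t > 0" using r t by auto
  have E1: "E \<le> A * (r powr (l + 5) * t powr (- ((l + 5) / 2)))"
  proof -
    have "E \<le> (4 * ((l + 5) / 2)) powr ((l + 5) / 2) * (r powr (2 * ((l + 5) / 2)) * t powr (- ((l + 5) / 2)))"
      unfolding E_def by (rule exp_decay_powr) (use l r0 t0 in auto)
    moreover have "4 * ((l + 5) / 2) = 2 * (l + 5)" "2 * ((l + 5) / 2) = l + 5" by simp_all
    ultimately show ?thesis unfolding A_def by (simp only:)
  qed
  have E2: "E \<le> B * (r powr (l + 4) * t powr (- ((l + 4) / 2)))"
  proof -
    have "E \<le> (4 * ((l + 4) / 2)) powr ((l + 4) / 2) * (r powr (2 * ((l + 4) / 2)) * t powr (- ((l + 4) / 2)))"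
      unfolding E_def by (rule exp_decay_powr) (use l r0 t0 in auto)
    moreover have "4 * ((l + 4) / 2) = 2 * (l + 4)" "2 * ((l + 4) / 2) = l + 4" by simp_all
    ultimately show ?thesis unfolding B_def by (simp only:)
  qed
  have tt: "t * t powr (- ((l + 5) / 2)) = \<tau>"
  proof -
    have "t powr 1 * t powr (- ((l + 5) / 2)) = t powr (1 + - ((l + 5) / 2))" by (simp only: powr_add)
    also have "1 + - ((l + 5) / 2) = - (l + 3) / 2" by (simp add: field_simps)
    finally show ?thesis using t0 by (simp add: \<tau>_def)
  qed
  have rr: "r powr (l + c) = r powr l * r powr c" for c by (rule powr_add)
  have rn: "r powr 5 = r ^ 5" "r powr 4 = r ^ 4" "r powr 1 = r"
    using r0 powr_realpow[of r 5] powr_realpow[of r 4] by simp_all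
  have "E * (t / r ^ 5) \<le> A * (r powr (l + 5) * t powr (- ((l + 5) / 2))) * (t / r ^ 5)"
    using t0 r0 by (intro mult_right_mono E1) auto
  also have "\<dots> = A * \<tau> * r powr l"
    unfolding tt[symmetric] rr rn using r0 by simp
  finally have 1: "E * (t / r ^ 5) \<le> A * \<tau> * r powr l" .
  have "E * (t / r ^ 4) = E * (t / r ^ 5) * r" using r0 by (simp add: eval_nat_numeral)
  also have "\<dots> \<le> A * \<tau> * r powr l * r" using 1 r0 by (intro mult_right_mono) auto
  finally have 2: "E * (t / r ^ 4) \<le> A * \<tau> * r powr (l + 1)" unfolding rr rn by (simp add: mult.assoc)
  have "E * (1 / r ^ 3) \<le> B * (r powr (l + 4) * t powr (- ((l + 4) / 2))) * (1 / r ^ 3)"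
    using r0 by (intro mult_right_mono E2) auto
  also have "\<dots> = B * r powr (l + 1) * t powr (- ((l + 4) / 2))"
    unfolding rr rn using r0 by (simp add: eval_nat_numeral)
  also have "\<dots> \<le> B * r powr (l + 1) * \<tau>"
  proof -
    have "(l + 3) / 2 \<le> (l + 4) / 2" by (intro divide_right_mono) auto
    then have "- ((l + 4) / 2) \<le> - (l + 3) / 2"
      unfolding minus_divide_left[symmetric] by (rule le_imp_neg_le)
    then show ?thesis unfolding \<tau>_def using t by (intro mult_left_mono powr_mono) (auto simp: B_def)
  qed
  finally have 3: "E * (1 / r ^ 3) \<le> B * \<tau> * r powr (l + 1)" by (simp add: mult_ac)
  have nn: "0 \<le> A" "0 \<le> B" "0 \<le> \<tau>" by (simp_all add: A_def B_def \<tau>_def)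
  have "norm (y - profile_at y0 y1 t r) \<le> E * (2 * t / r ^ 5 * norm y1 + (t / r ^ 4 + 1 / r ^ 3) * norm y0)"
    unfolding E_def by (rule high_frequency_difference[OF r t y])
  also have "\<dots> = 2 * (E * (t / r ^ 5)) * norm y1 + (E * (t / r ^ 4) + E * (1 / r ^ 3)) * norm y0"
    by (simp add: algebra_simps)
  also have "\<dots> \<le> 2 * (A * \<tau> * r powr l) * norm y1 + (A * \<tau> * r powr (l + 1) + B * \<tau> * r powr (l + 1)) * norm y0"
    using 1 2 3 by (intro add_mono mult_right_mono mult_left_mono) auto
  also have "\<dots> \<le> (2 * A + B) * \<tau> * (r powr l * norm y1 + r powr (l + 1) * norm y0)"
  proof -
    have "0 \<le> B * (\<tau> * (r powr l * norm y1))" "0 \<le> A * (\<tau> * (r powr (l + 1) * norm y0))"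
      using nn by simp_all
    then show ?thesis by (simp only: algebra_simps)
  qed
  finally show ?thesis unfolding K_def A_def B_def \<tau>_def .
qed

section \<open>The asymptotic profile\<close>

text \<open>The factorised equation gives \<open>v - \<nu> u\<close> and \<open>v - \<lambda> u\<close> at time \<open>t\<close> for the two roots \<open>\<lambda>\<close>, \<open>\<nu>\<close>; their
  difference \<open>(\<lambda> - \<nu>) u\<close> no longer contains the time derivative.\<close>

lemma cauchy_solution_fourier:
  fixes u\<^sub>0 u\<^sub>1 :: "'a::euclidean_space \<Rightarrow> complex"
  assumes u0: "u\<^sub>0 \<in> sobolev s\<^sub>0" and u1: "u\<^sub>1 \<in> sobolev s\<^sub>1" and sol: "cauchy_solution u\<^sub>0 u\<^sub>1 u" and t: "t > 0"
  shows "has_fourier_L2 (u t) (fourier (u t))"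
    and "AE \<xi> in lborel. 2 * osc (norm \<xi>) * fourier (u t) \<xi>
      = mode 1 (norm \<xi>) t * (fourier u\<^sub>1 \<xi> - char_root (-1) (norm \<xi>) * fourier u\<^sub>0 \<xi>)
      - mode (-1) (norm \<xi>) t * (fourier u\<^sub>1 \<xi> - char_root 1 (norm \<xi>) * fourier u\<^sub>0 \<xi>)"
    (is "AE \<xi> in lborel. ?solved \<xi>")
proof -
  obtain v w where uv: "has_sobolev_deriv 1 u v" and vw: "has_sobolev_deriv 1 v w"
    and init: "AE x in lborel. u 0 x = u\<^sub>0 x" "AE x in lborel. v 0 x = u\<^sub>1 x"
    and weak: "\<And>t \<phi>. t > 0 \<Longrightarrow> \<phi> \<in> test_functions \<Longrightarrow>
        (LINT x|lborel. (\<phi> x - laplacian \<phi> x) *\<^sub>R w t x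
          + (laplacian (laplacian \<phi>) x - laplacian \<phi> x) *\<^sub>R u t x + \<phi> x *\<^sub>R v t x) = 0"
    using sol unfolding cauchy_solution_def by blast
  have S: "u t \<in> sobolev 1" "v t \<in> sobolev 1" "w t \<in> sobolev 1" if "t \<ge> 0" for t
    using uv vw that by (auto simp: has_sobolev_deriv_def)
  show "has_fourier_L2 (u t) (fourier (u t))" using t by (intro sobolevD(1)[OF S(1)]) simp
  note L2 = S[THEN sobolevD(3)]
  have eq: "AE \<xi> in lborel. fourier (w t) \<xi>
      = (char_root 1 (norm \<xi>) + char_root (-1) (norm \<xi>)) * fourier (v t) \<xi> - char_root 1 (norm \<xi>) * char_root (-1) (norm \<xi>) * fourier (u t) \<xi>"
    if "t > 0" for t
  proof -
    have "t \<ge> 0" using that by simp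
    have "AE \<xi> in lborel. complex_of_real (1 + (norm \<xi>)\<^sup>2) * fourier (w t) \<xi>
       + complex_of_real ((norm \<xi>) ^ 4 + (norm \<xi>)\<^sup>2) * fourier (u t) \<xi> + fourier (v t) \<xi> = 0"
      by (rule cauchy_equation_fourier[OF S[OF \<open>t \<ge> 0\<close>, THEN sobolevD(1)] weak[OF that]])
    then show ?thesis
    proof eventually_elim
      case (elim \<xi>)
      define r where "r = norm \<xi>"
      define c where "c = complex_of_real (1 + r\<^sup>2)"
      have "1 + r\<^sup>2 \<noteq> 0" by (smt (verit) zero_le_power2)
      then have c: "c \<noteq> 0" unfolding c_def by (simp only: of_real_eq_0_iff not_False_eq_True)
      have "c * fourier (w t) \<xi> + complex_of_real (r\<^sup>2) * c * fourier (u t) \<xi> + fourier (v t) \<xi> = 0"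
        using elim by (simp add: c_def r_def algebra_simps eval_nat_numeral)
      then have "c * fourier (w t) \<xi> = c * (- (1 / c) * fourier (v t) \<xi> - complex_of_real (r\<^sup>2) * fourier (u t) \<xi>)"
        using c by (simp add: algebra_simps add_eq_0_iff)
      then have "fourier (w t) \<xi> = - (1 / c) * fourier (v t) \<xi> - complex_of_real (r\<^sup>2) * fourier (u t) \<xi>"
        using c by simp
      moreover have "char_root 1 r + char_root (-1) r = - (1 / c)"
      proof -
        have "2 * (1 / (2 * x)) = 1 / x" for x :: real by simp
        then have "2 * damp r = 1 / (1 + r\<^sup>2)" unfolding damp_def .
        then show ?thesis unfolding char_root_sum c_def by (simp only: of_real_divide of_real_1)
      qed
      ultimately show ?case
        using char_root_prod[of r] by (simp add: r_def)
    qed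
  qed
  have bd: "norm (char_root 1 (norm \<xi>)) \<le> 2 + norm \<xi>" "norm (char_root (-1) (norm \<xi>)) \<le> 2 + norm \<xi>" for \<xi> :: 'a
    by (rule norm_char_root_le; simp)+
  have m: "(\<lambda>\<xi>::'a. char_root s (norm \<xi>)) \<in> borel_measurable borel" for s by measurable
  have mono: "mono (\<lambda>x::real. 2 + x)" by (simp add: mono_def)
  note flow = characteristic_flow[where U = "\<lambda>t. fourier (u t)" and V = "\<lambda>t. fourier (v t)" and W = "\<lambda>t. fourier (w t)" and B = "\<lambda>x. 2 + x",
      OF L2 has_sobolev_deriv_fourier[OF uv] has_sobolev_deriv_fourier[OF vw]]
  have p: "AE \<xi> in lborel. fourier (v t) \<xi> - char_root (-1) (norm \<xi>) * fourier (u t) \<xi>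
      = mode 1 (norm \<xi>) t * (fourier (v 0) \<xi> - char_root (-1) (norm \<xi>) * fourier (u 0) \<xi>)"
    by (rule flow) (use eq m bd mono t in auto)
  have eq': "AE \<xi> in lborel. fourier (w t) \<xi>
      = (char_root (-1) (norm \<xi>) + char_root 1 (norm \<xi>)) * fourier (v t) \<xi> - char_root (-1) (norm \<xi>) * char_root 1 (norm \<xi>) * fourier (u t) \<xi>"
    if "t > 0" for t
    using eq[OF that] by (simp add: add.commute mult.commute[of "char_root (-1) _" "char_root 1 _"])
  have n: "AE \<xi> in lborel. fourier (v t) \<xi> - char_root 1 (norm \<xi>) * fourier (u t) \<xi>
      = mode (-1) (norm \<xi>) t * (fourier (v 0) \<xi> - char_root 1 (norm \<xi>) * fourier (u 0) \<xi>)"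
    by (rule flow) (use eq' m bd mono t in auto)
  have "AE \<xi> in lborel. fourier (u 0) \<xi> = fourier u\<^sub>0 \<xi>"
    by (rule fourier_eqI, rule has_fourier_L2_cong_AE_left[OF sobolevD(1)[OF u0] _ init(1)])
       (use L2_spaceD(1)[OF sobolevD(2)[OF S(1)[of 0]]] in simp)
  moreover have "AE \<xi> in lborel. fourier (v 0) \<xi> = fourier u\<^sub>1 \<xi>"
    by (rule fourier_eqI, rule has_fourier_L2_cong_AE_left[OF sobolevD(1)[OF u1] _ init(2)])
       (use L2_spaceD(1)[OF sobolevD(2)[OF S(2)[of 0]]] in simp)
  ultimately show "AE \<xi> in lborel. ?solved \<xi>"
    using p n
  proof eventually_elim
    case (elim \<xi>)
    have "2 * osc (norm \<xi>) * fourier (u t) \<xi> = (fourier (v t) \<xi> - char_root (-1) (norm \<xi>) * fourier (u t) \<xi>)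
        - (fourier (v t) \<xi> - char_root 1 (norm \<xi>) * fourier (u t) \<xi>)"
      by (simp add: char_root_def algebra_simps)
    then show ?case using elim by simp
  qed
qed

text \<open>\<open>damp\<close> is decreasing, so the two roots coincide at most on one sphere.\<close>

lemma AE_osc_nonzero: "AE \<xi> in lborel. osc (norm (\<xi> :: 'a::euclidean_space)) \<noteq> 0"
proof -
  have z: "r = damp r" if "r \<ge> 0" "osc r = 0" for r
  proof -
    have "(damp r)\<^sup>2 = r\<^sup>2" using osc_square[OF that(1)] that(2) by (simp only: mult_zero_left) (metis eq_iff_diff_eq_0 of_real_eq_0_iff)
    then show ?thesis using that(1) damp_pos[of r] by (simp add: power2_eq_iff_nonneg)
  qed
  have less: "False" if "0 \<le> r" "r < r'" "r = damp r" "r' = damp r'" for r r'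
  proof -
    have "r\<^sup>2 < r'\<^sup>2" using that by (intro power_strict_mono) auto
    then have "damp r' \<le> damp r" unfolding damp_def by (intro frac_le) (auto simp: add_pos_nonneg)
    then show False using that by simp
  qed
  obtain r0 where r0: "\<And>r. r \<ge> 0 \<Longrightarrow> osc r = 0 \<Longrightarrow> r = r0"
    by (metis z less linorder_neqE_linordered_idom)
  have "sphere (0::'a) r0 \<in> null_sets lborel"
    using negligible_sphere[of "0::'a" r0] by (simp add: negligible_iff_null_sets null_sets_completion_iff)
  then have "AE \<xi> in lborel. \<xi> \<notin> sphere (0::'a) r0" by (rule AE_not_in)
  then show ?thesis
    by eventually_elim (use r0 in force)
qed

lemma norm_fourier_le_L11:
  assumes "f \<in> L11_space"
  shows "norm (fourier f \<xi>) \<le> L11_norm f"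
proof -
  have f: "integrable lborel f" "integrable lborel (\<lambda>x. (1 + norm x) * norm (f x))"
    using assms by (auto simp: L11_space_def)
  have "norm (fourier f \<xi>) \<le> (LINT x|lborel. norm (f x))"
    using f(1) norm_fourier_integral_le[of f \<xi>] by (simp add: fourier_def)
  also have "\<dots> \<le> L11_norm f"
    unfolding L11_norm_def using f by (intro integral_mono) (auto simp: algebra_simps)
  finally show ?thesis .
qed

lemma L11_norm_nonneg: "0 \<le> L11_norm f"
  unfolding L11_norm_def by (intro Bochner_Integration.integral_nonneg) simp

text \<open>The heat kernel scaling, which is where the rate \<open>t\<^bsup>-n/4\<^esup>\<close> comes from.\<close>

lemma L2_norm_heat:
  assumes t: "t > 0"
  shows "(\<lambda>\<xi>::'a::euclidean_space. complex_of_real (exp (- ((norm \<xi>)\<^sup>2 * t / 16)))) \<in> L2_space"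
    and "L2_norm (\<lambda>\<xi>::'a. complex_of_real (exp (- ((norm \<xi>)\<^sup>2 * t / 16))))
      = sqrt (sqrt (8 * pi) ^ DIM('a)) * t powr (- real DIM('a) / 4)"
proof -
  have s: "sqrt (t / 4) > 0" using t by simp
  have sq: "(norm (complex_of_real (exp (- ((norm \<xi>)\<^sup>2 * t / 16)))))\<^sup>2 = gauss (sqrt (t / 4)) \<xi>" for \<xi> :: 'a
    using t by (simp add: gauss_eq power2_eq_square algebra_simps flip: exp_add)
  show "(\<lambda>\<xi>::'a. complex_of_real (exp (- ((norm \<xi>)\<^sup>2 * t / 16)))) \<in> L2_space"
    unfolding L2_space_def mem_Collect_eq sq using gauss_integral(1)[OF s] by simp
  have "L2_norm (\<lambda>\<xi>::'a. complex_of_real (exp (- ((norm \<xi>)\<^sup>2 * t / 16)))) = sqrt ((sqrt (2 * pi) / sqrt (t / 4)) ^ DIM('a))"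
    unfolding L2_norm_def sq gauss_integral(2)[OF s] ..
  also have "sqrt (2 * pi) / sqrt (t / 4) = sqrt (8 * pi) * t powr (- 1 / 2)"
  proof -
    have "sqrt (2 * pi) / sqrt (t / 4) = sqrt (2 * pi / (t / 4))" by (rule real_sqrt_divide[symmetric])
    also have "2 * pi / (t / 4) = (8 * pi) / t" using t by simp
    finally show ?thesis using t by (simp add: real_sqrt_divide powr_minus powr_half_sqrt field_simps)
  qed
  also have "(sqrt (8 * pi) * t powr (- 1 / 2)) ^ DIM('a) = sqrt (8 * pi) ^ DIM('a) * (t powr (- real DIM('a) / 4))\<^sup>2"
  proof -
    have "(t powr (- 1 / 2)) ^ DIM('a) = t powr (real DIM('a) * (- 1 / 2))"
      by (subst powr_realpow[symmetric]) (use t in \<open>auto simp: powr_powr mult.commute\<close>)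
    moreover have "(t powr (- real DIM('a) / 4))\<^sup>2 = t powr (real DIM('a) * (- 1 / 2))"
      by (simp add: power2_eq_square flip: powr_add)
    ultimately show ?thesis by (simp add: power_mult_distrib)
  qed
  also have "sqrt \<dots> = sqrt (sqrt (8 * pi) ^ DIM('a)) * t powr (- real DIM('a) / 4)"
    by (simp add: real_sqrt_mult)
  finally show "L2_norm (\<lambda>\<xi>::'a. complex_of_real (exp (- ((norm \<xi>)\<^sup>2 * t / 16))))
      = sqrt (sqrt (8 * pi) ^ DIM('a)) * t powr (- real DIM('a) / 4)" .
qed

text \<open>The Fourier transform of the Bessel potential \<open>(1 - \<Delta>)\<^bsup>s/2\<^esup> f\<close>.\<close>

definition bessel_fourier :: "real \<Rightarrow> ('a::euclidean_space \<Rightarrow> complex) \<Rightarrow> 'a \<Rightarrow> complex" where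
  "bessel_fourier s f \<xi> = complex_of_real ((1 + (norm \<xi>)\<^sup>2) powr (s / 2)) * fourier f \<xi>"

lemma sobolev_bessel:
  fixes f :: "'a::euclidean_space \<Rightarrow> complex"
  assumes "f \<in> sobolev s"
  shows "bessel_fourier s f \<in> L2_space" "L2_norm (bessel_fourier s f) = sobolev_norm s f"
    and "s \<ge> 0 \<Longrightarrow> norm \<xi> powr s * norm (fourier f \<xi>) \<le> norm (bessel_fourier s f \<xi>)"
proof -
  let ?g = "bessel_fourier s f"
  note D = sobolevD[OF assms(1)]
  have pos: "0 < 1 + (norm \<xi>)\<^sup>2" for \<xi> :: 'a by (simp add: add_pos_nonneg)
  have sq: "(norm (?g \<xi>))\<^sup>2 = (1 + (norm \<xi>)\<^sup>2) powr s * (norm (fourier f \<xi>))\<^sup>2" for \<xi>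
  proof -
    have "((1 + (norm \<xi>)\<^sup>2) powr (s / 2))\<^sup>2 = (1 + (norm \<xi>)\<^sup>2) powr s"
      by (simp add: power2_eq_square flip: powr_add)
    then show ?thesis unfolding bessel_fourier_def by (simp add: norm_mult power_mult_distrib)
  qed
  have "?g \<in> borel_measurable borel"
    unfolding bessel_fourier_def[abs_def] using L2_spaceD(1)[OF D(3)] by measurable
  then show "?g \<in> L2_space" using D(4) by (simp add: L2_space_def sq)
  show "L2_norm ?g = sobolev_norm s f" unfolding L2_norm_def sobolev_norm_def sq ..
  show "norm \<xi> powr s * norm (fourier f \<xi>) \<le> norm (?g \<xi>)" if "s \<ge> 0"
  proof -
    have "norm \<xi> powr s = ((norm \<xi>)\<^sup>2) powr (s / 2)"
      by (cases "\<xi> = 0") (simp_all add: powr_powr flip: powr_numeral)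
    also have "\<dots> \<le> (1 + (norm \<xi>)\<^sup>2) powr (s / 2)" using that by (intro powr_mono2) auto
    finally show ?thesis unfolding bessel_fourier_def by (simp add: norm_mult mult_right_mono)
  qed
qed

text \<open>A single pointwise bound covers all frequencies: the heat kernel term is used for \<open>\<bar>\<xi>\<bar> \<le> 1\<close>
  and the two Sobolev terms for \<open>\<bar>\<xi>\<bar> > 1\<close>.\<close>

lemma fourier_profile_bound:
  fixes u\<^sub>0 u\<^sub>1 :: "'a::euclidean_space \<Rightarrow> complex"
  assumes l: "l \<ge> 0" and u0: "u\<^sub>0 \<in> sobolev (l + 1)" "u\<^sub>0 \<in> L11_space" and u1: "u\<^sub>1 \<in> sobolev l" "u\<^sub>1 \<in> L11_space"
    and sol: "cauchy_solution u\<^sub>0 u\<^sub>1 u" and t: "t \<ge> 1"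
  defines "K \<equiv> 2 * (2 * (l + 5)) powr ((l + 5) / 2) + (2 * (l + 4)) powr ((l + 4) / 2)"
    and "c \<equiv> sqrt (sqrt (8 * pi) ^ DIM('a))"
    and "d \<equiv> \<lambda>\<xi>. fourier (u t) \<xi> - profile u\<^sub>0 u\<^sub>1 t \<xi>"
  shows "d \<in> L2_space"
    and "L2_norm d \<le> (80 * c + K) * data_size l u\<^sub>0 u\<^sub>1 * max (t powr (- real DIM('a) / 4)) (t powr (- (l + 3) / 2))"
proof -
  have t0: "t > 0" "t \<ge> 0" using t by auto
  note F = cauchy_solution_fourier[OF u0(1) u1(1) sol t0(1)]
  define g where "g = (\<lambda>\<xi>::'a. complex_of_real (exp (- ((norm \<xi>)\<^sup>2 * t / 16))))"
  define h e where "h = bessel_fourier l u\<^sub>1" and "e = bessel_fourier (l + 1) u\<^sub>0"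
  note G = L2_norm_heat[OF t0(1), where 'a = 'a, folded g_def c_def]
  note H = sobolev_bessel[OF u1(1), folded h_def] and E = sobolev_bessel[OF u0(1), folded e_def]
  define J where "J = L11_norm u\<^sub>0 + L11_norm u\<^sub>1"
  define \<tau> where "\<tau> = t powr (- (l + 3) / 2)"
  have J0: "0 \<le> J" by (simp add: J_def L11_norm_nonneg)
  have K0: "0 \<le> K" by (simp add: K_def)
  have \<tau>0: "0 \<le> \<tau>" by (simp add: \<tau>_def)
  have c0: "0 \<le> c" by (simp add: c_def)
  have dm: "d \<in> borel_measurable borel"
  proof -
    have [measurable]: "fourier (u t) \<in> borel_measurable borel" "fourier u\<^sub>0 \<in> borel_measurable borel" "fourier u\<^sub>1 \<in> borel_measurable borel"
      using has_fourier_L2D(2)[OF F(1)] sobolevD(3)[OF u0(1)] sobolevD(3)[OF u1(1)] L2_spaceD(1) by auto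
    show ?thesis unfolding d_def profile_def by measurable
  qed
  have "AE \<xi> in lborel. \<xi> \<noteq> (0::'a)" by (rule AE_lborel_singleton)
  then have le: "AE \<xi> in lborel. norm (d \<xi>) \<le> (80 * J) * norm (g \<xi>) + (K * \<tau>) * norm (h \<xi>) + (K * \<tau>) * norm (e \<xi>)"
    using AE_osc_nonzero F(2)
  proof eventually_elim
    case (elim \<xi>)
    define r where "r = norm \<xi>"
    have r: "0 < r" "osc r \<noteq> 0" using elim by (auto simp: r_def)
    have y: "fourier (u t) \<xi> = fourier u\<^sub>1 \<xi> * fund r t
        + fourier u\<^sub>0 \<xi> * (mode 1 r t - char_root 1 r * fund r t)"
      by (rule solution_via_fund) (use elim in \<open>auto simp: r_def\<close>)
    have d: "d \<xi> = fourier (u t) \<xi> - profile_at (fourier u\<^sub>0 \<xi>) (fourier u\<^sub>1 \<xi>) t r"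
      by (simp add: d_def profile_def profile_at_def r_def)
    have nn: "0 \<le> (80 * J) * norm (g \<xi>)" "0 \<le> (K * \<tau>) * norm (h \<xi>)" "0 \<le> (K * \<tau>) * norm (e \<xi>)"
      using J0 K0 \<tau>0 by simp_all
    show ?case
    proof (cases "r \<le> 1")
      case True
      have "norm (d \<xi>) \<le> 80 * exp (- (r\<^sup>2 * t / 16)) * (norm (fourier u\<^sub>0 \<xi>) + norm (fourier u\<^sub>1 \<xi>))"
        unfolding d by (rule low_frequency_bound[OF r(1) True t0(2) r(2) y])
      also have "\<dots> \<le> 80 * exp (- (r\<^sup>2 * t / 16)) * J"
        unfolding J_def by (intro mult_left_mono add_mono norm_fourier_le_L11 u0 u1) auto
      also have "\<dots> = (80 * J) * norm (g \<xi>)" by (simp add: g_def r_def)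
      finally show ?thesis using nn by linarith
    next
      case False
      then have "1 \<le> r" by simp
      from high_frequency_bound[OF this t l y]
      have "norm (d \<xi>) \<le> K * \<tau> * (r powr l * norm (fourier u\<^sub>1 \<xi>) + r powr (l + 1) * norm (fourier u\<^sub>0 \<xi>))"
        unfolding d K_def \<tau>_def .
      also have "\<dots> \<le> K * \<tau> * (norm (h \<xi>) + norm (e \<xi>))"
        unfolding r_def using K0 \<tau>0 l by (intro mult_left_mono add_mono H(3) E(3)) auto
      finally show ?thesis using nn by (simp add: distrib_left)
    qed
  qed
  note C = L2_norm_le_combination[OF dm G(1) H(1) E(1) _ _ _ le]
  show "d \<in> L2_space" using C(2) J0 K0 \<tau>0 by simp
  define m where "m = max (t powr (- real DIM('a) / 4)) \<tau>"
  define s where "s = sobolev_norm l u\<^sub>1 + sobolev_norm (l + 1) u\<^sub>0"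
  have s0: "0 \<le> s" by (simp add: s_def sobolev_norm_nonneg)
  have m0: "0 \<le> m" using \<tau>0 by (simp add: m_def)
  have "L2_norm d \<le> (80 * J) * (c * t powr (- real DIM('a) / 4)) + (K * \<tau>) * sobolev_norm l u\<^sub>1 + (K * \<tau>) * sobolev_norm (l + 1) u\<^sub>0"
    using C(1) J0 K0 \<tau>0 by (simp only: G(2) H(2) E(2)) simp
  also have "\<dots> = (80 * J * c) * t powr (- real DIM('a) / 4) + (K * s) * \<tau>"
    by (simp add: s_def algebra_simps)
  also have "\<dots> \<le> (80 * J * c) * m + (K * s) * m"
    using J0 K0 c0 s0 by (intro add_mono mult_left_mono) (auto simp: m_def)
  also have "\<dots> \<le> (80 * (J + s) * c) * m + (K * (J + s)) * m"
    using J0 K0 c0 s0 m0 by (intro add_mono mult_right_mono mult_left_mono) auto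
  also have "\<dots> = (80 * c + K) * data_size l u\<^sub>0 u\<^sub>1 * m"
    by (simp add: data_size_def J_def s_def algebra_simps)
  finally show "L2_norm d \<le> (80 * c + K) * data_size l u\<^sub>0 u\<^sub>1 * max (t powr (- real DIM('a) / 4)) (t powr (- (l + 3) / 2))"
    unfolding m_def \<tau>_def .
qed

lemma data_size_nonneg: "0 \<le> data_size l u\<^sub>0 u\<^sub>1"
  by (simp add: data_size_def sobolev_norm_nonneg L11_norm_nonneg)

theorem theorem3p1:
  fixes l :: real
  assumes "CARD('n::finite) \<ge> 7"
  shows "\<exists>C>0. \<forall>(u\<^sub>0 :: real ^ 'n \<Rightarrow> complex) (u\<^sub>1 :: real ^ 'n \<Rightarrow> complex)
      (u :: real \<Rightarrow> real ^ 'n \<Rightarrow> complex).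
    u\<^sub>0 \<in> sobolev (l + 1) \<inter> L11_space \<longrightarrow>
    u\<^sub>1 \<in> sobolev l \<inter> L11_space \<longrightarrow>
    u \<in> X2 \<longrightarrow> cauchy_solution u\<^sub>0 u\<^sub>1 u \<longrightarrow>
    (\<forall>t\<ge>1.
      (CARD('n) \<ge> 10 \<and> 2 \<le> l \<and> l \<le> real CARD('n) / 2 - 3 \<longrightarrow>
        (\<lambda>\<xi>. fourier (u t) \<xi> - profile u\<^sub>0 u\<^sub>1 t \<xi>) \<in> L2_space \<and>
        L2_norm (\<lambda>\<xi>. fourier (u t) \<xi> - profile u\<^sub>0 u\<^sub>1 t \<xi>)
          \<le> C * data_size l u\<^sub>0 u\<^sub>1 * t powr (- (l + 3) / 2)) \<and>
      ((CARD('n) \<in> {7, 8, 9} \<and> 2 \<le> l \<and> l < real CARD('n) / 2 - 1) \<or>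
       (CARD('n) \<ge> 10 \<and> real CARD('n) / 2 - 3 < l \<and> l < real CARD('n) / 2 - 1) \<longrightarrow>
        (\<lambda>\<xi>. fourier (u t) \<xi> - profile u\<^sub>0 u\<^sub>1 t \<xi>) \<in> L2_space \<and>
        L2_norm (\<lambda>\<xi>. fourier (u t) \<xi> - profile u\<^sub>0 u\<^sub>1 t \<xi>)
          \<le> C * data_size l u\<^sub>0 u\<^sub>1 * t powr (- real CARD('n) / 4)))"
proof -
  define n where "n = real CARD('n)"
  define C where "C = 80 * sqrt (sqrt (8 * pi) ^ CARD('n))
      + (2 * (2 * (l + 5)) powr ((l + 5) / 2) + (2 * (l + 4)) powr ((l + 4) / 2))"
  have "0 < C"
    unfolding C_def by (intro add_pos_nonneg) auto
  have bound: "(\<lambda>\<xi>. fourier (u t) \<xi> - profile u\<^sub>0 u\<^sub>1 t \<xi>) \<in> L2_space"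
    "L2_norm (\<lambda>\<xi>. fourier (u t) \<xi> - profile u\<^sub>0 u\<^sub>1 t \<xi>) \<le> C * data_size l u\<^sub>0 u\<^sub>1 * t powr p"
    if "u\<^sub>0 \<in> sobolev (l + 1) \<inter> L11_space" "u\<^sub>1 \<in> sobolev l \<inter> L11_space" "cauchy_solution u\<^sub>0 u\<^sub>1 u" "t \<ge> 1" "l \<ge> 0"
      and p: "- n / 4 \<le> p" "- (l + 3) / 2 \<le> p"
    for u\<^sub>0 u\<^sub>1 :: "real ^ 'n \<Rightarrow> complex" and u t p
  proof -
    note B = fourier_profile_bound[of l u\<^sub>0 u\<^sub>1 u t]
    show "(\<lambda>\<xi>. fourier (u t) \<xi> - profile u\<^sub>0 u\<^sub>1 t \<xi>) \<in> L2_space" using B(1) that by simp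
    have "L2_norm (\<lambda>\<xi>. fourier (u t) \<xi> - profile u\<^sub>0 u\<^sub>1 t \<xi>)
        \<le> C * data_size l u\<^sub>0 u\<^sub>1 * max (t powr (- n / 4)) (t powr (- (l + 3) / 2))"
      using B(2) that unfolding C_def n_def by simp
    also have "\<dots> \<le> C * data_size l u\<^sub>0 u\<^sub>1 * t powr p"
      using \<open>0 < C\<close> p \<open>t \<ge> 1\<close> by (intro mult_left_mono max.boundedI powr_mono mult_nonneg_nonneg data_size_nonneg) auto
    finally show "L2_norm (\<lambda>\<xi>. fourier (u t) \<xi> - profile u\<^sub>0 u\<^sub>1 t \<xi>) \<le> C * data_size l u\<^sub>0 u\<^sub>1 * t powr p" .
  qed
  \<comment> \<open>The rates are equal for \<open>l = n / 2 - 3\<close>. For \<open>n \<le> 9\<close> this value is below \<open>2\<close>, and \<open>l\<close> exceeds it.\<close>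
  have 1: "2 \<le> l \<Longrightarrow> l \<le> n / 2 - 3 \<Longrightarrow> l \<ge> 0 \<and> - n / 4 \<le> - (l + 3) / 2"
    by (simp add: field_simps)
  have 2: "l \<ge> 0 \<and> - (l + 3) / 2 \<le> - n / 4"
    if "(CARD('n) \<in> {7, 8, 9} \<and> 2 \<le> l \<and> l < n / 2 - 1) \<or> (CARD('n) \<ge> 10 \<and> n / 2 - 3 < l \<and> l < n / 2 - 1)"
    using that by (auto simp: n_def field_simps)
  show ?thesis
    unfolding n_def[symmetric]
    by (intro exI[of _ C] conjI \<open>0 < C\<close> allI impI; (elim conjE)?) (use bound 1 2 in \<open>blast intro: order_refl\<close>)+
qed

end
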